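(* Let $R$ be a trinomial algebra of Type $1$ over an algebraically closed field $\Bbbk$ of characteristic zero, with the torus $\mathbb T$ acting on it as described in the context. (i) Any nonzero $\mathbb T$-homogeneous locally nilpotent derivation $\delta$ of $R$ is of the form $\delta=h\,\partial/\partial S_k$ for some $k\in\{1,\dots,d\}$ and some $\mathbb T$-homogeneous $h\in\ker \partial/\partial S_k$, or of the form $\delta=h\,\delta_C$ for some admissible tuple $C$ and some $\mathbb T$-homogeneous $h\in\ker\delta_C$. (ii) For every $k$, any $\mathbb T$-homogeneous element $h\in\ker\partial/\partial S_k$ is of the form $$h=F\prod_{i,j} T_{ij}^{\alpha_{ij}}\prod_{p\neq k} S_p^{\gamma_p},$$ where $F$ is a polynomial in the elements $T_i^{l_i/d_i}$, $i=1,\dots,r$, with $d_i=\gcd(l_{i1},\dots,l_{in_i})$, and $\alpha_{ij},\gamma_p\in\mathbb Z_{\ge0}$. (iii) For every admissible tuple $C=(c_1,\dots,c_r)$, any $\mathbb T$-homogeneous element $h\in\ker\delta_C$ is of the form $$h=\lambda\prod_{i,\; j\neq c_i} T_{ij}^{\alpha_{ij}}\prod_p S_p^{\gamma_p},$$ where $\lambda\in\Bbbk$ and $\alpha_{ij},\gamma_p\in\mathbb Z_{\ge0}$.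
   Context: Trinomial algebra of Type $1$: fix integers $r\ge2$, $d\ge0$, $n_i\ge1$ ($i=1,\dots,r$), positive integers $l_{ij}$ ($1\le j\le n_i$), and pairwise distinct $a_1,\dots,a_r\in\Bbbk$. Put $T_i^{l_i}=\prod_{j=1}^{n_i}T_{ij}^{l_{ij}}$. Then $R$ is the quotient of the polynomial algebra $\Bbbk[T_{ij},S_k\mid 1\le i\le r,\,1\le j\le n_i,\,1\le k\le d]$ by the ideal generated by $T_i^{l_i}-T_{i+1}^{l_{i+1}}-(a_{i+1}-a_i)$, $i=1,\dots,r-1$. (It is a normal domain.) If an integer $a$ divides $l_{ij}$ for all $j$, then $T_i^{l_i/a}$ denotes $\prod_{j}T_{ij}^{l_{ij}/a}$. Torus: the torus of dimension $\sum_i n_i+d$ acts on the variables $T_{ij},S_k$ by scaling each of them; $\mathbb H$ is the subgroup of elements for which all monomials $T_i^{l_i}$ are invariant, and $\mathbb T$ is the identity component of $\mathbb H$. It acts on $R$, so $R$ is graded by the character lattice of $\mathbb T$. "$\mathbb T$-homogeneous" refers to this grading; a derivation $\delta$ is $\mathbb T$-homogeneous if there is a degree $e$ with $\delta(R_g)\subseteq R_{g+e}$ for all $g$. A derivation $\delta$ is locally nilpotent if for each $f\in R$ there is $n>0$ with $\delta^n(f)=0$. The derivation $\partial/\partial S_k$ of $R$ sends $S_k$ to $1$ and all the other generators to $0$. A tuple $C=(c_1,\dots,c_r)$ with $1\le c_i\le n_i$ is called admissible here if $l_{ic_i}=1$ for all $i$ except possibly one index $i_0$. For an admissible $C$, $\delta_C$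 is the derivation of $R$ given by $\delta_C(T_{ic_i})=\prod_{k\ne i}\frac{\partial T_k^{l_k}}{\partial T_{kc_k}}$, $\delta_C(T_{ij})=0$ for $j\ne c_i$, and $\delta_C(S_k)=0$ for all $k$ (it is well defined on $R$, locally nilpotent and $\mathbb T$-homogeneous). *)

theory Defs
  imports
    "HOL-Library.Poly_Mapping"
    "HOL-Computational_Algebra.Polynomial"
    "HOL-Analysis.Function_Topology"
    "HOL-Algebra.QuotRing"
begin

section \<open>Polynomials in a set of variables\<close>

type_synonym ('v, 'k) mpol = "('v \<Rightarrow>\<^sub>0 nat) \<Rightarrow>\<^sub>0 'k"

definition mvar :: "'v \<Rightarrow> ('v, 'k::comm_ring_1) mpol" where
  "mvar v = Poly_Mapping.single (Poly_Mapping.single v 1) 1"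

definition mconst :: "'k::comm_ring_1 \<Rightarrow> ('v, 'k) mpol" where
  "mconst c = Poly_Mapping.single 0 c"

definition poly_ring :: "'v set \<Rightarrow> ('v, 'k::comm_ring_1) mpol ring" where
  "poly_ring V =
    \<lparr>carrier = {f. \<forall>m\<in>Poly_Mapping.keys f. Poly_Mapping.keys m \<subseteq> V}, mult = (*), one = 1, zero = 0, add = (+)\<rparr>"

text \<open>Evaluation of \<open>f\<close> at \<open>x\<close>, with \<open>\<phi>\<close> applied to the coefficients.\<close>

definition mp_eval ::
  "('k::comm_ring_1 \<Rightarrow> 'b::comm_ring_1) \<Rightarrow> ('v \<Rightarrow> 'b) \<Rightarrow> ('v, 'k) mpol \<Rightarrow> 'b" where
  "mp_eval \<phi> x f = (\<Sum>m\<in>Poly_Mapping.keys f. \<phi> (Poly_Mapping.lookup f m) * (\<Prod>v\<in>Poly_Mapping.keys m. x v ^ Poly_Mapping.lookup m v))"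

abbreviation eval_at :: "('v \<Rightarrow> 'k::comm_ring_1) \<Rightarrow> ('v, 'k) mpol \<Rightarrow> 'k" where
  "eval_at \<equiv> mp_eval (\<lambda>c. c)"

abbreviation subst_vars :: "('v \<Rightarrow> ('w, 'k::comm_ring_1) mpol) \<Rightarrow> ('v, 'k) mpol \<Rightarrow> ('w, 'k) mpol" where
  "subst_vars \<equiv> mp_eval mconst"

definition pd :: "'v \<Rightarrow> ('v, 'k::comm_ring_1) mpol \<Rightarrow> ('v, 'k) mpol" where
  "pd v f = (\<Sum>m\<in>Poly_Mapping.keys f.
     Poly_Mapping.single (m - Poly_Mapping.single v 1) (of_nat (Poly_Mapping.lookup m v) * Poly_Mapping.lookup f m))"

definition vec_field ::
  "'v set \<Rightarrow> ('v \<Rightarrow> ('v, 'k::comm_ring_1) mpol) \<Rightarrow> ('v, 'k) mpol \<Rightarrow> ('v, 'k) mpol" where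
  "vec_field V g f = (\<Sum>v\<in>V. g v * pd v f)"


section \<open>Derivations\<close>

text \<open>An algebra is given by a ring \<open>A\<close> together with the structure map \<open>\<iota>\<close> from the field.\<close>

definition derivation :: "('x, 'm) ring_scheme \<Rightarrow> ('k \<Rightarrow> 'x) \<Rightarrow> ('x \<Rightarrow> 'x) \<Rightarrow> bool" where
  "derivation A \<iota> \<delta> \<longleftrightarrow>
     \<delta> \<in> carrier A \<rightarrow> carrier A \<and>
     (\<forall>f\<in>carrier A. \<forall>g\<in>carrier A. \<delta> (f \<oplus>\<^bsub>A\<^esub> g) = \<delta> f \<oplus>\<^bsub>A\<^esub> \<delta> g) \<and>
     (\<forall>c. \<forall>f\<in>carrier A. \<delta> (\<iota> c \<otimes>\<^bsub>A\<^esub> f) = \<iota> c \<otimes>\<^bsub>A\<^esub> \<delta> f) \<and>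
     (\<forall>f\<in>carrier A. \<forall>g\<in>carrier A.
        \<delta> (f \<otimes>\<^bsub>A\<^esub> g) = (\<delta> f \<otimes>\<^bsub>A\<^esub> g) \<oplus>\<^bsub>A\<^esub> (f \<otimes>\<^bsub>A\<^esub> \<delta> g))"

definition locally_nilpotent :: "('x, 'm) ring_scheme \<Rightarrow> ('x \<Rightarrow> 'x) \<Rightarrow> bool" where
  "locally_nilpotent A \<delta> \<longleftrightarrow> (\<forall>f\<in>carrier A. \<exists>n>0. (\<delta> ^^ n) f = \<zero>\<^bsub>A\<^esub>)"


section \<open>Trinomial algebras of Type 1\<close>

datatype tvar = TV nat nat | SV nat

definition tri_vars :: "nat \<Rightarrow> (nat \<Rightarrow> nat) \<Rightarrow> nat \<Rightarrow> tvar set" where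
  "tri_vars r n d = {TV i j |i j. i \<in> {1..r} \<and> j \<in> {1..n i}} \<union> {SV k |k. k \<in> {1..d}}"

definition tri_mon ::
  "(nat \<Rightarrow> nat) \<Rightarrow> (nat \<Rightarrow> nat \<Rightarrow> nat) \<Rightarrow> nat \<Rightarrow> (tvar, 'k::comm_ring_1) mpol" where
  "tri_mon n l i = (\<Prod>j = 1..n i. mvar (TV i j) ^ l i j)"

definition tri_gcd :: "(nat \<Rightarrow> nat) \<Rightarrow> (nat \<Rightarrow> nat \<Rightarrow> nat) \<Rightarrow> nat \<Rightarrow> nat" where
  "tri_gcd n l i = Gcd (l i ` {1..n i})"

definition tri_ideal ::
  "nat \<Rightarrow> (nat \<Rightarrow> nat) \<Rightarrow> nat \<Rightarrow> (nat \<Rightarrow> nat \<Rightarrow> nat) \<Rightarrow> (nat \<Rightarrow> 'k::comm_ring_1) \<Rightarrow> (tvar, 'k) mpol set"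
  where
  "tri_ideal r n d l a = Idl\<^bsub>poly_ring (tri_vars r n d)\<^esub>
     ((\<lambda>i. tri_mon n l i - tri_mon n l (i + 1) - mconst (a (i + 1) - a i)) ` {1..r - 1})"

definition tri_alg ::
  "nat \<Rightarrow> (nat \<Rightarrow> nat) \<Rightarrow> nat \<Rightarrow> (nat \<Rightarrow> nat \<Rightarrow> nat) \<Rightarrow> (nat \<Rightarrow> 'k::comm_ring_1)
    \<Rightarrow> (tvar, 'k) mpol set ring" where
  "tri_alg r n d l a = poly_ring (tri_vars r n d) Quot tri_ideal r n d l a"

definition tri_cls ::
  "nat \<Rightarrow> (nat \<Rightarrow> nat) \<Rightarrow> nat \<Rightarrow> (nat \<Rightarrow> nat \<Rightarrow> nat) \<Rightarrow> (nat \<Rightarrow> 'k::comm_ring_1)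
    \<Rightarrow> (tvar, 'k) mpol \<Rightarrow> (tvar, 'k) mpol set" where
  "tri_cls r n d l a f = tri_ideal r n d l a +>\<^bsub>poly_ring (tri_vars r n d)\<^esub> f"

abbreviation tri_const ::
  "nat \<Rightarrow> (nat \<Rightarrow> nat) \<Rightarrow> nat \<Rightarrow> (nat \<Rightarrow> nat \<Rightarrow> nat) \<Rightarrow> (nat \<Rightarrow> 'k::comm_ring_1)
    \<Rightarrow> 'k \<Rightarrow> (tvar, 'k) mpol set" where
  "tri_const r n d l a c \<equiv> tri_cls r n d l a (mconst c)"

text \<open>The map on the quotient induced by the derivation \<open>X\<^sub>v \<mapsto> g v\<close> of the polynomial ring;
  it is well defined if the latter preserves the ideal. This holds for \<open>dS\<close>, which annihilates the
  generators of the ideal, and for \<open>deltaC\<close>, which sends every monomial \<open>tri_mon n l i\<close> to the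
  same product of partial derivatives \<open>\<Prod>k\<in>{1..r}. pd (TV k (c k)) (tri_mon n l k)\<close>.\<close>

definition tri_induced ::
  "nat \<Rightarrow> (nat \<Rightarrow> nat) \<Rightarrow> nat \<Rightarrow> (nat \<Rightarrow> nat \<Rightarrow> nat) \<Rightarrow> (nat \<Rightarrow> 'k::comm_ring_1)
    \<Rightarrow> (tvar \<Rightarrow> (tvar, 'k) mpol) \<Rightarrow> (tvar, 'k) mpol set \<Rightarrow> (tvar, 'k) mpol set" where
  "tri_induced r n d l a g A =
     the_elem ((\<lambda>f. tri_cls r n d l a (vec_field (tri_vars r n d) g f)) ` A)"

definition dS ::
  "nat \<Rightarrow> (nat \<Rightarrow> nat) \<Rightarrow> nat \<Rightarrow> (nat \<Rightarrow> nat \<Rightarrow> nat) \<Rightarrow> (nat \<Rightarrow> 'k::comm_ring_1)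
    \<Rightarrow> nat \<Rightarrow> (tvar, 'k) mpol set \<Rightarrow> (tvar, 'k) mpol set" where
  "dS r n d l a k = tri_induced r n d l a (\<lambda>v. if v = SV k then 1 else 0)"

definition admissible :: "nat \<Rightarrow> (nat \<Rightarrow> nat) \<Rightarrow> (nat \<Rightarrow> nat \<Rightarrow> nat) \<Rightarrow> (nat \<Rightarrow> nat) \<Rightarrow> bool" where
  "admissible r n l c \<longleftrightarrow>
     (\<forall>i\<in>{1..r}. c i \<in> {1..n i}) \<and> (\<exists>i0\<in>{1..r}. \<forall>i\<in>{1..r} - {i0}. l i (c i) = 1)"

fun deltaC_gen ::
  "nat \<Rightarrow> (nat \<Rightarrow> nat) \<Rightarrow> (nat \<Rightarrow> nat \<Rightarrow> nat) \<Rightarrow> (nat \<Rightarrow> nat) \<Rightarrow> tvar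
    \<Rightarrow> (tvar, 'k::comm_ring_1) mpol" where
  "deltaC_gen r n l c (TV i j) =
     (if j = c i then \<Prod>k\<in>{1..r} - {i}. pd (TV k (c k)) (tri_mon n l k) else 0)"
| "deltaC_gen r n l c (SV k) = 0"

definition deltaC ::
  "nat \<Rightarrow> (nat \<Rightarrow> nat) \<Rightarrow> nat \<Rightarrow> (nat \<Rightarrow> nat \<Rightarrow> nat) \<Rightarrow> (nat \<Rightarrow> 'k::comm_ring_1)
    \<Rightarrow> (nat \<Rightarrow> nat) \<Rightarrow> (tvar, 'k) mpol set \<Rightarrow> (tvar, 'k) mpol set" where
  "deltaC r n d l a c = tri_induced r n d l a (deltaC_gen r n l c)"


section \<open>The torus and the grading\<close>

text \<open>Points of the torus with coordinates indexed by \<open>V\<close> are extended by \<open>1\<close> outside \<open>V\<close>, so that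
  the group operation is the pointwise product.\<close>

definition std_torus :: "'v set \<Rightarrow> ('v \<Rightarrow> 'k::field) set" where
  "std_torus V = {t. (\<forall>v\<in>V. t v \<noteq> 0) \<and> (\<forall>v. v \<notin> V \<longrightarrow> t v = 1)}"

definition zariski_torus :: "'v set \<Rightarrow> ('v \<Rightarrow> 'k::field) topology" where
  "zariski_torus V = topology_generated_by
     ((\<lambda>f. {t \<in> std_torus V. eval_at t f \<noteq> 0}) ` carrier (poly_ring V))"

definition torus_act :: "('v \<Rightarrow> 'k::comm_ring_1) \<Rightarrow> ('v, 'k) mpol \<Rightarrow> ('v, 'k) mpol" where
  "torus_act t = subst_vars (\<lambda>v. mconst (t v) * mvar v)"

definition tri_H :: "nat \<Rightarrow> (nat \<Rightarrow> nat) \<Rightarrow> nat \<Rightarrow> (nat \<Rightarrow> nat \<Rightarrow> nat) \<Rightarrow> (tvar \<Rightarrow> 'k::field) set" where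
  "tri_H r n d l = {t \<in> std_torus (tri_vars r n d).
     \<forall>i\<in>{1..r}. torus_act t (tri_mon n l i) = tri_mon n l i}"

definition tri_T :: "nat \<Rightarrow> (nat \<Rightarrow> nat) \<Rightarrow> nat \<Rightarrow> (nat \<Rightarrow> nat \<Rightarrow> nat) \<Rightarrow> (tvar \<Rightarrow> 'k::field) set" where
  "tri_T r n d l = connected_component_of_set
     (subtopology (zariski_torus (tri_vars r n d)) (tri_H r n d l)) (\<lambda>_. 1)"

text \<open>Characters of a closed subgroup \<open>G\<close> of the torus: homomorphisms to the multiplicative group
  that are regular, i.e. restrictions of elements of the coordinate ring of the torus, the polynomial
  ring localized at the product of all variables. They are written multiplicatively, and the values
  outside \<open>G\<close> play no role.\<close>

definition characters :: "'v set \<Rightarrow> ('v \<Rightarrow> 'k::field) set \<Rightarrow> (('v \<Rightarrow> 'k) \<Rightarrow> 'k) set" where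
  "characters V G = {\<chi>.
     (\<forall>t\<in>G. \<chi> t \<noteq> 0) \<and>
     (\<forall>s\<in>G. \<forall>t\<in>G. \<chi> (\<lambda>v. s v * t v) = \<chi> s * \<chi> t) \<and>
     (\<exists>f\<in>carrier (poly_ring V). \<exists>N. \<forall>t\<in>G. \<chi> t = eval_at t f / (\<Prod>v\<in>V. t v) ^ N)}"

abbreviation tri_chars ::
  "nat \<Rightarrow> (nat \<Rightarrow> nat) \<Rightarrow> nat \<Rightarrow> (nat \<Rightarrow> nat \<Rightarrow> nat) \<Rightarrow> ((tvar \<Rightarrow> 'k::field) \<Rightarrow> 'k) set" where
  "tri_chars r n d l \<equiv> characters (tri_vars r n d) (tri_T r n d l)"

text \<open>Elements of the quotient are cosets, on which \<open>t\<close> acts by taking images.\<close>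

definition tri_weight_space ::
  "nat \<Rightarrow> (nat \<Rightarrow> nat) \<Rightarrow> nat \<Rightarrow> (nat \<Rightarrow> nat \<Rightarrow> nat) \<Rightarrow> (nat \<Rightarrow> 'k::field)
    \<Rightarrow> ((tvar \<Rightarrow> 'k) \<Rightarrow> 'k) \<Rightarrow> (tvar, 'k) mpol set set" where
  "tri_weight_space r n d l a \<chi> = {f \<in> carrier (tri_alg r n d l a).
     \<forall>t\<in>tri_T r n d l. torus_act t ` f = tri_const r n d l a (\<chi> t) \<otimes>\<^bsub>tri_alg r n d l a\<^esub> f}"

definition homogeneous_elem ::
  "nat \<Rightarrow> (nat \<Rightarrow> nat) \<Rightarrow> nat \<Rightarrow> (nat \<Rightarrow> nat \<Rightarrow> nat) \<Rightarrow> (nat \<Rightarrow> 'k::field)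
    \<Rightarrow> (tvar, 'k) mpol set \<Rightarrow> bool" where
  "homogeneous_elem r n d l a f \<longleftrightarrow> (\<exists>\<chi>\<in>tri_chars r n d l. f \<in> tri_weight_space r n d l a \<chi>)"

definition homogeneous_der ::
  "nat \<Rightarrow> (nat \<Rightarrow> nat) \<Rightarrow> nat \<Rightarrow> (nat \<Rightarrow> nat \<Rightarrow> nat) \<Rightarrow> (nat \<Rightarrow> 'k::field)
    \<Rightarrow> ((tvar, 'k) mpol set \<Rightarrow> (tvar, 'k) mpol set) \<Rightarrow> bool" where
  "homogeneous_der r n d l a \<delta> \<longleftrightarrow> (\<exists>\<epsilon>\<in>tri_chars r n d l. \<forall>\<chi>\<in>tri_chars r n d l.
     \<delta> ` tri_weight_space r n d l a \<chi> \<subseteq> tri_weight_space r n d l a (\<lambda>t. \<chi> t * \<epsilon> t))"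

end

theory Submission
  imports Defs "HOL-Computational_Algebra.Polynomial_FPS"
begin

text \<open>In \<open>R\<close> the element \<open>x = T\<^sub>i\<^bsup>l\<^sub>i\<^esup> + a\<^sub>i\<close> does not depend on \<open>i\<close>. Write \<open>x = x\<^sub>0 + t\<close> with \<open>x\<^sub>0\<close> different from
  all \<open>a\<^sub>i\<close> and send each \<open>T\<^sub>i\<^sub>j\<close> to a root of \<open>x - a\<^sub>i\<close> in \<open>k[[t]]\<close> times a Laurent monomial recording its weight.
  Over \<open>k[x]\<close> the algebra \<open>R\<close> is spanned by the monomials divisible by no \<open>T\<^sub>i\<^bsup>l\<^sub>i\<^esup>\<close>; those of equal weight go to
  hyperexponential series whose logarithmic derivatives differ by non-integral residues, and such series are
  linearly independent over \<open>k(t)\<close>. So \<open>R\<close> embeds into a domain of Laurent polynomials over \<open>k[[t]]\<close>.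

  Since \<open>\<T>\<close> contains the one-parameter subgroups of \<open>\<H>\<close>, a homogeneous element is the class of a polynomial whose
  monomials have one common weight. If \<open>\<delta>\<close> is locally nilpotent, \<open>f\<close> divides \<open>\<delta> f\<close> only if \<open>\<delta> f = 0\<close>. Comparing the
  weights of the monomials of \<open>\<delta> T\<^sub>i\<^sub>j\<close> and \<open>\<delta> S\<^sub>k\<close>, this leaves two cases: \<open>\<delta>\<close> moves a single \<open>S\<^sub>k\<close>, or it moves
  exactly one variable \<open>T\<^sub>i\<^sub>c\<close> of each block. In the second case the exponents of two of these variables cannot
  both exceed \<open>1\<close>, by a degree count in \<open>b P\<^sup>m - b' Q\<^sup>n = const\<close>, and the same comparison of weights shows
  that \<open>\<delta> T\<^sub>i\<^sub>c\<close> is divisible by the partial derivatives in \<open>\<delta>\<^sub>C T\<^sub>i\<^sub>c\<close>. The kernel of \<open>\<delta>\<^sub>C\<close> is factorially closed,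
  and when \<open>C\<close> is admissible a homogeneous element is a monomial times a polynomial in one variable, which splits
  into linear factors.\<close>

section \<open>Polynomials\<close>

text \<open>Formulated for all finitely supported maps, so that it serves polynomials as well as
  their exponent vectors.\<close>

lemma mpol_induct [case_names zero single add]:
  fixes f :: "'a \<Rightarrow>\<^sub>0 'b::comm_monoid_add"
  assumes "P 0" "\<And>m c. P (Poly_Mapping.single m c)" "\<And>f g. P f \<Longrightarrow> P g \<Longrightarrow> P (f + g)"
  shows "P f"
proof (induction f rule: update_induct)
  case const then show ?case using assms(1) .
next
  case (update f a b)
  have "Poly_Mapping.update a b f = f + Poly_Mapping.single a b"
    using update(1) by (intro poly_mapping_eqI)
      (auto simp: lookup_update lookup_add lookup_single when_def in_keys_iff)
  then show ?case using assms(2,3) update by simp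
qed

lemma mpol_eq_sum_single: "f = (\<Sum>m\<in>Poly_Mapping.keys f. Poly_Mapping.single m (Poly_Mapping.lookup f m))"
proof (rule poly_mapping_eqI)
  fix k
  show "Poly_Mapping.lookup f k = Poly_Mapping.lookup (\<Sum>m\<in>Poly_Mapping.keys f. Poly_Mapping.single m (Poly_Mapping.lookup f m)) k"
    by (simp add: lookup_sum lookup_single when_def in_keys_iff sum.delta)
qed

text \<open>At a torus point \<open>t\<close> this is the character by which \<open>t\<close> scales
  the monomial; at \<open>mvar\<close> it gives back the monomial itself.\<close>

definition mon_eval :: "('v \<Rightarrow> 'b::comm_monoid_mult) \<Rightarrow> ('v \<Rightarrow>\<^sub>0 nat) \<Rightarrow> 'b" where
  "mon_eval x m = (\<Prod>v\<in>Poly_Mapping.keys m. x v ^ Poly_Mapping.lookup m v)"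

lemma mon_eval_superset:
  assumes "finite A" "Poly_Mapping.keys m \<subseteq> A"
  shows "mon_eval x m = (\<Prod>v\<in>A. x v ^ Poly_Mapping.lookup m v)"
  unfolding mon_eval_def by (rule prod.mono_neutral_left) (use assms in \<open>auto simp: in_keys_iff\<close>)

lemma mon_eval_0 [simp]: "mon_eval x 0 = 1"
  by (simp add: mon_eval_def)

lemma mon_eval_single [simp]: "mon_eval x (Poly_Mapping.single v k) = x v ^ k"
  by (simp add: mon_eval_def)

lemma mon_eval_add: "mon_eval x (m + m') = mon_eval x m * mon_eval x m'"
proof -
  let ?A = "Poly_Mapping.keys m \<union> Poly_Mapping.keys m'"
  have "Poly_Mapping.keys (m + m') \<subseteq> ?A" by (rule keys_add)
  then show ?thesis
    by (simp add: mon_eval_superset[of ?A] lookup_add power_add prod.distrib)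
qed

lemma mon_eval_sum: "mon_eval x (\<Sum>i\<in>A. m i) = (\<Prod>i\<in>A. mon_eval x (m i))"
  by (induction A rule: infinite_finite_induct) (auto simp: mon_eval_add)

lemma mon_eval_cong: "(\<And>v. v \<in> Poly_Mapping.keys m \<Longrightarrow> x v = y v) \<Longrightarrow> mon_eval x m = mon_eval y m"
  by (simp add: mon_eval_def)

lemma mon_eval_mult: "mon_eval (\<lambda>v. x v * y v) m = mon_eval x m * mon_eval y m"
  by (simp add: mon_eval_def power_mult_distrib prod.distrib)

lemma mon_eval_mvar: "mon_eval mvar m = (Poly_Mapping.single m 1 :: ('v, 'k::comm_ring_1) mpol)"
proof (induction m rule: mpol_induct)
  case zero then show ?case by simp
next
  case (single v k)
  have "mvar v ^ k = (Poly_Mapping.single (Poly_Mapping.single v k) 1 :: ('v, 'k) mpol)"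
    by (induction k) (auto simp: mvar_def mult_single simp flip: single_add)
  then show ?case by simp
next
  case (add f g) then show ?case by (simp add: mon_eval_add mult_single)
qed

lemma mp_eval_alt: "mp_eval \<phi> x f = (\<Sum>m\<in>Poly_Mapping.keys f. \<phi> (Poly_Mapping.lookup f m) * mon_eval x m)"
  by (simp add: mp_eval_def mon_eval_def)

text \<open>Evaluation along such a homomorphism is again one (\<open>eval_hom\<close>), so the
  rules below also serve \<open>torus_act\<close>, \<open>NF\<close>, \<open>\<Phi>\<close> and
  substitutions.\<close>

locale coeff_hom =
  fixes \<phi> :: "'k::comm_ring_1 \<Rightarrow> 'b::comm_ring_1"
  assumes zero [simp]: "\<phi> 0 = 0" and one [simp]: "\<phi> 1 = 1"
    and add: "\<phi> (a + b) = \<phi> a + \<phi> b" and mult: "\<phi> (a * b) = \<phi> a * \<phi> b"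
begin

lemma uminus: "\<phi> (- a) = - \<phi> a"
  using add[of a "- a"] by (simp add: eq_neg_iff_add_eq_0 add.commute)

lemma diff: "\<phi> (a - b) = \<phi> a - \<phi> b"
  using add[of a "- b"] by (simp add: uminus)

lemma power: "\<phi> (a ^ k) = \<phi> a ^ k"
  by (induction k) (auto simp: mult)

lemma sum: "\<phi> (\<Sum>i\<in>A. f i) = (\<Sum>i\<in>A. \<phi> (f i))"
  by (induction A rule: infinite_finite_induct) (auto simp: add)

lemma prod: "\<phi> (\<Prod>i\<in>A. f i) = (\<Prod>i\<in>A. \<phi> (f i))"
  by (induction A rule: infinite_finite_induct) (auto simp: mult)

lemma of_nat: "\<phi> (of_nat k) = of_nat k"
  by (induction k) (auto simp: add)

lemma eval_superset:
  assumes "finite A" "Poly_Mapping.keys f \<subseteq> A"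
  shows "mp_eval \<phi> x f = (\<Sum>m\<in>A. \<phi> (Poly_Mapping.lookup f m) * mon_eval x m)"
  unfolding mp_eval_alt by (rule sum.mono_neutral_left) (use assms in \<open>auto simp: in_keys_iff\<close>)

lemma eval_single: "mp_eval \<phi> x (Poly_Mapping.single m c) = \<phi> c * mon_eval x m"
  by (simp add: mp_eval_alt)

lemma eval_add: "mp_eval \<phi> x (f + g) = mp_eval \<phi> x f + mp_eval \<phi> x g"
proof -
  let ?A = "Poly_Mapping.keys f \<union> Poly_Mapping.keys g"
  have "Poly_Mapping.keys (f + g) \<subseteq> ?A" by (rule keys_add)
  then show ?thesis
    by (simp add: eval_superset[of ?A] lookup_add add distrib_right sum.distrib)
qed

lemma eval_mult: "mp_eval \<phi> x (f * g) = mp_eval \<phi> x f * mp_eval \<phi> x g"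
proof (induction f rule: mpol_induct)
  case zero then show ?case by (simp add: mp_eval_alt)
next
  case (single m c)
  show ?case
  proof (induction g rule: mpol_induct)
    case zero then show ?case by (simp add: mp_eval_alt)
  next
    case (single m' c') then show ?case by (simp add: mult_single eval_single mon_eval_add mult)
  next
    case (add f g) then show ?case by (simp add: eval_add distrib_left)
  qed
next
  case (add f g) then show ?case by (simp add: eval_add distrib_right)
qed

lemma eval_hom: "coeff_hom (mp_eval \<phi> x)"
proof
  show "mp_eval \<phi> x 0 = 0" by (simp add: mp_eval_alt)
  show "mp_eval \<phi> x 1 = 1" using eval_single[of x 0 1] by simp
qed (simp_all add: eval_add eval_mult)

lemma eval_mvar: "mp_eval \<phi> x (mvar v) = x v"
  by (simp add: mvar_def eval_single)

lemma eval_mconst: "mp_eval \<phi> x (mconst c) = \<phi> c"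
  by (simp add: mconst_def eval_single)

end

lemma coeff_hom_mconst: "coeff_hom mconst"
  by unfold_locales (auto simp: mconst_def single_add mult_single)

lemma coeff_hom_id: "coeff_hom (\<lambda>c. c)"
  by unfold_locales auto

interpretation mconst: coeff_hom "mconst :: 'k::comm_ring_1 \<Rightarrow> ('v, 'k) mpol"
  by (rule coeff_hom_mconst)

lemma single_eq_mconst_mult: "Poly_Mapping.single m c = mconst c * Poly_Mapping.single m 1"
  by (simp add: mconst_def mult_single)

section \<open>Polynomials with variables in a given set\<close>

lemma poly_ring_carrier: "f \<in> carrier (poly_ring V) \<longleftrightarrow> (\<forall>m\<in>Poly_Mapping.keys f. Poly_Mapping.keys m \<subseteq> V)"
  by (simp add: poly_ring_def)

lemma pr_single: "Poly_Mapping.keys m \<subseteq> V \<Longrightarrow> Poly_Mapping.single m c \<in> carrier (poly_ring V)"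
  by (auto simp: poly_ring_carrier)

lemma pr_0 [simp]: "0 \<in> carrier (poly_ring V)" and pr_1 [simp]: "1 \<in> carrier (poly_ring V)"
  by (auto simp: poly_ring_carrier)

lemma pr_mconst [simp]: "mconst c \<in> carrier (poly_ring V)"
  unfolding mconst_def by (rule pr_single) auto

lemma pr_mvar [simp]: "v \<in> V \<Longrightarrow> mvar v \<in> carrier (poly_ring V)"
  unfolding mvar_def by (rule pr_single) auto

lemma pr_add [simp]: "f \<in> carrier (poly_ring V) \<Longrightarrow> g \<in> carrier (poly_ring V) \<Longrightarrow> f + g \<in> carrier (poly_ring V)"
  using keys_add[of f g] by (auto simp: poly_ring_carrier)

lemma pr_uminus [simp]: "f \<in> carrier (poly_ring V) \<Longrightarrow> - f \<in> carrier (poly_ring V)"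
  by (auto simp: poly_ring_carrier in_keys_iff)

lemma pr_diff [simp]: "f \<in> carrier (poly_ring V) \<Longrightarrow> g \<in> carrier (poly_ring V) \<Longrightarrow> f - g \<in> carrier (poly_ring V)"
  using pr_add[of f V "- g"] by simp

lemma pr_mult [simp]: "f \<in> carrier (poly_ring V) \<Longrightarrow> g \<in> carrier (poly_ring V) \<Longrightarrow> f * g \<in> carrier (poly_ring V)"
  unfolding poly_ring_carrier
proof
  fix m assume fg: "\<forall>m\<in>Poly_Mapping.keys f. Poly_Mapping.keys m \<subseteq> V" "\<forall>m\<in>Poly_Mapping.keys g. Poly_Mapping.keys m \<subseteq> V"
    and "m \<in> Poly_Mapping.keys (f * g)"
  then obtain p q where "m = p + q" "p \<in> Poly_Mapping.keys f" "q \<in> Poly_Mapping.keys g"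
    using keys_mult[of f g] by auto
  then show "Poly_Mapping.keys m \<subseteq> V" using fg keys_add[of p q] by blast
qed

lemma pr_power [simp]: "f \<in> carrier (poly_ring V) \<Longrightarrow> f ^ k \<in> carrier (poly_ring V)"
  by (induction k) auto

lemma pr_sum: "(\<And>i. i \<in> A \<Longrightarrow> f i \<in> carrier (poly_ring V)) \<Longrightarrow> (\<Sum>i\<in>A. f i) \<in> carrier (poly_ring V)"
  by (induction A rule: infinite_finite_induct) auto

lemma pr_prod: "(\<And>i. i \<in> A \<Longrightarrow> f i \<in> carrier (poly_ring V)) \<Longrightarrow> (\<Prod>i\<in>A. f i) \<in> carrier (poly_ring V)"
  by (induction A rule: infinite_finite_induct) auto

lemma pr_induct [consumes 1, case_names const var add mult]:
  assumes "f \<in> carrier (poly_ring V)"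
    and const: "\<And>c. P (mconst c)" and var: "\<And>v. v \<in> V \<Longrightarrow> P (mvar v)"
    and add: "\<And>f g. f \<in> carrier (poly_ring V) \<Longrightarrow> g \<in> carrier (poly_ring V) \<Longrightarrow> P f \<Longrightarrow> P g \<Longrightarrow> P (f + g)"
    and mult: "\<And>f g. f \<in> carrier (poly_ring V) \<Longrightarrow> g \<in> carrier (poly_ring V) \<Longrightarrow> P f \<Longrightarrow> P g \<Longrightarrow> P (f * g)"
  shows "P f"
proof -
  have one: "P 1" using const[of 1] by simp
  have pow: "P (mvar v ^ k)" if "v \<in> V" for v k
    by (induction k) (use that one var mult in auto)
  have prod: "P (\<Prod>v\<in>A. mvar v ^ k v)" if "A \<subseteq> V" for A k
    using that by (induction A rule: infinite_finite_induct)
      (auto intro!: mult pow one pr_prod)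
  have mon: "P (Poly_Mapping.single m c)" if "Poly_Mapping.keys m \<subseteq> V" for m c
    using that unfolding single_eq_mconst_mult[of m c]
    by (intro mult const) (auto simp: mon_eval_def prod simp flip: mon_eval_mvar intro!: pr_prod)
  have "P (\<Sum>m\<in>A. Poly_Mapping.single m (Poly_Mapping.lookup f m))" if "A \<subseteq> Poly_Mapping.keys f" for A
    using that assms(1) const[of 0]
    by (induction A rule: infinite_finite_induct)
      (auto intro!: add mon pr_sum pr_single simp: poly_ring_carrier[of f V])
  from this[OF order.refl] show ?thesis by (simp flip: mpol_eq_sum_single)
qed

lemma poly_ring_simps [simp]:
  "\<zero>\<^bsub>poly_ring V\<^esub> = 0" "\<one>\<^bsub>poly_ring V\<^esub> = 1" "x \<oplus>\<^bsub>poly_ring V\<^esub> y = x + y" "x \<otimes>\<^bsub>poly_ring V\<^esub> y = x * y"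
  by (auto simp: poly_ring_def)

lemma cring_poly_ring: "cring (poly_ring V)"
proof (rule cringI)
  show "abelian_group (poly_ring V)"
  proof (rule abelian_groupI)
    fix x assume "x \<in> carrier (poly_ring V)"
    then show "\<exists>y\<in>carrier (poly_ring V). y \<oplus>\<^bsub>poly_ring V\<^esub> x = \<zero>\<^bsub>poly_ring V\<^esub>"
      by (intro bexI[of _ "- x"]) simp_all
  qed (simp_all add: add_ac)
  show "Group.comm_monoid (poly_ring V)"
    by (rule comm_monoidI) (simp_all add: mult_ac)
qed (simp_all add: distrib_right)

subsection \<open>Partial derivatives\<close>

lemma pd_superset:
  assumes "finite A" "Poly_Mapping.keys f \<subseteq> A"
  shows "pd v f = (\<Sum>m\<in>A. Poly_Mapping.single (m - Poly_Mapping.single v 1) (of_nat (Poly_Mapping.lookup m v) * Poly_Mapping.lookup f m))"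
  unfolding pd_def by (rule sum.mono_neutral_left) (use assms in \<open>auto simp: in_keys_iff\<close>)

lemma pd_single: "pd v (Poly_Mapping.single m c) = Poly_Mapping.single (m - Poly_Mapping.single v 1) (of_nat (Poly_Mapping.lookup m v) * c)"
  by (simp add: pd_def)

lemma pd_add: "pd v (f + g) = pd v f + pd v g"
proof -
  let ?A = "Poly_Mapping.keys f \<union> Poly_Mapping.keys g"
  have "Poly_Mapping.keys (f + g) \<subseteq> ?A" by (rule keys_add)
  then show ?thesis
    by (simp add: pd_superset[of ?A] lookup_add distrib_left single_add sum.distrib)
qed

lemma pd_0 [simp]: "pd v 0 = 0" by (simp add: pd_def)

lemma pd_mult: "pd v (f * g) = pd v f * g + f * pd v g"
proof (induction f rule: mpol_induct)
  case (single m c)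
  show ?case
  proof (induction g rule: mpol_induct)
    case (single m' c')
    \<comment> \<open>For a zero exponent of \<open>v\<close> the truncated subtraction breaks this
      identity, but the coefficient vanishes then as well.\<close>
    have 1: "m - Poly_Mapping.single v 1 + m' = m + m' - Poly_Mapping.single v 1" if "Poly_Mapping.lookup m v \<noteq> 0" for m m' :: "'a \<Rightarrow>\<^sub>0 nat"
      using that by (intro poly_mapping_eqI) (auto simp: lookup_add lookup_minus lookup_single when_def)
    show ?case
      using 1[of m m'] 1[of m' m]
      by (cases "Poly_Mapping.lookup m v = 0"; cases "Poly_Mapping.lookup m' v = 0")
        (auto simp: mult_single pd_single lookup_add algebra_simps simp flip: single_add)
  next
    case (add f g) then show ?case by (simp add: pd_add algebra_simps)
  qed auto
next
  case (add f g) then show ?case by (simp add: pd_add algebra_simps)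
qed auto

lemma pd_mconst [simp]: "pd v (mconst c) = 0"
  by (simp add: mconst_def pd_single)

lemma pd_mvar: "pd v (mvar w) = (if v = w then 1 else 0)"
  by (auto simp: mvar_def pd_single lookup_single when_def)

lemma vec_field_add: "vec_field V g (f + f') = vec_field V g f + vec_field V g f'"
  by (simp add: vec_field_def pd_add distrib_left sum.distrib)

lemma vec_field_mult: "vec_field V g (f * f') = vec_field V g f * f' + f * vec_field V g f'"
  by (simp add: vec_field_def pd_mult distrib_left sum.distrib sum_distrib_left sum_distrib_right mult_ac)

lemma vec_field_mconst [simp]: "vec_field V g (mconst c) = 0"
  by (simp add: vec_field_def)

lemma vec_field_mvar: "finite V \<Longrightarrow> w \<in> V \<Longrightarrow> vec_field V g (mvar w) = g w"
  by (simp add: vec_field_def pd_mvar if_distrib cong: if_cong)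

lemma vec_field_in:
  assumes "finite V" "\<And>v. v \<in> V \<Longrightarrow> g v \<in> carrier (poly_ring V)" "f \<in> carrier (poly_ring V)"
  shows "vec_field V g f \<in> carrier (poly_ring V)"
  using assms(3) by (induction f rule: pr_induct) (auto simp: vec_field_mvar vec_field_add vec_field_mult assms)

subsection \<open>Scaling\<close>

lemma mon_eval_mconst: "mon_eval (\<lambda>v. mconst (t v)) m = mconst (mon_eval t m)"
  by (simp add: mon_eval_def mconst.prod mconst.power)

lemma lookup_torus_act: "Poly_Mapping.lookup (torus_act t f) m = mon_eval t m * Poly_Mapping.lookup f m"
proof (induction f rule: mpol_induct)
  case zero then show ?case by (simp add: torus_act_def mp_eval_alt)
next
  case (single m' c)
  have "torus_act t (Poly_Mapping.single m' c) = mconst c * (mconst (mon_eval t m') * Poly_Mapping.single m' 1)"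
    by (simp add: torus_act_def mon_eval_mconst mconst.eval_single mon_eval_mult mon_eval_mvar)
  also have "\<dots> = Poly_Mapping.single m' (mon_eval t m' * c)"
    by (simp add: mconst_def mult_single mult.commute)
  finally show ?case by (simp add: lookup_single when_def)
next
  case (add f g)
  then show ?case by (simp add: torus_act_def mconst.eval_add lookup_add algebra_simps)
qed

lemma torus_act_hom: "coeff_hom (torus_act t)"
  unfolding torus_act_def by (rule mconst.eval_hom)

lemma torus_act_single: "torus_act t (Poly_Mapping.single m c) = Poly_Mapping.single m (mon_eval t m * c)"
  by (rule poly_mapping_eqI) (simp add: lookup_torus_act lookup_single when_def)

lemma torus_act_in: "f \<in> carrier (poly_ring V) \<Longrightarrow> torus_act t f \<in> carrier (poly_ring V)"
  by (auto simp: poly_ring_carrier in_keys_iff lookup_torus_act)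

section \<open>Locally nilpotent derivations of domains\<close>

text \<open>The derivation lives on a subring \<open>B\<close> of a domain given as a type: later
  \<open>B\<close> is the image of \<open>\<Phi>\<close> in a ring of Laurent polynomials, which
  stands for the quotient \<open>R\<close>.\<close>

locale domain_der =
  fixes B :: "'a::{idom, semiring_char_0} set" and \<Delta> :: "'a \<Rightarrow> 'a"
  assumes one_in: "1 \<in> B"
    and add_in: "f \<in> B \<Longrightarrow> g \<in> B \<Longrightarrow> f + g \<in> B"
    and uminus_in: "f \<in> B \<Longrightarrow> - f \<in> B"
    and mult_in: "f \<in> B \<Longrightarrow> g \<in> B \<Longrightarrow> f * g \<in> B"
    and der_in: "f \<in> B \<Longrightarrow> \<Delta> f \<in> B"
    and der_add: "f \<in> B \<Longrightarrow> g \<in> B \<Longrightarrow> \<Delta> (f + g) = \<Delta> f + \<Delta> g"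
    and der_mult: "f \<in> B \<Longrightarrow> g \<in> B \<Longrightarrow> \<Delta> (f * g) = \<Delta> f * g + f * \<Delta> g"
begin

lemma zero_in: "0 \<in> B"
  using add_in[OF one_in uminus_in[OF one_in]] by simp

lemma diff_in: "f \<in> B \<Longrightarrow> g \<in> B \<Longrightarrow> f - g \<in> B"
  using add_in[of f "- g"] uminus_in by simp

lemma power_in: "f \<in> B \<Longrightarrow> f ^ k \<in> B"
  by (induction k) (auto simp: one_in mult_in)

lemma sum_in: "(\<And>i. i \<in> A \<Longrightarrow> f i \<in> B) \<Longrightarrow> (\<Sum>i\<in>A. f i) \<in> B"
  by (induction A rule: infinite_finite_induct) (auto simp: zero_in add_in)

lemma of_nat_in: "of_nat k \<in> B"
  by (induction k) (auto simp: zero_in one_in add_in)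

lemma iter_in: "f \<in> B \<Longrightarrow> (\<Delta> ^^ n) f \<in> B"
  by (induction n) (auto simp: der_in)

lemma der_0: "\<Delta> 0 = 0"
  using der_add[OF zero_in zero_in] by simp

lemma der_1: "\<Delta> 1 = 0"
  using der_mult[OF one_in one_in] by simp

lemma der_uminus: "f \<in> B \<Longrightarrow> \<Delta> (- f) = - \<Delta> f"
  using der_add[of f "- f"] uminus_in by (simp add: der_0 eq_neg_iff_add_eq_0 add.commute)

lemma der_diff: "f \<in> B \<Longrightarrow> g \<in> B \<Longrightarrow> \<Delta> (f - g) = \<Delta> f - \<Delta> g"
  using der_add[of f "- g"] uminus_in by (simp add: der_uminus)

lemma der_of_nat: "\<Delta> (of_nat k) = 0"
  by (induction k) (auto simp: der_0 der_1 der_add one_in of_nat_in)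

lemma der_of_nat_mult: "f \<in> B \<Longrightarrow> \<Delta> (of_nat k * f) = of_nat k * \<Delta> f"
  by (simp add: der_mult of_nat_in der_of_nat)

lemma der_sum: "(\<And>i. i \<in> A \<Longrightarrow> f i \<in> B) \<Longrightarrow> \<Delta> (\<Sum>i\<in>A. f i) = (\<Sum>i\<in>A. \<Delta> (f i))"
  by (induction A rule: infinite_finite_induct) (auto simp: der_0 der_add sum_in)

lemma der_power: "f \<in> B \<Longrightarrow> \<Delta> (f ^ Suc k) = of_nat (Suc k) * f ^ k * \<Delta> f"
  by (induction k) (auto simp: der_mult power_in der_1 one_in mult_in algebra_simps)

lemma der_power_ker: "f \<in> B \<Longrightarrow> \<Delta> f = 0 \<Longrightarrow> \<Delta> (f ^ k) = 0"
  by (cases k) (auto simp: der_power der_1 simp del: power_Suc)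

lemma iter_0: "(\<Delta> ^^ n) 0 = 0"
  by (induction n) (auto simp: der_0)

lemma iter_zero_mono: "(\<Delta> ^^ m) f = 0 \<Longrightarrow> m \<le> n \<Longrightarrow> (\<Delta> ^^ n) f = 0"
  by (metis add_diff_inverse_nat funpow_add comp_apply iter_0 not_less add.commute)

lemma leibniz:
  assumes "f \<in> B" "g \<in> B"
  shows "(\<Delta> ^^ n) (f * g) = (\<Sum>k\<le>n. of_nat (n choose k) * ((\<Delta> ^^ k) f * (\<Delta> ^^ (n - k)) g))"
proof (induction n)
  case 0 then show ?case by simp
next
  case (Suc n)
  let ?t = "\<lambda>i j. (\<Delta> ^^ i) f * (\<Delta> ^^ j) g"
  have B: "?t i j \<in> B" for i j using assms by (simp add: iter_in mult_in)
  have "(\<Delta> ^^ Suc n) (f * g) = (\<Sum>k\<le>n. of_nat (n choose k) * (?t (Suc k) (n - k) + ?t k (Suc (n - k))))"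
    using assms by (simp add: Suc der_sum B mult_in of_nat_in der_of_nat_mult)
      (simp add: der_mult iter_in)
  also have "\<dots> = (\<Sum>k\<le>n. of_nat (n choose k) * ?t (Suc k) (n - k)) + (\<Sum>k\<le>n. of_nat (n choose k) * ?t k (Suc n - k))"
    by (simp add: distrib_left sum.distrib Suc_diff_le)
  also have "(\<Sum>k\<le>n. of_nat (n choose k) * ?t k (Suc n - k)) = (\<Sum>k\<le>Suc n. of_nat (n choose k) * ?t k (Suc n - k))"
    by simp
  also have "\<dots> = ?t 0 (Suc n) + (\<Sum>k\<le>n. of_nat (n choose Suc k) * ?t (Suc k) (n - k))"
    by (subst sum.atMost_Suc_shift) simp
  also have "(\<Sum>k\<le>n. of_nat (n choose k) * ?t (Suc k) (n - k)) + (?t 0 (Suc n) + (\<Sum>k\<le>n. of_nat (n choose Suc k) * ?t (Suc k) (n - k)))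
     = ?t 0 (Suc n) + (\<Sum>k\<le>n. of_nat (Suc n choose Suc k) * ?t (Suc k) (n - k))"
    by (simp add: sum.distrib algebra_simps)
  also have "\<dots> = (\<Sum>k\<le>Suc n. of_nat (Suc n choose k) * ?t k (Suc n - k))"
    by (subst sum.atMost_Suc_shift) simp
  finally show ?case .
qed

lemma nilpotent_add:
  assumes "f \<in> B" "g \<in> B" "(\<Delta> ^^ m) f = 0" "(\<Delta> ^^ n) g = 0"
  shows "(\<Delta> ^^ (m + n)) (f + g) = 0"
proof -
  have "(\<Delta> ^^ k) (f + g) = (\<Delta> ^^ k) f + (\<Delta> ^^ k) g" for k
    by (induction k) (auto simp: der_add iter_in assms)
  then show ?thesis using iter_zero_mono[OF assms(3), of "m + n"] iter_zero_mono[OF assms(4), of "m + n"] by simp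
qed

lemma nilpotent_mult:
  assumes "f \<in> B" "g \<in> B" "(\<Delta> ^^ m) f = 0" "(\<Delta> ^^ n) g = 0"
  shows "(\<Delta> ^^ (m + n)) (f * g) = 0"
  unfolding leibniz[OF assms(1,2)]
proof (intro sum.neutral ballI)
  fix k
  show "of_nat (m + n choose k) * ((\<Delta> ^^ k) f * (\<Delta> ^^ (m + n - k)) g) = 0"
    using iter_zero_mono[OF assms(3), of k] iter_zero_mono[OF assms(4), of "m + n - k"]
    by (cases "m \<le> k") auto
qed

end

section \<open>The degree function of a locally nilpotent derivation\<close>

locale lnd = domain_der +
  assumes nilp: "f \<in> B \<Longrightarrow> \<exists>n. (\<Delta> ^^ n) f = 0"
begin

text \<open>The largest number of applications of \<open>\<Delta>\<close> that leave a nonzero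
  \<open>f\<close> nonzero. By convention \<open>deg 0 = 0\<close>, so nonvanishing has to be
  assumed where degrees add.\<close>

definition deg :: "'a \<Rightarrow> nat" where "deg f = (LEAST n. (\<Delta> ^^ Suc n) f = 0)"

lemma deg_zero: "f \<in> B \<Longrightarrow> (\<Delta> ^^ Suc (deg f)) f = 0"
proof -
  assume "f \<in> B"
  then obtain n where "(\<Delta> ^^ n) f = 0" using nilp by blast
  then have "(\<Delta> ^^ Suc n) f = 0" using iter_zero_mono by (metis le_SucI order.refl)
  then show ?thesis unfolding deg_def by (rule LeastI)
qed

lemma deg_nonzero: assumes "f \<noteq> 0" shows "(\<Delta> ^^ deg f) f \<noteq> 0"
proof (cases "deg f")
  case 0 then show ?thesis using assms by simp
next
  case (Suc n)
  then have "n < deg f" by simp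
  then have "(\<Delta> ^^ Suc n) f \<noteq> 0" unfolding deg_def by (rule not_less_Least)
  then show ?thesis by (simp add: Suc)
qed

lemma deg_eqI: assumes "f \<in> B" "(\<Delta> ^^ n) f \<noteq> 0" "(\<Delta> ^^ Suc n) f = 0" shows "deg f = n"
proof (rule antisym)
  show "deg f \<le> n" unfolding deg_def using assms(3) by (rule Least_le)
  show "n \<le> deg f"
  proof (rule ccontr)
    assume "\<not> n \<le> deg f"
    then have "(\<Delta> ^^ n) f = 0" using iter_zero_mono[OF deg_zero[OF assms(1)], of n] by simp
    then show False using assms(2) by simp
  qed
qed

lemma deg_eq_0_iff: "f \<in> B \<Longrightarrow> deg f = 0 \<longleftrightarrow> \<Delta> f = 0"
  using deg_eqI[of f 0] deg_zero[of f] by (cases "f = 0") (auto simp: deg_def der_0 Least_eq_0)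

lemma deg_der: assumes "f \<in> B" "\<Delta> f \<noteq> 0" shows "deg f = Suc (deg (\<Delta> f))"
proof (rule deg_eqI[OF assms(1)])
  show "(\<Delta> ^^ Suc (deg (\<Delta> f))) f \<noteq> 0" "(\<Delta> ^^ Suc (Suc (deg (\<Delta> f)))) f = 0"
    using deg_nonzero[OF assms(2)] deg_zero[OF der_in[OF assms(1)]] by (simp_all add: funpow_swap1)
qed

text \<open>At order \<open>deg f + deg g\<close> exactly one term of the Leibniz formula survives,
  and its binomial coefficient is nonzero in characteristic zero; one order higher none
  survives.\<close>

lemma deg_mult:
  assumes f: "f \<in> B" "f \<noteq> 0" and g: "g \<in> B" "g \<noteq> 0"
  shows "deg (f * g) = deg f + deg g"
proof (rule deg_eqI)
  have z: "(\<Delta> ^^ k) f = 0" if "k > deg f" for k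
    using iter_zero_mono[OF deg_zero[OF f(1)]] that by simp
  have z': "(\<Delta> ^^ k) g = 0" if "k > deg g" for k
    using iter_zero_mono[OF deg_zero[OF g(1)]] that by simp
  show "f * g \<in> B" using f g mult_in by blast
  let ?t = "\<lambda>n k. of_nat (n choose k) * ((\<Delta> ^^ k) f * (\<Delta> ^^ (n - k)) g)"
  let ?n = "deg f + deg g"
  have t: "?t ?n k = (if k = deg f then ?t ?n (deg f) else 0)" for k
    using z[of k] z'[of "?n - k"] by (cases "k < deg f") auto
  have "(\<Delta> ^^ ?n) (f * g) = (\<Sum>k\<le>?n. if k = deg f then ?t ?n (deg f) else 0)"
    unfolding leibniz[OF f(1) g(1)] by (rule sum.cong[OF refl]) (rule t)
  also have "\<dots> = ?t ?n (deg f)" by simp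
  also have "\<dots> \<noteq> 0" using deg_nonzero f g by (simp add: binomial_eq_0_iff)
  finally show "(\<Delta> ^^ ?n) (f * g) \<noteq> 0" .
  have "?t (Suc ?n) k = 0" for k
    using z[of k] z'[of "Suc ?n - k"] by (cases "k \<le> deg f") auto
  then show "(\<Delta> ^^ Suc ?n) (f * g) = 0"
    unfolding leibniz[OF f(1) g(1)] by (intro sum.neutral) blast
qed

text \<open>Degrees add and kernel elements have degree zero: the kernel is factorially
  closed.\<close>

lemma ker_factor:
  assumes "f \<in> B" "g \<in> B" "f * g \<noteq> 0" "\<Delta> (f * g) = 0"
  shows "\<Delta> f = 0" "\<Delta> g = 0"
  using deg_mult[of f g] assms deg_eq_0_iff mult_in by (metis add_is_0 mult_zero_left mult_zero_right)+

text \<open>Divisibility would give \<open>deg (\<Delta> f) \<ge> deg f\<close>, whereas a nonzero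
  \<open>\<Delta> f\<close> has degree one less than \<open>f\<close>.\<close>

lemma dvd_der_imp_ker:
  assumes "f \<in> B" "g \<in> B" "\<Delta> f = f * g"
  shows "\<Delta> f = 0"
proof (rule ccontr)
  assume "\<Delta> f \<noteq> 0"
  then have "f \<noteq> 0" "g \<noteq> 0" using assms(3) by auto
  then have "deg (\<Delta> f) = deg f + deg g" using assms deg_mult by simp
  then show False using deg_der[OF assms(1) \<open>\<Delta> f \<noteq> 0\<close>] by simp
qed

lemma deg_power: "f \<in> B \<Longrightarrow> f \<noteq> 0 \<Longrightarrow> deg (f ^ k) = k * deg f"
proof (induction k)
  case 0 then show ?case using deg_eq_0_iff[OF one_in] by (simp add: der_1)
next
  case (Suc k) then show ?case by (simp add: deg_mult power_in)
qed

text \<open>If \<open>b P\<^sup>m - b' Q\<^sup>n\<close> is a nonzero kernel element \<open>c\<close>, then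
  \<open>n c \<Delta> Q = b P\<^sup>m\<^sup>-\<^sup>1 (n P \<Delta> Q - m Q \<Delta> P)\<close>, so \<open>(m - 1) deg P \<le> deg Q - 1\<close>; exchange \<open>P\<close> and \<open>Q\<close>.\<close>

lemma power_diff_deg:
  assumes P: "P \<in> B" and Q: "Q \<in> B" "\<Delta> Q \<noteq> 0"
    and b: "b \<in> B" "\<Delta> b = 0" "b' \<in> B" "\<Delta> b' = 0" and c: "\<Delta> c = 0" "c \<noteq> 0"
    and eq: "b * P ^ Suc m - b' * Q ^ Suc n = c"
  shows "m * deg P < deg Q"
proof -
  define E where "E = of_nat (Suc n) * (P * \<Delta> Q) - of_nat (Suc m) * (Q * \<Delta> P)"
  have E: "E \<in> B" unfolding E_def using P Q by (intro diff_in mult_in of_nat_in der_in)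
  have cB: "c \<in> B" using eq P Q b by (auto intro!: diff_in mult_in power_in)
  have "\<Delta> (b * P ^ Suc m - b' * Q ^ Suc n) = b * \<Delta> (P ^ Suc m) - b' * \<Delta> (Q ^ Suc n)"
    using P Q b by (simp add: der_diff der_mult mult_in power_in del: power_Suc)
  then have d: "b' * (of_nat (Suc n) * Q ^ n * \<Delta> Q) = b * (of_nat (Suc m) * P ^ m * \<Delta> P)"
    using eq c P Q by (simp add: der_power del: power_Suc of_nat_Suc)
  have "of_nat (Suc n) * c * \<Delta> Q = of_nat (Suc n) * b * P ^ Suc m * \<Delta> Q - (b' * (of_nat (Suc n) * Q ^ n * \<Delta> Q)) * Q"
    unfolding eq[symmetric] by (simp add: algebra_simps del: of_nat_Suc)
  also have "\<dots> = b * P ^ m * E" unfolding d E_def by (simp add: algebra_simps del: of_nat_Suc)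
  finally have *: "of_nat (Suc n) * c * \<Delta> Q = b * P ^ m * E" .
  have nz: "of_nat (Suc n) * c * \<Delta> Q \<noteq> 0" using Q(2) c(2) by (metis mult_eq_0_iff of_nat_neq_0)
  then have nz': "b \<noteq> 0" "P ^ m \<noteq> 0" "E \<noteq> 0" unfolding * by auto
  have "m * deg P \<le> deg (P ^ m)"
    using nz'(2) deg_power[OF P, of m] deg_eq_0_iff[OF one_in] by (cases "m = 0") auto
  also have "\<dots> \<le> deg (b * P ^ m * E)"
    using nz' P b E by (simp add: deg_mult mult_in power_in)
  also have "\<dots> = deg (\<Delta> Q)"
  proof -
    have "of_nat (Suc n) * c \<noteq> 0" using nz by auto
    moreover have "deg (of_nat (Suc n) * c) = 0"
      using cB c by (subst deg_eq_0_iff) (auto simp: mult_in of_nat_in der_of_nat_mult simp del: of_nat_Suc)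
    ultimately show ?thesis
      unfolding *[symmetric] using Q cB by (simp add: deg_mult mult_in of_nat_in der_in del: of_nat_Suc)
  qed
  also have "\<dots> < deg Q" using deg_der[OF Q] by simp
  finally show ?thesis .
qed

text \<open>If both exponents were at least 2, the degree inequality and its mirror image would give
  \<open>deg P < deg Q\<close> and \<open>deg Q < deg P\<close>.\<close>

lemma power_diff_ker:
  assumes "P \<in> B" "\<Delta> P \<noteq> 0" "Q \<in> B" "\<Delta> Q \<noteq> 0"
    and b: "b \<in> B" "\<Delta> b = 0" "b' \<in> B" "\<Delta> b' = 0" and c: "\<Delta> c = 0" "c \<noteq> 0"
    and eq: "b * P ^ m - b' * Q ^ n = c" and mn: "m \<ge> 1" "n \<ge> 1"
  shows "m = 1 \<or> n = 1"
proof (rule ccontr)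
  assume "\<not> ?thesis"
  with mn obtain m' n' where m': "m = Suc (Suc m')" "n = Suc (Suc n')"
    by (metis One_nat_def Suc_le_D not0_implies_Suc)
  have "c \<in> B" using eq assms by (auto intro!: diff_in mult_in power_in)
  have "Suc m' * deg P < deg Q"
    using power_diff_deg[of P Q b b' c "Suc m'" "Suc n'"] assms m' by auto
  moreover have "Suc n' * deg Q < deg P"
    using power_diff_deg[of Q P b' b "- c" "Suc n'" "Suc m'"] assms m' der_uminus[OF \<open>c \<in> B\<close>] by auto
  ultimately show False by simp
qed

end

text \<open>Over an algebraically closed field a nonconstant \<open>p\<close> has a linear factor.
  The kernel being factorially closed, it would contain \<open>y - z\<close> for a root
  \<open>z\<close>, hence \<open>y\<close>.\<close>

lemma (in lnd) ker_poly:
  fixes p :: "'k::alg_closed_field poly" and \<iota> :: "'k \<Rightarrow> 'a"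
  assumes \<iota>: "\<And>c. \<iota> c \<in> B \<and> \<Delta> (\<iota> c) = 0" "\<And>c d. \<iota> (c + d) = \<iota> c + \<iota> d"
      "\<And>c d. \<iota> (c * d) = \<iota> c * \<iota> d" "\<iota> 0 = 0"
    and y: "y \<in> B" "\<Delta> y \<noteq> 0"
    and p: "poly (map_poly \<iota> p) y \<noteq> 0" "\<Delta> (poly (map_poly \<iota> p) y) = 0"
  shows "degree p = 0"
  using p
proof (induction "degree p" arbitrary: p)
  case (Suc n)
  have inB: "poly (map_poly \<iota> q) y \<in> B" for q
    by (induction q) (use \<iota>(4) in \<open>auto simp: map_poly_pCons zero_in \<iota> add_in mult_in y\<close>)
  obtain z where "poly p z = 0" using alg_closed_imp_poly_has_root[of p] Suc(2) by auto
  then obtain q where q: "p = [:-z, 1:] * q" by (auto simp: poly_eq_0_iff_dvd elim: dvdE)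
  have hom: "poly (map_poly \<iota> (q + q')) y = poly (map_poly \<iota> q) y + poly (map_poly \<iota> q') y" for q q'
    using \<iota>(2,4) by (induction q q' rule: poly_induct2) (auto simp: map_poly_pCons algebra_simps)
  have sm: "poly (map_poly \<iota> (smult c q)) y = \<iota> c * poly (map_poly \<iota> q) y" for c q
    using \<iota>(3,4) by (induction q) (auto simp: map_poly_pCons algebra_simps)
  have p: "p = pCons 0 q + smult (- z) q" unfolding q by simp
  have eq: "poly (map_poly \<iota> p) y = (y + \<iota> (- z)) * poly (map_poly \<iota> q) y"
    unfolding p hom sm using \<iota>(4) by (simp add: map_poly_pCons distrib_right)
  have "\<Delta> (y + \<iota> (- z)) = 0"
    using ker_factor(1)[of "y + \<iota> (- z)" "poly (map_poly \<iota> q) y"] Suc eq y \<iota>(1) inB add_in by auto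
  then show ?case using y \<iota>(1) der_add by simp
qed simp

section \<open>Independence of hyperexponential power series\<close>

definition root_prod :: "'i set \<Rightarrow> ('i \<Rightarrow> 'k::comm_ring_1) \<Rightarrow> 'k poly" where
  "root_prod J b = (\<Prod>i\<in>J. [:- b i, 1:])"

text \<open>Over the common denominator \<open>root_prod J b\<close> this is the numerator of the
  sum of the \<open>q i / (x - b i)\<close>, a logarithmic derivative with simple poles and residues
  \<open>q i\<close>.\<close>

definition log_num :: "'i set \<Rightarrow> ('i \<Rightarrow> 'k::comm_ring_1) \<Rightarrow> ('i \<Rightarrow> 'k) \<Rightarrow> 'k poly" where
  "log_num J b q = (\<Sum>i\<in>J. smult (q i) (root_prod (J - {i}) b))"

lemma poly_root_prod: "poly (root_prod J b) x = (\<Prod>i\<in>J. x - b i)"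
  by (simp add: root_prod_def poly_prod)

lemma pderiv_times_linear:
  fixes P :: "'k::{idom, ring_char_0} poly"
  shows "pderiv ([:-a, 1:] ^ n * P) * [:-a, 1:] = [:-a, 1:] ^ n * (smult (of_nat n) P + [:-a, 1:] * pderiv P)"
proof (cases n)
  case 0 then show ?thesis by (simp add: mult.commute)
next
  case (Suc k)
  have "pderiv ([:-a, 1:] ^ Suc k) = smult (of_nat (Suc k)) ([:-a, 1:] ^ k)"
    by (simp add: pderiv_power_Suc pderiv_pCons del: power_Suc of_nat_Suc)
  then show ?thesis
    unfolding Suc pderiv_mult
    by (simp add: algebra_simps smult_add_left del: mult_pCons_left mult_pCons_right)
qed

text \<open>Comparing orders at the root \<open>b i\<close>: the residue of \<open>P'/P\<close> is the order of \<open>P\<close> at \<open>b i\<close>, an integer.\<close>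

lemma log_deriv_residue:
  fixes P P0 :: "'k::field_char_0 poly"
  assumes J: "finite J" "inj_on b J" "i \<in> J" and nz: "P \<noteq> 0" "P0 \<noteq> 0"
    and eq: "P0 * (pderiv P * root_prod J b + P * log_num J b q) = P * (pderiv P0 * root_prod J b + P0 * log_num J b q0)"
  shows "q0 i - q i \<in> \<int>"
proof -
  define L where "L = [:- b i, 1:]"
  let ?Qi = "root_prod (J - {i}) b"
  obtain P1 where P1: "P = L ^ Polynomial.order (b i) P * P1" "\<not> L dvd P1"
    using order_decomp[OF nz(1)] unfolding L_def by blast
  obtain P2 where P2: "P0 = L ^ Polynomial.order (b i) P0 * P2" "\<not> L dvd P2"
    using order_decomp[OF nz(2)] unfolding L_def by blast
  define \<alpha> \<beta> where "\<alpha> = Polynomial.order (b i) P" and "\<beta> = Polynomial.order (b i) P0"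
  have Q: "root_prod J b = L * ?Qi" unfolding root_prod_def L_def using J by (simp add: prod.remove)
  have dP: "pderiv P * L = L ^ \<alpha> * (smult (of_nat \<alpha>) P1 + L * pderiv P1)"
    unfolding \<alpha>_def by (subst (1) P1(1)) (simp only: L_def pderiv_times_linear)
  have dP0: "pderiv P0 * L = L ^ \<beta> * (smult (of_nat \<beta>) P2 + L * pderiv P2)"
    unfolding \<beta>_def by (subst (1) P2(1)) (simp only: L_def pderiv_times_linear)
  \<comment> \<open>Splitting \<open>L\<close> off the denominator turns the two derivatives into
    multiples of \<open>L ^ \<alpha>\<close> and \<open>L ^ \<beta>\<close>, so that
    \<open>L ^ (\<alpha> + \<beta>)\<close> cancels.\<close>
  have "P0 * (pderiv P * L * ?Qi + P * log_num J b q) = P * (pderiv P0 * L * ?Qi + P0 * log_num J b q0)"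
    using eq unfolding Q by (simp only: mult.assoc)
  then have "L ^ (\<alpha> + \<beta>) * (P2 * ((smult (of_nat \<alpha>) P1 + L * pderiv P1) * ?Qi + P1 * log_num J b q))
     = L ^ (\<alpha> + \<beta>) * (P1 * ((smult (of_nat \<beta>) P2 + L * pderiv P2) * ?Qi + P2 * log_num J b q0))"
    unfolding dP dP0 using P1(1) P2(1) unfolding \<alpha>_def[symmetric] \<beta>_def[symmetric]
    by (simp add: power_add algebra_simps)
  then have "P2 * ((smult (of_nat \<alpha>) P1 + L * pderiv P1) * ?Qi + P1 * log_num J b q)
     = P1 * ((smult (of_nat \<beta>) P2 + L * pderiv P2) * ?Qi + P2 * log_num J b q0)"
    by (subst (asm) mult_left_cancel) (auto simp: L_def)
  then have "poly (P2 * ((smult (of_nat \<alpha>) P1 + L * pderiv P1) * ?Qi + P1 * log_num J b q)) (b i)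
     = poly (P1 * ((smult (of_nat \<beta>) P2 + L * pderiv P2) * ?Qi + P2 * log_num J b q0)) (b i)" by simp
  moreover have "poly (log_num J b q) (b i) = q i * poly ?Qi (b i)" for q
  proof -
    have "poly (root_prod (J - {j}) b) (b i) = 0" if "j \<in> J - {i}" for j
      using that J by (auto simp: poly_root_prod)
    then show ?thesis unfolding log_num_def using J by (simp add: poly_sum sum.remove[of J i])
  qed
  ultimately have "poly P1 (b i) * poly P2 (b i) * poly ?Qi (b i) * (of_nat \<alpha> + q i)
     = poly P1 (b i) * poly P2 (b i) * poly ?Qi (b i) * (of_nat \<beta> + q0 i)"
    by (simp add: L_def algebra_simps)
  moreover have "poly ?Qi (b i) \<noteq> 0" using J by (auto simp: poly_root_prod dest: inj_onD)
  moreover have "poly P1 (b i) \<noteq> 0" "poly P2 (b i) \<noteq> 0"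
    using P1(2) P2(2) by (simp_all add: poly_eq_0_iff_dvd L_def)
  ultimately have "of_nat \<alpha> + q i = of_nat \<beta> + q0 i" by simp
  then have "q0 i - q i = of_nat \<alpha> - of_nat \<beta>" by (simp add: algebra_simps)
  then show ?thesis by simp
qed

lemma fps_deriv_fps_of_poly: "fps_deriv (fps_of_poly p) = fps_of_poly (pderiv p)"
  by (rule fps_ext) (simp add: coeff_pderiv)

text \<open>Induction on the number of nonzero coefficients: differentiating a relation and
  cross-multiplying eliminates one term, and the shorter relation is trivial. Then any other nonzero
  term has the same logarithmic derivative as the eliminated one, and their residues differ by
  integers, against \<open>nonint\<close>.\<close>

lemma hyperexponential_independent:
  fixes u :: "'s \<Rightarrow> 'k::field_char_0 fps" and b :: "'i \<Rightarrow> 'k"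
  assumes S: "finite S" and J: "finite J" "inj_on b J"
    and u: "\<And>s. s \<in> S \<Longrightarrow> u s \<noteq> 0"
    and der: "\<And>s. s \<in> S \<Longrightarrow> fps_of_poly (root_prod J b) * fps_deriv (u s) = fps_of_poly (log_num J b (q s)) * u s"
    and nonint: "\<And>s s'. s \<in> S \<Longrightarrow> s' \<in> S \<Longrightarrow> s \<noteq> s' \<Longrightarrow> \<exists>i\<in>J. q s i - q s' i \<notin> \<int>"
    and rel: "(\<Sum>s\<in>S. fps_of_poly (p s) * u s) = 0"
  shows "s \<in> S \<Longrightarrow> p s = 0"
  using rel
proof (induction "card {s\<in>S. p s \<noteq> 0}" arbitrary: p s rule: less_induct)
  case less
  show ?case
  proof (rule ccontr)
    assume nz: "p s \<noteq> 0"
    define Q where "Q = root_prod J b"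
    define W where "W s = log_num J b (q s)" for s
    \<comment> \<open>The coefficients of \<open>p s\<close> times \<open>Q\<close> times the
      derivative of the relation, minus a multiple of the relation chosen so that the term at
      \<open>s\<close> cancels.\<close>
    define p' where "p' t = p s * (pderiv (p t) * Q + p t * W t) - p t * (pderiv (p s) * Q + p s * W s)" for t
    have d: "fps_of_poly Q * fps_deriv (u t) = fps_of_poly (W t) * u t" if "t \<in> S" for t
      using der that by (simp add: Q_def W_def)
    have "fps_of_poly Q * fps_deriv (\<Sum>t\<in>S. fps_of_poly (p t) * u t) = (\<Sum>t\<in>S. fps_of_poly (pderiv (p t) * Q + p t * W t) * u t)"
      unfolding fps_deriv_sum sum_distrib_left
    proof (rule sum.cong[OF refl])
      fix t assume "t \<in> S"
      have "fps_of_poly Q * fps_deriv (fps_of_poly (p t) * u t)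
        = fps_of_poly Q * fps_of_poly (pderiv (p t)) * u t + fps_of_poly (p t) * (fps_of_poly Q * fps_deriv (u t))"
        by (simp add: fps_deriv_fps_of_poly algebra_simps)
      then show "fps_of_poly Q * fps_deriv (fps_of_poly (p t) * u t) = fps_of_poly (pderiv (p t) * Q + p t * W t) * u t"
        unfolding d[OF \<open>t \<in> S\<close>] by (simp add: fps_of_poly_add fps_of_poly_mult algebra_simps)
    qed
    then have 1: "(\<Sum>t\<in>S. fps_of_poly (pderiv (p t) * Q + p t * W t) * u t) = 0"
      using less.prems(2) by simp
    have "(\<Sum>t\<in>S. fps_of_poly (p' t) * u t) =
      fps_of_poly (p s) * (\<Sum>t\<in>S. fps_of_poly (pderiv (p t) * Q + p t * W t) * u t)
      - fps_of_poly (pderiv (p s) * Q + p s * W s) * (\<Sum>t\<in>S. fps_of_poly (p t) * u t)"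
      unfolding sum_distrib_left sum_subtractf[symmetric]
    proof (rule sum.cong[OF refl])
      fix t
      have "p' t = p s * (pderiv (p t) * Q + p t * W t) - (pderiv (p s) * Q + p s * W s) * p t"
        unfolding p'_def by (simp only: mult.commute)
      then show "fps_of_poly (p' t) * u t = fps_of_poly (p s) * (fps_of_poly (pderiv (p t) * Q + p t * W t) * u t)
        - fps_of_poly (pderiv (p s) * Q + p s * W s) * (fps_of_poly (p t) * u t)"
        by (simp only: fps_of_poly_diff fps_of_poly_mult left_diff_distrib mult.assoc)
    qed
    then have rel': "(\<Sum>t\<in>S. fps_of_poly (p' t) * u t) = 0" using 1 less.prems(2) by simp
    have "{t \<in> S. p' t \<noteq> 0} \<subseteq> {t \<in> S. p t \<noteq> 0}" by (auto simp: p'_def)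
    moreover have "p' s = 0" by (simp add: p'_def)
    ultimately have "{t \<in> S. p' t \<noteq> 0} \<subset> {t \<in> S. p t \<noteq> 0}" using less.prems(1) nz by blast
    then have "card {t \<in> S. p' t \<noteq> 0} < card {t \<in> S. p t \<noteq> 0}" using S by (intro psubset_card_mono) auto
    then have p'0: "p' t = 0" if "t \<in> S" for t using less.hyps rel' that by blast
    have "p t = 0" if t: "t \<in> S" "t \<noteq> s" for t
    proof (rule ccontr)
      assume "p t \<noteq> 0"
      then have "q s i - q t i \<in> \<int>" if "i \<in> J" for i
        using log_deriv_residue[OF J that, of "p t" "p s" "q t" "q s"] nz p'0[OF t(1)] by (simp add: p'_def Q_def W_def)
      then show False using nonint[OF less.prems(1) t(1)] t(2) by auto
    qed
    then have "(\<Sum>t\<in>S. fps_of_poly (p t) * u t) = fps_of_poly (p s) * u s"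
      using less.prems(1) S by (simp add: sum.remove)
    then show False using less.prems nz u by simp
  qed
qed

text \<open>Logarithmic derivatives add: each factor contributes the residue
  \<open>e i * c i\<close> at \<open>b i\<close>.\<close>

lemma fps_log_deriv_prod:
  fixes u :: "'i \<Rightarrow> 'k::field_char_0 fps"
  assumes J: "finite J"
    and u: "\<And>i. i \<in> J \<Longrightarrow> fps_of_poly [:- b i, 1:] * fps_deriv (u i) = fps_const (c i) * u i"
  shows "fps_of_poly (root_prod J b) * fps_deriv (\<Prod>i\<in>J. u i ^ e i)
    = fps_of_poly (log_num J b (\<lambda>i. of_nat (e i) * c i)) * (\<Prod>i\<in>J. u i ^ e i)"
  using assms
proof (induction J rule: finite_induct)
  case empty then show ?case by (simp add: root_prod_def log_num_def)
next
  case (insert j J)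
  let ?L = "fps_of_poly [:- b j, 1:]" and ?U = "\<Prod>i\<in>J. u i ^ e i" and ?Q = "fps_of_poly (root_prod J b)"
  have 1: "?L * fps_deriv (u j ^ e j) = fps_const (of_nat (e j) * c j) * u j ^ e j"
  proof (cases "e j")
    case (Suc k)
    have "?L * fps_deriv (u j ^ e j) = of_nat (Suc k) * u j ^ k * (?L * fps_deriv (u j))"
      unfolding Suc fps_deriv_power' by (simp add: mult_ac del: of_nat_Suc)
    also have "\<dots> = fps_const (of_nat (e j) * c j) * u j ^ e j"
      unfolding insert.prems[OF insertI1] unfolding Suc by (simp add: mult_ac fps_of_nat[symmetric] fps_const_mult[symmetric] del: of_nat_Suc fps_const_mult)
    finally show ?thesis .
  qed simp
  have Q: "root_prod (insert j J) b = [:- b j, 1:] * root_prod J b" unfolding root_prod_def using insert(1,2) by simp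
  have W: "log_num (insert j J) b q = smult (q j) (root_prod J b) + [:- b j, 1:] * log_num J b q" for q
  proof -
    have "root_prod (insert j J - {i}) b = [:- b j, 1:] * root_prod (J - {i}) b" if "i \<in> J" for i
    proof -
      have "insert j J - {i} = insert j (J - {i})" using that insert(2) by auto
      then show ?thesis unfolding root_prod_def using insert(1,2) by simp
    qed
    then show ?thesis unfolding log_num_def using insert(1,2)
      by (simp add: sum_distrib_left del: mult_pCons_left)
  qed
  have "fps_of_poly (root_prod (insert j J) b) * fps_deriv (\<Prod>i\<in>insert j J. u i ^ e i)
    = ?Q * (?L * fps_deriv (u j ^ e j)) * ?U + ?L * u j ^ e j * (?Q * fps_deriv ?U)"
    unfolding Q fps_of_poly_mult prod.insert[OF insert(1,2)] by (simp add: algebra_simps)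
  also have "?Q * fps_deriv ?U = fps_of_poly (log_num J b (\<lambda>i. of_nat (e i) * c i)) * ?U"
    using insert by blast
  finally show ?case
    unfolding 1 W fps_of_poly_mult fps_of_poly_add fps_of_poly_smult prod.insert[OF insert(1,2)]
    by (simp add: algebra_simps)
qed

text \<open>Since \<open>- b\<close> is nonzero and has a \<open>k\<close>-th root,
  \<open>t - b\<close> has a power series radical; differentiating \<open>u ^ k = t - b\<close>
  yields the differential equation.\<close>

lemma linear_radical:
  fixes b :: "'k::{alg_closed_field, field_char_0}"
  assumes "b \<noteq> 0" "k > 0"
  obtains u where "u ^ k = fps_of_poly [:- b, 1:]"
    "fps_of_poly [:- b, 1:] * fps_deriv u = fps_const (1 / of_nat k) * u"
proof -
  let ?f = "fps_of_poly [:- b, 1:]"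
  obtain k' where k: "k = Suc k'" using assms(2) not0_implies_Suc by auto
  obtain z where z: "z ^ k = - b" using nth_root_exists[of k "- b"] assms(2) by auto
  have "fps_radical (\<lambda>_ _. z) k ?f ^ k = ?f"
    using power_radical[of ?f "\<lambda>_ _. z" k'] z assms(1) by (simp add: k)
  then obtain u where u: "u ^ k = ?f" by blast
  have nz: "u \<noteq> 0"
  proof
    assume "u = 0"
    then have "fps_nth ?f 0 = 0" using u k by simp
    then show False using assms(1) by simp
  qed
  have "fps_deriv (u ^ k) = 1" unfolding u by (simp add: fps_deriv_fps_of_poly pderiv_pCons)
  then have "of_nat k * fps_deriv u * u ^ k' = 1" unfolding k fps_deriv_power' by (simp del: of_nat_Suc)
  \<comment> \<open>Multiplying by \<open>u\<close> restores the full power \<open>u ^ k\<close>,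
    that is, \<open>t - b\<close>.\<close>
  then have "(of_nat k * fps_deriv u * u ^ k') * u = u" by simp
  then have "of_nat k * fps_deriv u * u ^ k = u" by (simp add: k mult_ac del: of_nat_Suc)
  then have "fps_const (1 / of_nat k) * (of_nat k * (?f * fps_deriv u)) = fps_const (1 / of_nat k) * u"
    unfolding u by (simp add: algebra_simps)
  moreover have "fps_const (1 / of_nat k) * (of_nat k * (?f * fps_deriv u)) = ?f * fps_deriv u"
    using assms(2) by (simp flip: fps_of_nat mult.assoc)
  ultimately show ?thesis using that[OF u] by simp
qed

section \<open>A graded model of the trinomial algebra\<close>

instance tvar :: countable by countable_datatype

text \<open>An arbitrary total order, taken from an enumeration. It induces an order on exponent
  vectors, which makes the Laurent polynomials over a domain a domain.\<close>

instantiation tvar :: linorder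
begin
definition "x \<le> y \<longleftrightarrow> to_nat (x :: tvar) \<le> to_nat y"
definition "x < y \<longleftrightarrow> to_nat (x :: tvar) < to_nat y"
instance by standard (auto simp: less_eq_tvar_def less_tvar_def)
end

abbreviation "lk \<equiv> Poly_Mapping.lookup"
abbreviation "ks \<equiv> Poly_Mapping.keys"
abbreviation "sg \<equiv> Poly_Mapping.single"

lemma mon_eval_additive:
  assumes "g 0 = 1" "\<And>m m'. g (m + m') = g m * g m'"
  shows "mon_eval (\<lambda>v. g (sg v 1)) m = g m"
proof (induction m rule: mpol_induct)
  case (single v k)
  have "g (sg v 1) ^ k = g (sg v k)"
    by (induction k) (simp_all add: assms flip: assms(2) single_add)
  then show ?case by simp
qed (simp_all add: assms mon_eval_add)

lemma (in coeff_hom) poly_hom: "coeff_hom (\<lambda>q. poly (map_poly \<phi> q) y)"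
proof
  show add: "poly (map_poly \<phi> (p + q)) y = poly (map_poly \<phi> p) y + poly (map_poly \<phi> q) y" for p q
    by (induction p q rule: poly_induct2) (auto simp: map_poly_pCons add algebra_simps)
  have sm: "poly (map_poly \<phi> (smult c q)) y = \<phi> c * poly (map_poly \<phi> q) y" for c q
    by (induction q) (auto simp: map_poly_pCons mult algebra_simps)
  show "poly (map_poly \<phi> (p * q)) y = poly (map_poly \<phi> p) y * poly (map_poly \<phi> q) y" for p q
    by (induction p) (auto simp: map_poly_pCons add sm algebra_simps)
qed (auto simp: map_poly_1')

locale trinomial =
  fixes r d :: nat and n :: "nat \<Rightarrow> nat" and l :: "nat \<Rightarrow> nat \<Rightarrow> nat"
    and a :: "nat \<Rightarrow> 'k::{alg_closed_field, field_char_0}"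
  assumes r2: "r \<ge> 2"
    and n1: "i \<in> {1..r} \<Longrightarrow> n i \<ge> 1"
    and l1: "i \<in> {1..r} \<Longrightarrow> j \<in> {1..n i} \<Longrightarrow> l i j \<ge> 1"
    and inj_a: "inj_on a {1..r}"
begin

abbreviation V :: "tvar set" where "V \<equiv> tri_vars r n d"
abbreviation P :: "(tvar, 'k) mpol set" where "P \<equiv> carrier (poly_ring V)"
abbreviation I :: "(tvar, 'k) mpol set" where "I \<equiv> tri_ideal r n d l a"

lemma finite_V [simp]: "finite V"
proof -
  have "V \<subseteq> (\<Union>i\<in>{1..r}. TV i ` {1..n i}) \<union> SV ` {1..d}" by (auto simp: tri_vars_def)
  then show ?thesis by (rule finite_subset) auto
qed

lemma TV_in: "TV i j \<in> V \<longleftrightarrow> i \<in> {1..r} \<and> j \<in> {1..n i}" and SV_in: "SV k \<in> V \<longleftrightarrow> k \<in> {1..d}"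
  by (auto simp: tri_vars_def)

section \<open>Weights of monomials\<close>

definition tlen :: "nat \<Rightarrow> nat" where "tlen i = (\<Sum>j = 1..n i. l i j)"

definition bdeg :: "nat \<Rightarrow> (tvar \<Rightarrow>\<^sub>0 nat) \<Rightarrow> nat" where "bdeg i m = (\<Sum>j = 1..n i. lk m (TV i j))"

fun wtf :: "(tvar \<Rightarrow>\<^sub>0 nat) \<Rightarrow> tvar \<Rightarrow> int" where
  "wtf m (TV i p) = int (tlen i) * int (lk m (TV i p)) - int (l i p) * int (bdeg i m)"
| "wtf m (SV k) = int (lk m (SV k))"

text \<open>The entries of \<open>wtf m\<close> at block \<open>i\<close> all vanish iff the exponents of \<open>m\<close> in that block are proportional
  to \<open>l\<^sub>i\<close>; the linear forms \<open>wtf \<cdot> v\<close> are cocharacters of the torus \<open>\<T>\<close>.\<close>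

definition wt :: "(tvar \<Rightarrow>\<^sub>0 nat) \<Rightarrow> tvar \<Rightarrow>\<^sub>0 int" where "wt m = (\<Sum>v\<in>V. sg v (wtf m v))"

definition tm :: "nat \<Rightarrow> tvar \<Rightarrow>\<^sub>0 nat" where "tm i = (\<Sum>j = 1..n i. sg (TV i j) (l i j))"

lemma tlen_pos: "i \<in> {1..r} \<Longrightarrow> tlen i > 0"
  unfolding tlen_def using n1[of i] l1[of i] by (intro sum_pos) fastforce+

lemma bdeg_0 [simp]: "bdeg i 0 = 0" and bdeg_add: "bdeg i (m + m') = bdeg i m + bdeg i m'"
  by (auto simp: bdeg_def lookup_add sum.distrib)

lemma wtf_0 [simp]: "wtf 0 v = 0" and wtf_add: "wtf (m + m') v = wtf m v + wtf m' v"
  by (cases v; simp add: bdeg_add lookup_add algebra_simps)+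

lemma lookup_wt: "lk (wt m) v = (if v \<in> V then wtf m v else 0)"
  by (simp add: wt_def lookup_sum lookup_single when_def)

lemma wt_0 [simp]: "wt 0 = 0" and wt_add: "wt (m + m') = wt m + wt m'"
  by (auto intro!: poly_mapping_eqI simp: lookup_wt lookup_add wtf_add)

lemma wt_eq_iff: "wt m = wt m' \<longleftrightarrow> (\<forall>v\<in>V. wtf m v = wtf m' v)"
  by (auto simp: poly_mapping_eq_iff fun_eq_iff lookup_wt)

lemma lookup_tm: "lk (tm i) v = (case v of TV i' j \<Rightarrow> if i' = i \<and> j \<in> {1..n i} then l i j else 0 | SV k \<Rightarrow> 0)"
proof (cases v)
  case (TV i' j)
  then have "lk (tm i) v = (\<Sum>j' = 1..n i. if j' = j \<and> i' = i then l i j else 0)"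
    unfolding tm_def lookup_sum by (intro sum.cong) (auto simp: lookup_single when_def)
  then show ?thesis using TV by (cases "i' = i") auto
qed (simp add: tm_def lookup_sum lookup_single)

lemma bdeg_tm: "bdeg i' (tm i) = (if i' = i then tlen i else 0)"
  by (auto simp: bdeg_def lookup_tm tlen_def)

lemma wt_tm [simp]: "wt (tm i) = 0"
proof (rule poly_mapping_eqI)
  fix v show "lk (wt (tm i)) v = lk 0 v"
    by (cases v) (auto simp: lookup_wt bdeg_tm lookup_tm TV_in)
qed

lemma keys_tm: "i \<in> {1..r} \<Longrightarrow> ks (tm i) \<subseteq> V"
  by (auto simp: in_keys_iff lookup_tm TV_in split: tvar.splits if_splits)

lemma tri_mon_eq: "tri_mon n l i = sg (tm i) (1::'b::comm_ring_1)"
proof -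
  have "sg (tm i) (1::'b) = mon_eval mvar (tm i)" by (simp add: mon_eval_mvar)
  also have "\<dots> = tri_mon n l i" by (simp add: tm_def mon_eval_sum tri_mon_def)
  finally show ?thesis ..
qed

lemma tri_mon_in: "i \<in> {1..r} \<Longrightarrow> tri_mon n l i \<in> P"
  unfolding tri_mon_eq by (rule pr_single) (rule keys_tm)

text \<open>Equal weights force the exponent differences within block \<open>i\<close> to be
  proportional to \<open>l i\<close>; the later comparisons of exponents of the \<open>T_ij\<close>
  rest on this.\<close>

lemma wtf_tm_block:
  assumes "wt m = wt m'" "i \<in> {1..r}" "j \<in> {1..n i}"
  shows "int (tlen i) * (int (lk m (TV i j)) - int (lk m' (TV i j))) = int (l i j) * (int (bdeg i m) - int (bdeg i m'))"
proof -
  have "TV i j \<in> V" using assms(2,3) by (simp add: TV_in)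
  then have "wtf m (TV i j) = wtf m' (TV i j)" using assms(1) unfolding wt_eq_iff by blast
  then show ?thesis by (simp add: algebra_simps)
qed

lemma wt_eq_SV: "wt m = wt m' \<Longrightarrow> k \<in> {1..d} \<Longrightarrow> lk m (SV k) = lk m' (SV k)"
  by (auto simp: wt_eq_iff SV_in dest!: bspec[of _ _ "SV k"])

section \<open>Embedding into Laurent polynomials over \<open>k[[t]]\<close>\<close>

definition x0 :: 'k where "x0 = (SOME x. x \<notin> a ` {1..r})"

text \<open>With \<open>x = x0 + t\<close> the linear form \<open>x - a i\<close> becomes
  \<open>t - b i\<close>, a unit of \<open>k[[t]]\<close> because \<open>x0\<close> is none of the
  \<open>a i\<close>.\<close>

definition b :: "nat \<Rightarrow> 'k" where "b i = a i - x0"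

lemma b_nz: "i \<in> {1..r} \<Longrightarrow> b i \<noteq> 0"
proof -
  have "\<exists>x. x \<notin> a ` {1..r}" using infinite_UNIV_char_0[where 'a = 'k] ex_new_if_finite by blast
  then have "x0 \<notin> a ` {1..r}" unfolding x0_def by (rule someI_ex)
  then show "i \<in> {1..r} \<Longrightarrow> b i \<noteq> 0" unfolding b_def by (metis eq_iff_diff_eq_0 imageI)
qed

lemma inj_b: "inj_on b {1..r}"
proof (rule inj_onI)
  fix i j assume ij: "i \<in> {1..r}" "j \<in> {1..r}" "b i = b j"
  then have "a i = a j" by (simp add: b_def)
  then show "i = j" by (rule inj_onD[OF inj_a _ ij(1,2)])
qed

text \<open>The order of the root is \<open>tlen i\<close>, the total degree of
  \<open>T_i^{l_i}\<close>: with every \<open>T_ij\<close> sent to this series times a Laurent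
  monomial, \<open>T_i^{l_i}\<close> goes to \<open>t - b i\<close>, since the weights of its
  factors cancel (\<open>wt_tm\<close>).\<close>

definition rad :: "nat \<Rightarrow> 'k fps" where
  "rad i = (SOME u. u ^ tlen i = fps_of_poly [:- b i, 1:] \<and>
    fps_of_poly [:- b i, 1:] * fps_deriv u = fps_const (1 / of_nat (tlen i)) * u)"

lemma rad:
  assumes "i \<in> {1..r}"
  shows "rad i ^ tlen i = fps_of_poly [:- b i, 1:]"
    "fps_of_poly [:- b i, 1:] * fps_deriv (rad i) = fps_const (1 / of_nat (tlen i)) * rad i"
proof -
  have "\<exists>u. u ^ tlen i = fps_of_poly [:- b i, 1:] \<and>
    fps_of_poly [:- b i, 1:] * fps_deriv u = fps_const (1 / of_nat (tlen i)) * u"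
    using linear_radical[OF b_nz[OF assms] tlen_pos[OF assms]] by metis
  from someI_ex[OF this, folded rad_def]
  show "rad i ^ tlen i = fps_of_poly [:- b i, 1:]"
    "fps_of_poly [:- b i, 1:] * fps_deriv (rad i) = fps_const (1 / of_nat (tlen i)) * rad i" by auto
qed

lemma rad_nz: "i \<in> {1..r} \<Longrightarrow> rad i \<noteq> 0"
proof
  assume i: "i \<in> {1..r}" "rad i = 0"
  have "fps_of_poly [:- b i, 1:] = (0 :: 'k fps)" using rad(1)[OF i(1)] tlen_pos[OF i(1)] i(2) by (simp add: zero_power)
  then show False by simp
qed

definition U :: "(tvar \<Rightarrow>\<^sub>0 nat) \<Rightarrow> 'k fps" where "U m = (\<Prod>i = 1..r. rad i ^ bdeg i m)"

lemma U_0 [simp]: "U 0 = 1" and U_add: "U (m + m') = U m * U m'"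
  by (auto simp: U_def bdeg_add power_add prod.distrib)

lemma U_nz: "U m \<noteq> 0"
  by (auto simp: U_def rad_nz)

lemma U_tm: assumes "i \<in> {1..r}" shows "U (tm i) = fps_of_poly [:- b i, 1:]"
proof -
  have "U (tm i) = (\<Prod>k = 1..r. if k = i then rad i ^ tlen i else 1)"
    unfolding U_def by (intro prod.cong) (auto simp: bdeg_tm)
  then show ?thesis using assms rad(1) by simp
qed

definition \<kappa> :: "'k \<Rightarrow> (tvar \<Rightarrow>\<^sub>0 int) \<Rightarrow>\<^sub>0 'k fps" where "\<kappa> c = sg 0 (fps_const c)"

definition X :: "(tvar \<Rightarrow>\<^sub>0 nat) \<Rightarrow> (tvar \<Rightarrow>\<^sub>0 int) \<Rightarrow>\<^sub>0 'k fps" where "X m = sg (wt m) (U m)"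

text \<open>\<open>T_ij\<close> goes to \<open>rad i\<close> and \<open>S_k\<close> to
  \<open>1\<close>, each times the Laurent monomial of its weight.\<close>

definition \<Phi> :: "(tvar, 'k) mpol \<Rightarrow> (tvar \<Rightarrow>\<^sub>0 int) \<Rightarrow>\<^sub>0 'k fps" where
  "\<Phi> = mp_eval \<kappa> (\<lambda>v. X (sg v 1))"

lemma \<kappa>_hom: "coeff_hom \<kappa>"
  by unfold_locales (auto simp: \<kappa>_def mult_single single_add simp flip: fps_const_add fps_const_mult)

sublocale \<kappa>: coeff_hom \<kappa> by (rule \<kappa>_hom)

sublocale \<Phi>: coeff_hom \<Phi> unfolding \<Phi>_def by (rule \<kappa>.eval_hom)

lemma X_0 [simp]: "X 0 = 1" and X_add: "X (m + m') = X m * X m'"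
  by (auto simp: X_def wt_add U_add mult_single)

lemma X_nz: "X m \<noteq> 0"
  using U_nz by (metis X_def lookup_single_eq lookup_zero)

lemma \<Phi>_single: "\<Phi> (sg m c) = sg (wt m) (fps_const c * U m)"
proof -
  have "mon_eval (\<lambda>v. X (sg v 1)) m = X m"
    by (rule mon_eval_additive) (auto simp: X_add)
  then show ?thesis by (simp add: \<Phi>_def \<kappa>.eval_single) (simp add: \<kappa>_def X_def mult_single)
qed

lemma \<Phi>_mon: "\<Phi> (sg m 1) = X m" by (simp add: \<Phi>_single X_def)

lemma \<Phi>_mvar: "\<Phi> (mvar v) = X (sg v 1)" by (simp add: mvar_def \<Phi>_mon)

lemma \<Phi>_mconst: "\<Phi> (mconst c) = \<kappa> c" by (simp add: \<Phi>_def \<kappa>.eval_mconst)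

lemma \<kappa>_eq_0_iff: "\<kappa> c = 0 \<longleftrightarrow> c = 0"
  by (metis \<kappa>_def \<kappa>.zero fps_const_eq_0_iff lookup_single_eq lookup_zero)

lemma \<Phi>_tri_mon: "i \<in> {1..r} \<Longrightarrow> \<Phi> (tri_mon n l i) = sg 0 (fps_X - fps_const (b i))"
  by (simp add: tri_mon_eq \<Phi>_single U_tm fps_of_poly_pCons flip: fps_const_neg)

lemma lookup_\<Phi>: "lk (\<Phi> f) w = (\<Sum>m\<in>{m\<in>ks f. wt m = w}. fps_const (lk f m) * U m)"
proof -
  have "\<Phi> f = (\<Sum>m\<in>ks f. sg (wt m) (fps_const (lk f m) * U m))"
    by (subst mpol_eq_sum_single[of f]) (simp add: \<Phi>.sum \<Phi>_single)
  then show ?thesis by (simp add: lookup_sum lookup_single when_def sum.If_cases Collect_conj_eq)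
qed

section \<open>The ideal of relations\<close>

definition gens :: "(tvar, 'k) mpol set" where
  "gens = (\<lambda>i. tri_mon n l i - tri_mon n l (i + 1) - mconst (a (i + 1) - a i)) ` {1..r - 1}"

lemma I_eq: "I = Idl\<^bsub>poly_ring V\<^esub> gens"
  by (simp add: tri_ideal_def gens_def)

lemma gens_P: "gens \<subseteq> P"
  unfolding gens_def using tri_mon_in by auto

sublocale PR: cring "poly_ring V" by (rule cring_poly_ring)

lemma ideal_I: "ideal I (poly_ring V)"
  unfolding I_eq by (rule PR.genideal_ideal) (rule gens_P)

lemma I_P: "f \<in> I \<Longrightarrow> f \<in> P"
  using ideal_I by (meson additive_subgroup.a_Hcarr ideal.axioms(1))

lemma I_0: "0 \<in> I" and I_add: "f \<in> I \<Longrightarrow> g \<in> I \<Longrightarrow> f + g \<in> I"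
  and I_mult: "f \<in> I \<Longrightarrow> g \<in> P \<Longrightarrow> g * f \<in> I"
  using additive_subgroup.zero_closed[OF ideal.axioms(1)[OF ideal_I]]
    additive_subgroup.a_closed[OF ideal.axioms(1)[OF ideal_I]] ideal.I_l_closed[OF ideal_I]
  by simp_all

lemma I_uminus: "f \<in> I \<Longrightarrow> - f \<in> I"
  using I_mult[of f "mconst (-1)"] by (simp add: mconst.uminus)

lemma I_diff: "f \<in> I \<Longrightarrow> g \<in> I \<Longrightarrow> f - g \<in> I"
  using I_add[of f "- g"] I_uminus by simp

text \<open>The form in which properties of \<open>I\<close> are reduced to its generators.\<close>

lemma I_minimal:
  assumes "K \<subseteq> P" "gens \<subseteq> K" "0 \<in> K" "\<And>f g. f \<in> K \<Longrightarrow> g \<in> K \<Longrightarrow> f + g \<in> K"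
    "\<And>f g. f \<in> K \<Longrightarrow> g \<in> P \<Longrightarrow> g * f \<in> K"
  shows "I \<subseteq> K"
  unfolding I_eq
proof (rule PR.genideal_minimal)
  show "ideal K (poly_ring V)"
  proof (rule idealI)
    have "\<ominus>\<^bsub>poly_ring V\<^esub> f \<in> K" if "f \<in> K" for f
    proof -
      have "- f \<in> K" using assms(5)[OF that, of "mconst (-1)"] by (simp add: mconst.uminus)
      moreover have "\<ominus>\<^bsub>poly_ring V\<^esub> f = - f"
        using that assms(1) by (intro PR.minus_equality) auto
      ultimately show ?thesis by simp
    qed
    then show "subgroup K (add_monoid (poly_ring V))"
      using assms by (intro subgroup.intro) (auto simp: a_inv_def)
  qed (use assms PR.ring_axioms in \<open>auto simp: mult.commute\<close>)
qed fact

lemma I_sub_ker: "f \<in> I \<Longrightarrow> \<Phi> f = 0"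
proof -
  have "\<Phi> g = 0" if g0: "g \<in> gens" for g
  proof -
    obtain i where i: "i \<in> {1..r-1}" and g: "g = tri_mon n l i - tri_mon n l (i + 1) - mconst (a (i + 1) - a i)"
      using g0 unfolding gens_def by blast
    then have "i \<in> {1..r}" "i + 1 \<in> {1..r}" by auto
    then show ?thesis unfolding g
      by (simp add: \<Phi>.diff \<Phi>_tri_mon \<Phi>_mconst \<kappa>_def b_def flip: single_diff)
  qed
  then have "I \<subseteq> {f \<in> P. \<Phi> f = 0}"
    using gens_P by (intro I_minimal) (auto simp: \<Phi>.add \<Phi>.mult)
  then show "f \<in> I \<Longrightarrow> \<Phi> f = 0" by auto
qed

text \<open>A polynomial representing \<open>t = x - x0\<close>.\<close>

definition Xh :: "(tvar, 'k) mpol" where "Xh = tri_mon n l 1 + mconst (b 1)"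

lemma Xh_P: "Xh \<in> P"
  unfolding Xh_def using r2 by (intro pr_add tri_mon_in) auto

lemma \<Phi>_Xh: "\<Phi> Xh = sg 0 fps_X"
  unfolding Xh_def using r2 by (simp add: \<Phi>.add \<Phi>_tri_mon \<Phi>_mconst \<kappa>_def flip: single_add)

text \<open>The generators link consecutive indices, so the case \<open>i = 1\<close>, which is the
  definition of \<open>Xh\<close>, propagates.\<close>

lemma tri_mon_cong: "i \<in> {1..r} \<Longrightarrow> tri_mon n l i - (Xh - mconst (b i)) \<in> I"
proof (induction i)
  case (Suc i)
  show ?case
  proof (cases "i = 0")
    case True then show ?thesis by (simp add: Xh_def I_0)
  next
    case False
    then have i: "i \<in> {1..r-1}" "i \<in> {1..r}" using Suc.prems by auto
    have "tri_mon n l i - tri_mon n l (Suc i) - mconst (a (Suc i) - a i) \<in> I"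
      unfolding I_eq using i gens_P by (intro subsetD[OF PR.genideal_self]) (auto simp: gens_def)
    from I_diff[OF Suc.IH[OF i(2)] this] show ?thesis by (simp add: b_def mconst.diff algebra_simps)
  qed
qed simp

section \<open>Normal forms over \<open>k[x]\<close>\<close>

definition reduced :: "(tvar \<Rightarrow>\<^sub>0 nat) set" where
  "reduced = {m. ks m \<subseteq> V \<and> (\<forall>i\<in>{1..r}. \<exists>j\<in>{1..n i}. lk m (TV i j) < l i j)}"

text \<open>The coefficients are formal polynomials in \<open>t = x - x0\<close>, evaluated at
  \<open>Xh\<close>.\<close>

definition NF :: "((tvar \<Rightarrow>\<^sub>0 nat) \<Rightarrow>\<^sub>0 'k poly) \<Rightarrow> (tvar, 'k) mpol" where
  "NF = mp_eval (\<lambda>q. poly (map_poly mconst q) Xh) mvar"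

lemma NF_hom: "coeff_hom NF"
  unfolding NF_def by (intro coeff_hom.eval_hom mconst.poly_hom)

lemma NF_single: "NF (sg m q) = poly (map_poly mconst q) Xh * sg m 1"
  unfolding NF_def by (simp add: coeff_hom.eval_single[OF mconst.poly_hom] mon_eval_mvar)

lemma \<Phi>_NF: "\<Phi> (NF p) = (\<Sum>m\<in>ks p. sg (wt m) (fps_of_poly (lk p m) * U m))"
proof -
  interpret NF: coeff_hom NF by (rule NF_hom)
  have *: "\<Phi> (poly (map_poly mconst q) Xh) = sg 0 (fps_of_poly q)" for q
    by (induction q) (auto simp: map_poly_pCons \<Phi>.add \<Phi>.mult \<Phi>_mconst \<Phi>_Xh \<kappa>_def mult_single fps_of_poly_pCons mult.commute
        simp flip: single_add)
  have "\<Phi> (NF p) = \<Phi> (NF (\<Sum>m\<in>ks p. sg m (lk p m)))" by (simp flip: mpol_eq_sum_single)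
  also have "\<dots> = (\<Sum>m\<in>ks p. sg (wt m) (fps_of_poly (lk p m) * U m))"
    unfolding NF.sum \<Phi>.sum by (intro sum.cong) (auto simp: NF_single \<Phi>.mult * \<Phi>_single mult_single)
  finally show ?thesis .
qed

text \<open>By \<open>q\<close> and the equality of weights the exponents in block \<open>i\<close>
  differ by an integer multiple \<open>z\<close> of \<open>l i\<close>. A positive \<open>z\<close>
  would make \<open>m\<close> divisible by \<open>T_i^{l_i}\<close>, a negative one
  \<open>m'\<close>.\<close>

lemma reduced_eqI:
  assumes m: "m \<in> reduced" and m': "m' \<in> reduced" and w: "wt m = wt m'"
    and q: "\<And>i. i \<in> {1..r} \<Longrightarrow> (of_nat (bdeg i m) * (1 / of_nat (tlen i)) :: 'k) - of_nat (bdeg i m') * (1 / of_nat (tlen i)) \<in> \<int>"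
  shows "m = m'"
proof (rule poly_mapping_eqI)
  have TV: "lk m (TV i j) = lk m' (TV i j)" if i: "i \<in> {1..r}" and j: "j \<in> {1..n i}" for i j
  proof -
    obtain z where z: "(of_nat (bdeg i m) * (1 / of_nat (tlen i)) :: 'k) - of_nat (bdeg i m') * (1 / of_nat (tlen i)) = of_int z"
      using q[OF i] by (auto elim: Ints_cases)
    then have "(of_nat (bdeg i m) :: 'k) - of_nat (bdeg i m') = of_int z * of_nat (tlen i)"
      using tlen_pos[OF i] by (simp add: field_simps)
    then have "(of_int (int (bdeg i m) - int (bdeg i m')) :: 'k) = of_int (z * int (tlen i))" by simp
    then have z': "int (bdeg i m) - int (bdeg i m') = z * int (tlen i)" by (simp only: of_int_eq_iff)
    have e: "int (lk m (TV i j)) - int (lk m' (TV i j)) = z * int (l i j)" if "j \<in> {1..n i}" for j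
      using wtf_tm_block[OF w i that] tlen_pos[OF i] by (simp add: z')
    obtain j1 where j1: "j1 \<in> {1..n i}" "lk m (TV i j1) < l i j1" using m i unfolding reduced_def by blast
    obtain j2 where j2: "j2 \<in> {1..n i}" "lk m' (TV i j2) < l i j2" using m' i unfolding reduced_def by blast
    have "\<not> z \<ge> 1"
    proof
      assume "z \<ge> 1"
      then have "z * int (l i j1) \<ge> 1 * int (l i j1)" by (intro mult_right_mono) auto
      then show False using e[OF j1(1)] j1(2) by linarith
    qed
    moreover have "\<not> z \<le> -1"
    proof
      assume "z \<le> -1"
      then have "z * int (l i j2) \<le> -1 * int (l i j2)" by (intro mult_right_mono) auto
      then show False using e[OF j2(1)] j2(2) by linarith
    qed
    ultimately have "z = 0" by linarith
    then show ?thesis using e[OF j] by simp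
  qed
  fix v
  show "lk m v = lk m' v"
  proof (cases "v \<in> V")
    case True then show ?thesis
      using TV wt_eq_SV[OF w] by (cases v) (auto simp: TV_in SV_in)
  next
    case False
    then have "v \<notin> ks m" "v \<notin> ks m'" using m m' unfolding reduced_def by blast+
    then show ?thesis by (simp add: in_keys_iff)
  qed
qed

text \<open>In each weight the image is a combination over \<open>k[t]\<close> of series
  \<open>U m\<close> with residues \<open>bdeg i m / tlen i\<close>. Distinct reduced monomials of
  one weight have a nonintegral residue difference at some \<open>b i\<close>, so these series are
  independent.\<close>

lemma NF_inj: assumes "ks p \<subseteq> reduced" "\<Phi> (NF p) = 0" shows "p = 0"
proof (rule poly_mapping_eqI)
  fix m
  show "lk p m = lk 0 m"
  proof (cases "m \<in> ks p")
    case True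
    define S where "S = {m' \<in> ks p. wt m' = wt m}"
    have "lk (\<Phi> (NF p)) (wt m) = (\<Sum>m'\<in>S. fps_of_poly (lk p m') * U m')"
      unfolding \<Phi>_NF S_def by (simp add: lookup_sum lookup_single when_def sum.If_cases Collect_conj_eq)
    then have rel: "(\<Sum>m'\<in>S. fps_of_poly (lk p m') * U m') = 0" using assms(2) by simp
    have "lk p m = 0"
    proof (rule hyperexponential_independent[where S = S and J = "{1..r}" and b = b and u = U and p = "lk p"
          and q = "\<lambda>m i. of_nat (bdeg i m) * (1 / of_nat (tlen i))"])
      show "fps_of_poly (root_prod {1..r} b) * fps_deriv (U s)
        = fps_of_poly (log_num {1..r} b (\<lambda>i. of_nat (bdeg i s) * (1 / of_nat (tlen i)))) * U s" for s
        unfolding U_def by (rule fps_log_deriv_prod) (auto intro: rad)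
      show "\<exists>i\<in>{1..r}. (of_nat (bdeg i s) * (1 / of_nat (tlen i)) :: 'k) - of_nat (bdeg i s') * (1 / of_nat (tlen i)) \<notin> \<int>"
        if "s \<in> S" "s' \<in> S" "s \<noteq> s'" for s s'
      proof (rule ccontr)
        assume *: "\<not> ?thesis"
        have "s = s'"
          by (rule reduced_eqI) (use that assms(1) * in \<open>blast | simp add: S_def subset_iff\<close>)+
        then show False using that by simp
      qed
    qed (use rel True inj_b in \<open>simp_all add: S_def U_nz del: atLeastAtMost_iff One_nat_def\<close>)
    then show ?thesis by simp
  qed (simp add: in_keys_iff)
qed

text \<open>Modulo \<open>I\<close> a factor \<open>T_i^{l_i}\<close> of a monomial is rewritten as
  \<open>Xh - b i\<close>. The set \<open>N\<close> of polynomials with a normal form is closed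
  under sums, congruence modulo \<open>I\<close> and multiplication by polynomials in
  \<open>Xh\<close>.\<close>

lemma NF_exists: assumes "f \<in> P" shows "\<exists>p. ks p \<subseteq> reduced \<and> f - NF p \<in> I"
proof -
  interpret NF: coeff_hom NF by (rule NF_hom)
  define N where "N = {f. \<exists>p. ks p \<subseteq> reduced \<and> f - NF p \<in> I}"
  have add: "f + g \<in> N" if fg: "f \<in> N" "g \<in> N" for f g
  proof -
    obtain p q where pq: "ks p \<subseteq> reduced" "ks q \<subseteq> reduced" "f - NF p \<in> I" "g - NF q \<in> I"
      using fg by (auto simp: N_def)
    then have "(f + g) - NF (p + q) \<in> I" using I_add[OF pq(3,4)] by (simp add: NF.add algebra_simps)
    moreover have "ks (p + q) \<subseteq> reduced" using pq keys_add[of p q] by auto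
    ultimately show ?thesis unfolding N_def by blast
  qed
  have cg: "f \<in> N" if fg: "g \<in> N" "f - g \<in> I" for f g
  proof -
    obtain p where p: "ks p \<subseteq> reduced" "g - NF p \<in> I" using fg by (auto simp: N_def)
    then have "f - NF p \<in> I" using I_add[OF fg(2) p(2)] by simp
    then show ?thesis using p unfolding N_def by blast
  qed
  have sm: "poly (map_poly mconst c) Xh * f \<in> N" if f: "f \<in> N" for f c
  proof -
    obtain p where p: "ks p \<subseteq> reduced" "f - NF p \<in> I" using f by (auto simp: N_def)
    have "poly (map_poly mconst c) Xh \<in> P" by (induction c) (auto simp: map_poly_pCons Xh_P)
    from I_mult[OF p(2) this] have "poly (map_poly mconst c) Xh * f - NF (sg 0 c * p) \<in> I"
      by (simp add: NF.mult NF_single algebra_simps)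
    moreover have "ks (sg 0 c * p) \<subseteq> reduced" using keys_mult[of "sg 0 c" p] p(1) by (auto split: if_splits)
    ultimately show ?thesis unfolding N_def by blast
  qed
  have mon: "sg m 1 \<in> N" if "ks m \<subseteq> V" for m
    using that
  proof (induction "\<Sum>i=1..r. bdeg i m" arbitrary: m rule: less_induct)
    case less
    show ?case
    proof (cases "m \<in> reduced")
      case True
      then have "sg m 1 - NF (sg m 1) \<in> I" by (simp add: NF_single I_0)
      then show ?thesis using True unfolding N_def by (intro CollectI exI[of _ "sg m 1"]) auto
    next
      case False
      then have "\<exists>i\<in>{1..r}. \<forall>j\<in>{1..n i}. \<not> lk m (TV i j) < l i j"
        using less.prems unfolding reduced_def by blast
      then obtain i where i: "i \<in> {1..r}" "\<forall>j\<in>{1..n i}. l i j \<le> lk m (TV i j)"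
        unfolding not_less by blast
      define m' where "m' = m - tm i"
      have m: "m = m' + tm i"
        using i(2) by (intro poly_mapping_eqI) (auto simp: m'_def lookup_add lookup_minus lookup_tm split: tvar.splits)
      have kV: "ks m' \<subseteq> V" using less.prems unfolding m by (auto simp: in_keys_iff lookup_add)
      \<comment> \<open>Each rewriting lowers the total degree in the \<open>T_ij\<close> by
        \<open>tlen i > 0\<close>, so it terminates.\<close>
      have lt: "(\<Sum>i=1..r. bdeg i m') < (\<Sum>i=1..r. bdeg i m)"
        using i(1) tlen_pos[OF i(1)] unfolding m by (intro sum_strict_mono_ex1) (auto simp: bdeg_add bdeg_tm intro!: bexI[of _ i])
      have IH: "sg m' 1 \<in> N" by (rule less.hyps[OF lt kV])
      have "poly (map_poly mconst [:- b i, 1:]) Xh * sg m' 1 \<in> N" using IH by (rule sm)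
      moreover have "sg m 1 - poly (map_poly mconst [:- b i, 1:]) Xh * sg m' 1 \<in> I"
        using I_mult[OF tri_mon_cong[OF i(1)] pr_single[OF kV, of 1]]
        by (simp add: map_poly_pCons tri_mon_eq mconst.uminus algebra_simps m mult_single)
      ultimately show ?thesis by (rule cg)
    qed
  qed
  have "0 \<in> N" using I_0 unfolding N_def by (intro CollectI exI[of _ 0]) auto
  moreover have "sg m c \<in> N" if "ks m \<subseteq> V" for m c
    using sm[OF mon[OF that], of "[:c:]"] by (simp add: map_poly_pCons flip: single_eq_mconst_mult)
  ultimately have "(\<Sum>m\<in>A. sg m (lk f m)) \<in> N" if "A \<subseteq> ks f" for A
    using that assms by (induction A rule: infinite_finite_induct) (auto intro: add simp: poly_ring_carrier)
  from this[OF order.refl] show ?thesis by (simp add: N_def flip: mpol_eq_sum_single)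
qed

text \<open>A normal form killed by \<open>\<Phi>\<close> vanishes, so \<open>I\<close> is the whole
  kernel on \<open>P\<close>. Hence \<open>R\<close> is isomorphic to the image of \<open>P\<close>
  under \<open>\<Phi>\<close> and is a domain.\<close>

theorem mem_I_iff: "f \<in> I \<longleftrightarrow> f \<in> P \<and> \<Phi> f = 0"
proof
  assume f: "f \<in> P \<and> \<Phi> f = 0"
  then obtain p where p: "ks p \<subseteq> reduced" "f - NF p \<in> I" using NF_exists by blast
  have "\<Phi> (NF p) = 0" using I_sub_ker[OF p(2)] f by (simp add: \<Phi>.diff)
  then have "p = 0" by (rule NF_inj[OF p(1)])
  then show "f \<in> I" using p(2) NF_hom by (simp add: coeff_hom.zero)
qed (auto intro: I_P I_sub_ker)

end

section \<open>The quotient and the torus action\<close>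

context trinomial
begin

abbreviation R :: "(tvar, 'k) mpol set ring" where "R \<equiv> tri_alg r n d l a"
abbreviation cls :: "(tvar, 'k) mpol \<Rightarrow> (tvar, 'k) mpol set" where "cls \<equiv> tri_cls r n d l a"

abbreviation T :: "(tvar \<Rightarrow> 'k) set" where "T \<equiv> tri_T r n d l"
abbreviation H :: "(tvar \<Rightarrow> 'k) set" where "H \<equiv> tri_H r n d l"
abbreviation chars :: "((tvar \<Rightarrow> 'k) \<Rightarrow> 'k) set" where "chars \<equiv> tri_chars r n d l"
abbreviation wspace :: "((tvar \<Rightarrow> 'k) \<Rightarrow> 'k) \<Rightarrow> (tvar, 'k) mpol set set" where "wspace \<equiv> tri_weight_space r n d l a"

lemma I_iff: "f \<in> P \<Longrightarrow> f \<in> I \<longleftrightarrow> \<Phi> f = 0"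
  by (simp add: mem_I_iff)

lemma cls_eq: "cls f = (\<lambda>h. h + f) ` I"
  by (auto simp: tri_cls_def a_r_coset_def')

lemma carrier_R: "carrier R = cls ` P"
  by (auto simp: tri_alg_def FactRing_def A_RCOSETS_def' tri_cls_def)

lemma cls_in [simp]: "f \<in> P \<Longrightarrow> cls f \<in> carrier R"
  by (auto simp: carrier_R)

lemma cls_hom: "cls \<in> ring_hom (poly_ring V) R"
  using ideal.rcos_ring_hom[OF ideal_I] by (simp add: tri_alg_def tri_cls_def[abs_def])

lemma cls_mult: "f \<in> P \<Longrightarrow> g \<in> P \<Longrightarrow> cls f \<otimes>\<^bsub>R\<^esub> cls g = cls (f * g)"
  using ring_hom_mult[OF cls_hom] by simp

lemma cls_add: "f \<in> P \<Longrightarrow> g \<in> P \<Longrightarrow> cls f \<oplus>\<^bsub>R\<^esub> cls g = cls (f + g)"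
  using ring_hom_add[OF cls_hom] by simp

lemma cls_eq_iff_I: "cls f = cls g \<longleftrightarrow> f - g \<in> I"
proof
  assume "cls f = cls g"
  moreover have "f \<in> cls f" unfolding cls_eq using I_0 by force
  ultimately obtain h where "h \<in> I" "f = h + g" unfolding cls_eq by auto
  then show "f - g \<in> I" by simp
next
  assume fg: "f - g \<in> I"
  have "h + f \<in> cls g" if "h \<in> I" for h
    unfolding cls_eq by (rule image_eqI[of _ _ "h + (f - g)"]) (use I_add[OF that fg] in auto)
  moreover have "h + g \<in> cls f" if "h \<in> I" for h
    unfolding cls_eq by (rule image_eqI[of _ _ "h - (f - g)"]) (use I_diff[OF that fg] in auto)
  ultimately show "cls f = cls g" unfolding cls_eq by blast
qed

lemma cls_eq_iff: "f \<in> P \<Longrightarrow> g \<in> P \<Longrightarrow> cls f = cls g \<longleftrightarrow> \<Phi> f = \<Phi> g"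
  by (simp add: cls_eq_iff_I I_iff \<Phi>.diff)

lemma zero_R: "\<zero>\<^bsub>R\<^esub> = cls 0"
  by (simp add: tri_alg_def FactRing_def cls_eq)

lemma cls_eq_zero_iff: "f \<in> P \<Longrightarrow> cls f = \<zero>\<^bsub>R\<^esub> \<longleftrightarrow> \<Phi> f = 0"
  by (simp add: zero_R cls_eq_iff)

lemma domain_R: "f \<in> P \<Longrightarrow> g \<in> P \<Longrightarrow> f * g \<in> I \<Longrightarrow> f \<in> I \<or> g \<in> I"
  by (simp add: I_iff \<Phi>.mult)

subsection \<open>Induced derivations\<close>

text \<open>By the Leibniz rule the elements of \<open>I\<close> sent into \<open>I\<close> form an
  ideal, so checking generators suffices; then a coset has a single class as its image and
  \<open>the_elem\<close> is well defined.\<close>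

lemma induced_cls:
  assumes g: "\<And>v. v \<in> V \<Longrightarrow> g v \<in> P" and gen: "\<And>f. f \<in> gens \<Longrightarrow> vec_field V g f \<in> I" and f: "f \<in> P"
  shows "tri_induced r n d l a g (cls f) = cls (vec_field V g f)"
proof -
  have "I \<subseteq> {f \<in> I. vec_field V g f \<in> I}"
  proof (rule I_minimal)
    show "gens \<subseteq> {f \<in> I. vec_field V g f \<in> I}"
      using gen PR.genideal_self[OF gens_P] by (auto simp: I_eq)
    show "f' * f \<in> {f \<in> I. vec_field V g f \<in> I}" if "f \<in> {f \<in> I. vec_field V g f \<in> I}" "f' \<in> P" for f f'
      using that I_mult[of f "vec_field V g f'"] g
      by (auto simp: vec_field_mult intro!: I_add I_mult vec_field_in)
  qed (auto simp: vec_field_add I_P I_0 I_add, simp add: vec_field_def I_0)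
  then have "vec_field V g h \<in> I" if "h \<in> I" for h using that by auto
  then have "cls (vec_field V g (h + f)) = cls (vec_field V g f)" if "h \<in> I" for h
    using that by (simp add: cls_eq_iff_I vec_field_add)
  then have "(\<lambda>f. cls (vec_field V g f)) ` cls f = {cls (vec_field V g f)}"
    using I_0 unfolding cls_eq image_image by auto
  then show ?thesis by (simp add: tri_induced_def)
qed

subsection \<open>The torus\<close>

lemma torus_tri_mon:
  assumes "t \<in> H" "i \<in> {1..r}"
  shows "mon_eval t (tm i) = 1"
proof -
  have "torus_act t (tri_mon n l i) = (tri_mon n l i :: (tvar, 'k) mpol)" using assms by (auto simp: tri_H_def)
  from arg_cong[OF this, of "\<lambda>f. lk f (tm i)"] show ?thesis by (simp add: tri_mon_eq torus_act_single)
qed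

lemma torus_act_I:
  assumes "\<And>i. i \<in> {1..r} \<Longrightarrow> mon_eval t (tm i) = 1" "f \<in> I"
  shows "torus_act t f \<in> I"
proof -
  interpret t: coeff_hom "torus_act t" by (rule torus_act_hom)
  have tm: "torus_act t (tri_mon n l i) = (tri_mon n l i :: (tvar, 'k) mpol)" if "i \<in> {1..r}" for i
    using that assms(1) by (simp add: tri_mon_eq torus_act_single)
  have "torus_act t g = g" if "g \<in> gens" for g
    using that by (auto simp: gens_def t.diff tm mconst_def torus_act_single)
  then have "I \<subseteq> {f \<in> P. torus_act t f \<in> I}"
    using gens_P PR.genideal_self[OF gens_P]
    by (intro I_minimal) (auto simp: I_eq[symmetric] t.add t.mult I_0 I_add I_mult torus_act_in)
  then show ?thesis using assms(2) by auto
qed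

text \<open>Images of cosets are whole cosets because the inverse point \<open>t'\<close> also
  preserves \<open>I\<close>, so that \<open>t\<close> maps \<open>I\<close> onto itself.\<close>

lemma torus_act_cls:
  assumes t: "t \<in> H"
  shows "torus_act t ` cls f = cls (torus_act t f)"
proof -
  interpret t: coeff_hom "torus_act t" by (rule torus_act_hom)
  have nz: "t v \<noteq> 0" for v using t by (cases "v \<in> V") (auto simp: tri_H_def std_torus_def)
  define t' where "t' v = inverse (t v)" for v
  have tt: "mon_eval t m * mon_eval t' m = 1" for m
    unfolding mon_eval_mult[symmetric] by (simp add: t'_def nz mon_eval_def)
  have t'1: "mon_eval t' (tm i) = 1" if "i \<in> {1..r}" for i
    using tt[of "tm i"] torus_tri_mon[OF t that] by simp
  have inv: "torus_act t (torus_act t' h) = h" for h :: "(tvar, 'k) mpol"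
    by (rule poly_mapping_eqI) (simp add: lookup_torus_act tt flip: mult.assoc)
  have "torus_act t ` I = I"
  proof
    show "torus_act t ` I \<subseteq> I" using torus_act_I torus_tri_mon[OF t] by blast
    show "I \<subseteq> torus_act t ` I" using inv torus_act_I[OF t'1] by (metis image_eqI subsetI)
  qed
  then have "(\<lambda>h. torus_act t h + torus_act t f) ` I = (\<lambda>h. h + torus_act t f) ` I"
    using image_image[of "\<lambda>h. h + torus_act t f" "torus_act t" I] by simp
  then show ?thesis unfolding cls_eq image_image t.add .
qed

text \<open>The one-parameter subgroup, with parameter \<open>s\<close>, of the cocharacter given by
  the linear form \<open>\<lambda>m. wtf m v\<close>; outside \<open>V\<close> it is
  \<open>1\<close>, as \<open>std_torus\<close> demands.\<close>

definition opt :: "tvar \<Rightarrow> 'k \<Rightarrow> tvar \<Rightarrow> 'k" where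
  "opt v s v' = (if v' \<in> V then s powi wtf (sg v' 1) v else 1)"

lemma mon_eval_opt:
  assumes "s \<noteq> 0" "ks m \<subseteq> V"
  shows "mon_eval (opt v s) m = s powi wtf m v"
proof -
  have "mon_eval (opt v s) m = mon_eval (\<lambda>v'. s powi wtf (sg v' 1) v) m"
    using assms by (intro mon_eval_cong) (auto simp: opt_def)
  also have "\<dots> = s powi wtf m v"
    using mon_eval_additive[of "\<lambda>m. s powi wtf m v" m] assms(1) by (simp add: wtf_add power_int_add)
  finally show ?thesis .
qed

lemma opt_std: "s \<noteq> 0 \<Longrightarrow> opt v s \<in> std_torus V"
  by (auto simp: std_torus_def opt_def)

lemma opt_H: assumes "v \<in> V" "s \<noteq> 0" shows "opt v s \<in> H"
proof -
  have "wtf (tm i) v = 0" for i using lookup_wt[of "tm i" v] assms(1) by simp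
  then have "mon_eval (opt v s) (tm i) = 1" if "i \<in> {1..r}" for i
    using that by (simp add: mon_eval_opt assms(2) keys_tm)
  then show ?thesis using opt_std[OF assms(2)] by (simp add: tri_H_def tri_mon_eq torus_act_single)
qed

text \<open>Along a one-parameter subgroup \<open>f\<close> becomes a Laurent polynomial in
  \<open>s\<close>; the factor \<open>s ^ N\<close> clears its negative exponents.\<close>

lemma eval_at_opt:
  assumes "f \<in> P"
  obtains p :: "'k poly" and N where "\<And>s. s \<noteq> 0 \<Longrightarrow> poly p s = s ^ N * eval_at (opt v s) f"
proof -
  define N where "N = nat (\<Sum>m\<in>ks f. \<bar>wtf m v\<bar>)"
  have N: "wtf m v + int N \<ge> 0" if "m \<in> ks f" for m
  proof -
    have "\<bar>wtf m v\<bar> \<le> (\<Sum>m\<in>ks f. \<bar>wtf m v\<bar>)" using that by (intro member_le_sum) auto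
    then show ?thesis by (simp add: N_def)
  qed
  define p where "p = (\<Sum>m\<in>ks f. monom (lk f m) (nat (wtf m v + int N)))"
  have "poly p s = s ^ N * eval_at (opt v s) f" if s: "s \<noteq> 0" for s
    unfolding p_def mp_eval_alt poly_sum sum_distrib_left
  proof (rule sum.cong[OF refl])
    fix m assume m: "m \<in> ks f"
    have "s ^ nat (wtf m v + int N) = s powi (wtf m v + int N)" using N[OF m] by (simp add: power_int_def)
    also have "\<dots> = s powi wtf m v * s ^ N" using s by (simp add: power_int_add)
    finally show "poly (monom (lk f m) (nat (wtf m v + int N))) s = s ^ N * (lk f m * mon_eval (opt v s) m)"
      using assms m s by (simp add: poly_monom mon_eval_opt poly_ring_carrier)
  qed
  then show ?thesis by (rule that)
qed

text \<open>A one-parameter subgroup is irreducible: every open set contains cofinitely many of its points or none.\<close>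

lemma opt_open:
  assumes "openin (zariski_torus V) E"
  shows "(\<forall>s. s \<noteq> 0 \<longrightarrow> opt v s \<notin> E) \<or> finite {s. s \<noteq> 0 \<and> opt v s \<notin> E}"
  using openin_topology_generated_by[OF assms[unfolded zariski_torus_def]]
proof (induction rule: generate_topology_on.induct)
  case (Int A B)
  have "{s. s \<noteq> 0 \<and> opt v s \<notin> A \<inter> B} = {s. s \<noteq> 0 \<and> opt v s \<notin> A} \<union> {s. s \<noteq> 0 \<and> opt v s \<notin> B}" by auto
  then show ?case using Int.IH by auto
next
  case (UN K)
  show ?case
  proof (cases "\<exists>k\<in>K. finite {s. s \<noteq> 0 \<and> opt v s \<notin> k}")
    case True
    then obtain k where "k \<in> K" "finite {s. s \<noteq> 0 \<and> opt v s \<notin> k}" by blast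
    then have "finite {s. s \<noteq> 0 \<and> opt v s \<notin> \<Union>K}" by (elim finite_subset[rotated]) auto
    then show ?thesis ..
  next
    case False then show ?thesis using UN.IH by blast
  qed
next
  case (Basis E)
  then obtain f where f: "f \<in> P" "E = {t \<in> std_torus V. eval_at t f \<noteq> 0}" by blast
  obtain p N where p: "\<And>s. s \<noteq> 0 \<Longrightarrow> poly p s = s ^ N * eval_at (opt v s) f" using eval_at_opt[OF f(1)] by blast
  have E: "opt v s \<in> E \<longleftrightarrow> poly p s \<noteq> 0" if "s \<noteq> 0" for s
    using p[OF that] that opt_std[OF that] by (simp add: f(2))
  show ?case
  proof (cases "p = 0")
    case True then show ?thesis using E by auto
  next
    case False
    have "{s. s \<noteq> 0 \<and> opt v s \<notin> E} \<subseteq> {s. poly p s = 0}" using E by auto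
    then show ?thesis using poly_roots_finite[OF False] finite_subset by blast
  qed
qed auto

text \<open>The curve lies in \<open>H\<close> and passes through the identity at
  \<open>s = 1\<close>. It is connected: two open sets meeting it each contain cofinitely many of
  its parameters, so over an infinite field they meet on the curve.\<close>

lemma opt_T: assumes "v \<in> V" "s \<noteq> 0" shows "opt v s \<in> T"
proof -
  let ?C = "{opt v s |s. s \<noteq> 0}"
  have "connectedin (zariski_torus V) ?C"
    unfolding connectedin
  proof (intro conjI notI)
    have "{t \<in> std_torus V. eval_at t (1 :: (tvar, 'k) mpol) \<noteq> 0} = std_torus V"
      by (simp add: coeff_hom.one[OF coeff_hom.eval_hom[OF coeff_hom_id]])
    then have "std_torus V \<subseteq> topspace (zariski_torus V :: (tvar \<Rightarrow> 'k) topology)"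
      unfolding zariski_torus_def topology_generated_by_topspace using pr_1[of V] by (intro Union_upper) blast
    then show "?C \<subseteq> topspace (zariski_torus V)" using opt_std by auto
  next
    assume "\<exists>E1 E2. openin (zariski_torus V) E1 \<and> openin (zariski_torus V) E2 \<and>
      ?C \<subseteq> E1 \<union> E2 \<and> E1 \<inter> E2 \<inter> ?C = {} \<and> E1 \<inter> ?C \<noteq> {} \<and> E2 \<inter> ?C \<noteq> {}"
    then obtain E1 E2 where E: "openin (zariski_torus V) E1" "openin (zariski_torus V) E2"
      "E1 \<inter> E2 \<inter> ?C = {}" "E1 \<inter> ?C \<noteq> {}" "E2 \<inter> ?C \<noteq> {}" by blast
    have "finite {s. s \<noteq> 0 \<and> opt v s \<notin> E1}" "finite {s. s \<noteq> 0 \<and> opt v s \<notin> E2}"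
      using opt_open[OF E(1), of v] opt_open[OF E(2), of v] E(4,5) by blast+
    then have "finite ({0} \<union> {s. s \<noteq> 0 \<and> opt v s \<notin> E1} \<union> {s. s \<noteq> 0 \<and> opt v s \<notin> E2})" by simp
    moreover have "{0} \<union> {s. s \<noteq> 0 \<and> opt v s \<notin> E1} \<union> {s. s \<noteq> 0 \<and> opt v s \<notin> E2} = UNIV"
      using E(3) by blast
    ultimately have "finite (UNIV :: 'k set)" by (simp only:)
    then show False using infinite_UNIV_char_0 by blast
  qed
  then have "connectedin (subtopology (zariski_torus V) (H)) ?C"
    using opt_H[OF assms(1)] by (auto simp: connectedin_subtopology)
  moreover have "opt v 1 = (\<lambda>_. 1)" by (auto simp: opt_def)
  then have "(\<lambda>_. 1) \<in> ?C" by (intro CollectI exI[of _ 1]) auto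
  ultimately show ?thesis using assms(2) unfolding tri_T_def connected_component_of_def by blast
qed

lemma T_sub_H: "t \<in> T \<Longrightarrow> t \<in> H"
  unfolding tri_T_def using connected_component_in_topspace by fastforce

lemma T_nz: "t \<in> T \<Longrightarrow> t v \<noteq> 0"
  using T_sub_H[of t] by (cases "v \<in> V") (auto simp: tri_H_def std_torus_def)

lemma mon_eval_T_nz: "t \<in> T \<Longrightarrow> mon_eval t m \<noteq> 0"
  using T_nz[of t] by (simp add: mon_eval_def)

subsection \<open>Weights\<close>

lemma weight_space_cls:
  assumes "f \<in> P"
  shows "cls f \<in> wspace \<chi> \<longleftrightarrow> (\<forall>t\<in>T. torus_act t f - mconst (\<chi> t) * f \<in> I)"
  using assms by (simp add: tri_weight_space_def torus_act_cls[OF T_sub_H] cls_mult cls_eq_iff_I)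

lemma mon_weight: assumes "ks m \<subseteq> V" shows "cls (sg m c) \<in> wspace (\<lambda>t. mon_eval t m)"
proof -
  have "torus_act t (sg m c) - mconst (mon_eval t m) * sg m c = 0" for t
    by (simp add: torus_act_single mconst_def mult_single)
  then show ?thesis using assms by (simp add: weight_space_cls pr_single I_0)
qed

lemma charI:
  assumes "\<And>t. t \<in> T \<Longrightarrow> \<chi> t \<noteq> 0" "\<And>s t. s \<in> T \<Longrightarrow> t \<in> T \<Longrightarrow> \<chi> (\<lambda>v. s v * t v) = \<chi> s * \<chi> t"
    "f \<in> P" "\<And>t. t \<in> T \<Longrightarrow> \<chi> t = eval_at t f / (\<Prod>v\<in>V. t v) ^ N"
  shows "\<chi> \<in> chars"
  using assms unfolding characters_def by blast

lemma char_mon: assumes "ks m \<subseteq> V" shows "(\<lambda>t. mon_eval t m) \<in> chars"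
proof (rule charI)
  show "mon_eval t m = eval_at t (sg m 1) / (\<Prod>v\<in>V. t v) ^ 0" for t :: "tvar \<Rightarrow> 'k"
    by (simp add: coeff_hom.eval_single[OF coeff_hom_id])
qed (use assms in \<open>auto simp: mon_eval_T_nz mon_eval_mult intro: pr_single\<close>)

lemma char_mult:
  assumes "\<chi> \<in> chars" "\<chi>' \<in> chars"
  shows "(\<lambda>t. \<chi> t * \<chi>' t) \<in> chars"
proof -
  have \<chi>: "\<And>t. t \<in> T \<Longrightarrow> \<chi> t \<noteq> 0" "\<And>s t. s \<in> T \<Longrightarrow> t \<in> T \<Longrightarrow> \<chi> (\<lambda>v. s v * t v) = \<chi> s * \<chi> t"
    and \<chi>': "\<And>t. t \<in> T \<Longrightarrow> \<chi>' t \<noteq> 0" "\<And>s t. s \<in> T \<Longrightarrow> t \<in> T \<Longrightarrow> \<chi>' (\<lambda>v. s v * t v) = \<chi>' s * \<chi>' t"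
    using assms unfolding characters_def by blast+
  obtain f N where f: "f \<in> P" "\<And>t. t \<in> T \<Longrightarrow> \<chi> t = eval_at t f / (\<Prod>v\<in>V. t v) ^ N"
    using assms(1) unfolding characters_def by blast
  obtain f' N' where f': "f' \<in> P" "\<And>t. t \<in> T \<Longrightarrow> \<chi>' t = eval_at t f' / (\<Prod>v\<in>V. t v) ^ N'"
    using assms(2) unfolding characters_def by blast
  show ?thesis
  proof (rule charI)
    show "\<chi> t * \<chi>' t = eval_at t (f * f') / (\<Prod>v\<in>V. t v) ^ (N + N')" if "t \<in> T" for t
      using f(2)[OF that] f'(2)[OF that] by (simp add: coeff_hom.eval_mult[OF coeff_hom_id] power_add)
    show "\<chi> t * \<chi>' t \<noteq> 0" if "t \<in> T" for t using \<chi>(1)[OF that] \<chi>'(1)[OF that] by simp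
    show "\<chi> (\<lambda>v. s v * t v) * \<chi>' (\<lambda>v. s v * t v) = \<chi> s * \<chi>' s * (\<chi> t * \<chi>' t)" if "s \<in> T" "t \<in> T" for s t
      unfolding \<chi>(2)[OF that] \<chi>'(2)[OF that] by (simp only: mult_ac)
    show "f * f' \<in> P" using f(1) f'(1) by simp
  qed
qed

text \<open>Regularity comes from the complementary monomial \<open>m'\<close>: every variable has
  exponent \<open>N\<close> in \<open>m + m'\<close>, so \<open>1 / t^m\<close> is
  \<open>t^m'\<close> divided by the \<open>N\<close>-th power of the product of the
  coordinates.\<close>

lemma char_inverse_mon:
  assumes "ks m \<subseteq> V"
  shows "(\<lambda>t. inverse (mon_eval t m)) \<in> chars"
proof -
  define N where "N = (\<Sum>v\<in>V. lk m v)"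
  define m' where "m' = (\<Sum>v\<in>V. sg v (N - lk m v))"
  have lm': "lk m' v = (if v \<in> V then N - lk m v else 0)" for v
    by (simp add: m'_def lookup_sum lookup_single when_def)
  have le: "lk m v \<le> N" if "v \<in> V" for v unfolding N_def using that by (intro member_le_sum) auto
  have km': "ks m' \<subseteq> V" by (auto simp: in_keys_iff lm' split: if_splits)
  have mm': "mon_eval t m' * mon_eval t m = (\<Prod>v\<in>V. t v) ^ N" for t :: "tvar \<Rightarrow> 'k"
    unfolding mon_eval_superset[OF finite_V km'] mon_eval_superset[OF finite_V assms] prod.distrib[symmetric] prod_power_distrib
    by (intro prod.cong) (auto simp: lm' le simp flip: power_add)
  show ?thesis
  proof (rule charI)
    show "inverse (mon_eval t m) = eval_at t (sg m' 1) / (\<Prod>v\<in>V. t v) ^ N" if "t \<in> T" for t :: "tvar \<Rightarrow> 'k"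
      unfolding mm'[symmetric] using mon_eval_T_nz[OF that]
      by (simp add: coeff_hom.eval_single[OF coeff_hom_id] field_simps)
    show "sg m' 1 \<in> P" using km' by (rule pr_single)
  qed (auto simp: mon_eval_T_nz mon_eval_mult)
qed

text \<open>A character is tested only at the parameter \<open>2\<close> of the one-parameter
  subgroups. As \<open>2\<close> has infinite order in characteristic zero, this already determines
  \<open>wt m\<close>.\<close>

definition has_wt :: "((tvar \<Rightarrow> 'k) \<Rightarrow> 'k) \<Rightarrow> (tvar \<Rightarrow>\<^sub>0 nat) \<Rightarrow> bool" where
  "has_wt \<chi> m \<longleftrightarrow> (\<forall>v\<in>V. \<chi> (opt v 2) = 2 powi wtf m v)"

lemma has_wt_mon: "ks m \<subseteq> V \<Longrightarrow> has_wt (\<lambda>t. mon_eval t m) m"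
  by (simp add: has_wt_def mon_eval_opt)

lemma two_powi_inj: "(2 :: 'k) powi x = 2 powi y \<Longrightarrow> x = y"
proof (induction x y rule: linorder_wlog)
  case (le x y)
  have "2 powi y = (2 :: 'k) powi x * 2 powi (y - x)" by (simp flip: power_int_add)
  then have "(2 :: 'k) powi (y - x) = 1" using le(2) by simp
  then have "(2 :: 'k) ^ nat (y - x) = 1" using le(1) by (simp add: power_int_def)
  then have "(of_nat (2 ^ nat (y - x)) :: 'k) = of_nat 1" by simp
  then have "(2 :: nat) ^ nat (y - x) = 1" by (simp only: of_nat_eq_iff)
  then show ?case using le(1) by simp
qed simp

lemma has_wt_mult:
  assumes "has_wt \<chi> m" "has_wt \<chi>' m'"
  shows "has_wt (\<lambda>t. \<chi> t * \<chi>' t) (m + m')"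
  using assms by (simp add: has_wt_def wtf_add power_int_add)

lemma has_wt_unique: "has_wt \<chi> m \<Longrightarrow> has_wt \<chi> m' \<Longrightarrow> wt m = wt m'"
  unfolding wt_eq_iff has_wt_def using two_powi_inj by metis

text \<open>Monomials of the wrong weight are discarded from an arbitrary representative, which is
  allowed because their weight components already vanish under \<open>\<Phi>\<close>.\<close>

theorem weight_repr:
  assumes "h \<in> wspace \<chi>"
  obtains f where "f \<in> P" "h = cls f" "\<And>m. m \<in> ks f \<Longrightarrow> has_wt \<chi> m"
proof -
  obtain f0 where f0: "f0 \<in> P" "h = cls f0"
    using assms unfolding tri_weight_space_def carrier_R by blast
  have inI: "torus_act t f0 - mconst (\<chi> t) * f0 \<in> I" if "t \<in> T" for t
    using assms that weight_space_cls[OF f0(1)] unfolding f0(2) by blast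
  define f where "f = (\<Sum>m\<in>{m \<in> ks f0. has_wt \<chi> m}. sg m (lk f0 m))"
  have lf: "lk f m = (if has_wt \<chi> m then lk f0 m else 0)" for m
    by (auto simp: f_def lookup_sum lookup_single when_def in_keys_iff)
  have "ks f \<subseteq> ks f0" by (auto simp: in_keys_iff lf split: if_splits)
  then have fP: "f \<in> P" using f0(1) by (auto simp: poly_ring_carrier)
  have "lk (\<Phi> f0) (wt m) = 0" if m: "m \<in> ks f0" "\<not> has_wt \<chi> m" for m
  proof -
    obtain v where v: "v \<in> V" "\<chi> (opt v 2) \<noteq> 2 powi wtf m v" using m(2) by (auto simp: has_wt_def)
    \<comment> \<open>In weight \<open>wt m\<close> the component of \<open>\<Phi> ?g\<close> is the
      nonzero constant \<open>?c\<close> times that of \<open>\<Phi> f0\<close>; since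
      \<open>?g\<close> lies in \<open>I\<close>, both are zero.\<close>
    let ?g = "torus_act (opt v 2) f0 - mconst (\<chi> (opt v 2)) * f0" and ?c = "2 powi wtf m v - \<chi> (opt v 2)"
    let ?S = "{m' \<in> ks f0. wt m' = wt m}"
    have "?g = (\<Sum>m'\<in>ks f0. sg m' ((mon_eval (opt v 2) m' - \<chi> (opt v 2)) * lk f0 m'))"
    proof (rule poly_mapping_eqI)
      fix k
      have "lk (mconst c * f0) k = c * lk f0 k" for c
        unfolding mconst_def mult_map_scale_conv_mult[symmetric] by (simp add: Poly_Mapping.map.rep_eq when_def)
      then show "lk ?g k = lk (\<Sum>m'\<in>ks f0. sg m' ((mon_eval (opt v 2) m' - \<chi> (opt v 2)) * lk f0 m')) k"
        by (auto simp: lookup_minus lookup_torus_act lookup_sum lookup_single when_def in_keys_iff algebra_simps)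
    qed
    then have "lk (\<Phi> ?g) (wt m) = (\<Sum>m'\<in>?S. fps_const ((mon_eval (opt v 2) m' - \<chi> (opt v 2)) * lk f0 m') * U m')"
      by (simp add: \<Phi>.sum \<Phi>_single lookup_sum lookup_single when_def sum.If_cases Collect_conj_eq)
    also have "\<dots> = (\<Sum>m'\<in>?S. fps_const ?c * (fps_const (lk f0 m') * U m'))"
    proof (rule sum.cong[OF refl])
      fix m' assume m': "m' \<in> ?S"
      then have "wtf m' v = wtf m v" using v(1) by (auto simp: wt_eq_iff)
      moreover have "ks m' \<subseteq> V" using m' f0(1) by (auto simp: poly_ring_carrier)
      ultimately show "fps_const ((mon_eval (opt v 2) m' - \<chi> (opt v 2)) * lk f0 m') * U m' = fps_const ?c * (fps_const (lk f0 m') * U m')"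
        by (simp add: mon_eval_opt flip: mult.assoc)
    qed
    also have "\<dots> = fps_const ?c * lk (\<Phi> f0) (wt m)" by (simp add: lookup_\<Phi> sum_distrib_left)
    finally show ?thesis using inI[OF opt_T[OF v(1)], of 2] v(2) I_sub_ker by auto
  qed
  then have *: "lk (\<Phi> f0) (wt m) = lk (\<Phi> f) (wt m)" if "m \<in> ks f0" for m
  proof (cases "has_wt \<chi> m")
    case True
    have hw: "has_wt \<chi> m'" if "wt m' = wt m" for m'
      using that True by (auto simp: has_wt_def wt_eq_iff)
    then have "{m' \<in> ks f. wt m' = wt m} = {m' \<in> ks f0. wt m' = wt m}" by (auto simp: in_keys_iff lf)
    then show ?thesis unfolding lookup_\<Phi> by (intro sum.cong) (auto simp: lf hw)
  next
    case False
    have "\<not> has_wt \<chi> m'" if "wt m' = wt m" for m'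
      using that False by (auto simp: has_wt_def wt_eq_iff)
    then have "{m' \<in> ks f. wt m' = wt m} = {}" by (auto simp: in_keys_iff lf)
    then have "lk (\<Phi> f) (wt m) = 0" unfolding lookup_\<Phi> by (simp only: sum.empty)
    moreover have "lk (\<Phi> f0) (wt m) = 0"
      using \<open>\<And>m. m \<in> ks f0 \<Longrightarrow> \<not> has_wt \<chi> m \<Longrightarrow> lk (\<Phi> f0) (wt m) = 0\<close> that False by blast
    ultimately show ?thesis by simp
  qed
  have "\<Phi> f0 = \<Phi> f"
  proof (rule poly_mapping_eqI)
    fix w show "lk (\<Phi> f0) w = lk (\<Phi> f) w"
    proof (cases "w \<in> wt ` ks f0")
      case True then show ?thesis using * by auto
    next
      case False
      then have "{m \<in> ks f0. wt m = w} = {}" "{m \<in> ks f. wt m = w} = {}" by (auto simp: in_keys_iff lf)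
      then show ?thesis unfolding lookup_\<Phi> by (simp only: sum.empty)
    qed
  qed
  then have "h = cls f" using f0 fP by (simp add: cls_eq_iff)
  then show ?thesis by (rule that[OF fP]) (auto simp: in_keys_iff lf split: if_splits)
qed

end

section \<open>Homogeneous elements and kernels\<close>

lemma prod_tri_vars:
  "(\<Prod>v\<in>tri_vars r n d. g v) = (\<Prod>i = 1..r. \<Prod>j = 1..n i. g (TV i j)) * (\<Prod>k = 1..d. g (SV k))"
proof -
  have "tri_vars r n d = (\<lambda>(i, j). TV i j) ` (SIGMA i:{1..r}. {1..n i}) \<union> SV ` {1..d}"
    by (force simp: tri_vars_def)
  moreover have "inj_on (\<lambda>(i, j). TV i j) (SIGMA i:{1..r}. {1..n i})" "inj_on SV {1..d}"
    by (auto simp: inj_on_def)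
  moreover have "(\<Prod>v\<in>(\<lambda>(i, j). TV i j) ` (SIGMA i:{1..r}. {1..n i}) \<union> SV ` {1..d}. g v)
    = (\<Prod>v\<in>(\<lambda>(i, j). TV i j) ` (SIGMA i:{1..r}. {1..n i}). g v) * (\<Prod>v\<in>SV ` {1..d}. g v)"
    by (rule prod.union_disjoint) auto
  ultimately show ?thesis by (simp add: prod.reindex prod.Sigma case_prod_unfold)
qed

lemma euler:
  assumes "\<And>m. m \<in> ks f \<Longrightarrow> lk m v = c"
  shows "mvar v * pd v f = of_nat c * f"
proof -
  have "mvar v * sg (m - sg v 1) (of_nat (lk m v) * lk f m) = of_nat c * sg m (lk f m)" if "m \<in> ks f" for m
  proof (cases "c = 0")
    case False
    have "sg v 1 + (m - sg v 1) = m"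
      using False assms[OF that] by (intro poly_mapping_eqI) (auto simp: lookup_add lookup_minus lookup_single when_def)
    then have "mvar v * sg (m - sg v 1) (of_nat (lk m v) * lk f m) = sg m (of_nat c * lk f m)"
      unfolding mvar_def mult_single using assms[OF that] by simp
    also have "\<dots> = of_nat c * sg m (lk f m)"
      by (simp add: mult_single flip: single_of_nat)
    finally show ?thesis .
  qed (simp add: assms[OF that])
  then have "mvar v * pd v f = (\<Sum>m\<in>ks f. of_nat c * sg m (lk f m))"
    by (simp add: pd_def sum_distrib_left)
  also have "\<dots> = of_nat c * f" by (simp flip: sum_distrib_left mpol_eq_sum_single)
  finally show ?thesis .
qed

context trinomial
begin

section \<open>Factorization of homogeneous elements\<close>

definition rmon :: "nat \<Rightarrow> (tvar, 'k) mpol" where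
  "rmon i = tri_mon n (\<lambda>i j. l i j div tri_gcd n l i) i"

lemma gcd_dvd: "j \<in> {1..n i} \<Longrightarrow> tri_gcd n l i dvd l i j"
  by (simp add: tri_gcd_def)

lemma gcd_pos: "i \<in> {1..r} \<Longrightarrow> tri_gcd n l i > 0"
  using gcd_dvd[of 1 i] n1[of i] l1[of i 1] by (auto intro!: Nat.gr0I)

lemma rmon_P: "i \<in> {1..r} \<Longrightarrow> rmon i \<in> P"
  unfolding rmon_def tri_mon_def by (intro pr_prod pr_power pr_mvar) (auto simp: TV_in)

lemma rmon_power: "i \<in> {1..r} \<Longrightarrow> rmon i ^ tri_gcd n l i = tri_mon n l i"
  unfolding rmon_def tri_mon_def prod_power_distrib
  using gcd_dvd[of _ i] by (intro prod.cong refl) (simp flip: power_mult)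

text \<open>With \<open>c\<close> the difference of the block degrees, \<open>tlen i\<close> divides
  \<open>c * l i j\<close> for all \<open>j\<close>, hence \<open>c\<close> times the gcd of the
  \<open>l i j\<close>; the quotient is \<open>s\<close>.\<close>

lemma wt_eq_multiple:
  assumes w: "wt m = wt m'" and i: "i \<in> {1..r}" and le: "bdeg i m' \<le> bdeg i m"
  shows "\<exists>s. \<forall>j\<in>{1..n i}. lk m (TV i j) = lk m' (TV i j) + s * (l i j div tri_gcd n l i)"
proof -
  define g where "g = tri_gcd n l i"
  define c where "c = bdeg i m - bdeg i m'"
  have D: "int (tlen i) * (int (lk m (TV i j)) - int (lk m' (TV i j))) = int (l i j * c)" if "j \<in> {1..n i}" for j
    using wtf_tm_block[OF w i that] le by (simp add: c_def of_nat_diff)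
  have "tlen i dvd c * l i j" if "j \<in> {1..n i}" for j
  proof -
    have "int (tlen i) dvd int (c * l i j)" using D[OF that] by (metis dvd_triv_left mult.commute)
    then show ?thesis by (simp only: of_nat_dvd_iff)
  qed
  then have "tlen i dvd Gcd ((*) c ` (l i ` {1..n i}))" by (auto intro!: Gcd_greatest)
  then have "tlen i dvd c * g" by (simp add: Gcd_mult tri_gcd_def g_def)
  then obtain s where s: "c * g = tlen i * s" by (auto elim: dvdE)
  have "lk m (TV i j) = lk m' (TV i j) + s * (l i j div g)" if j: "j \<in> {1..n i}" for j
  proof -
    obtain l' where l': "l i j = g * l'" using gcd_dvd[OF j] by (auto simp: g_def elim: dvdE)
    have g: "g > 0" using gcd_pos[OF i] by (simp add: g_def)
    have "int (tlen i) * (int (lk m (TV i j)) - int (lk m' (TV i j))) = int (l' * (c * g))"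
      using D[OF j] by (simp add: l' mult_ac)
    also have "\<dots> = int (tlen i) * int (s * l')" by (simp add: s)
    finally have "int (lk m (TV i j)) - int (lk m' (TV i j)) = int (s * l')"
      using tlen_pos[OF i] by simp
    then have "int (lk m (TV i j)) = int (lk m' (TV i j) + s * l')" by simp
    then have "lk m (TV i j) = lk m' (TV i j) + s * l'" by (simp only: of_nat_eq_iff)
    then show ?thesis using g by (simp add: l')
  qed
  then show ?thesis unfolding g_def by blast
qed

text \<open>All monomials of \<open>f\<close> arise from a common one by multiplying with powers of
  the \<open>rmon i\<close>; collecting these powers gives \<open>F\<close>.\<close>

lemma wt_factor:
  assumes f: "f \<in> P" and w: "\<forall>m\<in>ks f. \<forall>m'\<in>ks f. wt m = wt m'"
  shows "\<exists>F m0 \<alpha> \<gamma>. F \<in> carrier (poly_ring {1..r}) \<and> ks m0 \<subseteq> V \<and>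
    (\<forall>i j. lk m0 (TV i j) = (if TV i j \<in> V then \<alpha> i j else 0)) \<and> f = subst_vars rmon F * sg m0 1 \<and>
    sg m0 1 = (\<Prod>i = 1..r. \<Prod>j = 1..n i. mvar (TV i j) ^ \<alpha> i j) * (\<Prod>k = 1..d. mvar (SV k) ^ \<gamma> k :: (tvar, 'k) mpol) \<and>
    (\<forall>m\<in>ks f. \<forall>k\<in>{1..d}. lk m (SV k) = \<gamma> k)"
proof -
  obtain \<alpha> \<gamma> s where \<alpha>: "\<And>m i j. m \<in> ks f \<Longrightarrow> i \<in> {1..r} \<Longrightarrow> j \<in> {1..n i} \<Longrightarrow>
      lk m (TV i j) = \<alpha> i j + s m i * (l i j div tri_gcd n l i)"
    and \<gamma>: "\<And>m k. m \<in> ks f \<Longrightarrow> k \<in> {1..d} \<Longrightarrow> lk m (SV k) = \<gamma> k"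
  proof (cases "f = 0")
    case True then show ?thesis using that[of "\<lambda>_ _. 0"] by simp
  next
    case False
    then obtain m1 where m1: "m1 \<in> ks f" by (metis keys_eq_empty ex_in_conv)
    \<comment> \<open>The minimal block degree may be attained at a different monomial for each
      \<open>i\<close>. Taking the exponents block by block keeps all powers of the
      \<open>rmon i\<close> nonnegative.\<close>
    have "\<exists>mi\<in>ks f. \<forall>m\<in>ks f. bdeg i mi \<le> bdeg i m" for i
      using ex_is_arg_min_if_finite[OF finite_keys, of f "bdeg i"] False by (auto simp: is_arg_min_linorder)
    then obtain mi where mi: "\<And>i. mi i \<in> ks f" "\<And>i m. m \<in> ks f \<Longrightarrow> bdeg i (mi i) \<le> bdeg i m" by metis
    have "\<forall>m\<in>ks f. \<forall>i\<in>{1..r}. \<exists>s. \<forall>j\<in>{1..n i}. lk m (TV i j) = lk (mi i) (TV i j) + s * (l i j div tri_gcd n l i)"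
      using wt_eq_multiple[OF bspec[OF bspec[OF w] mi(1)] _ mi(2)] by blast
    then obtain s where "\<forall>m\<in>ks f. \<forall>i\<in>{1..r}. \<forall>j\<in>{1..n i}. lk m (TV i j) = lk (mi i) (TV i j) + s m i * (l i j div tri_gcd n l i)"
      by metis
    then show ?thesis using that[of "\<lambda>i j. lk (mi i) (TV i j)" s "\<lambda>k. lk m1 (SV k)"] wt_eq_SV[OF bspec[OF bspec[OF w] m1]] by blast
  qed
  define m0 where "m0 = (\<Sum>v\<in>V. sg v (case v of TV i j \<Rightarrow> \<alpha> i j | SV k \<Rightarrow> \<gamma> k))"
  have l0: "lk m0 v = (if v \<in> V then (case v of TV i j \<Rightarrow> \<alpha> i j | SV k \<Rightarrow> \<gamma> k) else 0)" for v
    by (simp add: m0_def lookup_sum lookup_single when_def)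
  have k0: "ks m0 \<subseteq> V" by (auto simp: in_keys_iff l0 split: if_splits)
  have m0: "sg m0 1 = (\<Prod>i = 1..r. \<Prod>j = 1..n i. mvar (TV i j) ^ \<alpha> i j) * (\<Prod>k = 1..d. mvar (SV k) ^ \<gamma> k :: (tvar, 'k) mpol)"
    unfolding mon_eval_mvar[symmetric] mon_eval_superset[OF finite_V k0] prod_tri_vars
    by (intro arg_cong2[of _ _ _ _ "(*)"] prod.cong refl) (auto simp: l0 TV_in SV_in)
  define F where "F = (\<Sum>m\<in>ks f. sg (\<Sum>i = 1..r. sg i (s m i)) (lk f m))"
  have F: "F \<in> carrier (poly_ring {1..r})"
    unfolding F_def
  proof (intro pr_sum pr_single)
    fix m show "ks (\<Sum>i = 1..r. sg i (s m i)) \<subseteq> {1..r}"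
      using keys_sum[of "\<lambda>i. sg i (s m i)" "{1..r}"] by (auto split: if_splits)
  qed
  have mon: "(\<Prod>i = 1..r. rmon i ^ s m i) * sg m0 1 = sg m 1" if m: "m \<in> ks f" for m
  proof -
    have km: "ks m \<subseteq> V" using f m by (auto simp: poly_ring_carrier)
    have "sg m 1 = (\<Prod>i = 1..r. \<Prod>j = 1..n i. mvar (TV i j) ^ lk m (TV i j)) * (\<Prod>k = 1..d. mvar (SV k) ^ lk m (SV k) :: (tvar, 'k) mpol)"
      unfolding mon_eval_mvar[symmetric] mon_eval_superset[OF finite_V km] prod_tri_vars ..
    also have "\<dots> = (\<Prod>i = 1..r. (\<Prod>j = 1..n i. mvar (TV i j) ^ \<alpha> i j) * rmon i ^ s m i) * (\<Prod>k = 1..d. mvar (SV k) ^ \<gamma> k)"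
      unfolding rmon_def tri_mon_def prod_power_distrib prod.distrib[symmetric]
      by (intro arg_cong2[of _ _ _ _ "(*)"] prod.cong refl)
         (simp_all add: \<alpha>[OF m] \<gamma>[OF m] power_add mult.commute flip: power_mult)
    finally show ?thesis by (simp add: m0 prod.distrib mult_ac)
  qed
  have "subst_vars rmon F * sg m0 1 = (\<Sum>m\<in>ks f. mconst (lk f m) * ((\<Prod>i = 1..r. rmon i ^ s m i) * sg m0 1))"
  proof -
    interpret sv: coeff_hom "subst_vars rmon" by (rule mconst.eval_hom)
    show ?thesis
      by (simp add: F_def sv.sum mconst.eval_single mon_eval_sum sum_distrib_right mult.assoc)
  qed
  also have "\<dots> = (\<Sum>m\<in>ks f. sg m (lk f m))"
    by (intro sum.cong refl) (simp only: mon single_eq_mconst_mult[symmetric])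
  also have "\<dots> = f" by (rule mpol_eq_sum_single[symmetric])
  finally have "f = subst_vars rmon F * sg m0 1" ..
  moreover have "\<forall>i j. lk m0 (TV i j) = (if TV i j \<in> V then \<alpha> i j else 0)" by (simp add: l0)
  ultimately show ?thesis using F k0 m0 \<gamma> by blast
qed

lemma homogeneous_repr:
  assumes "homogeneous_elem r n d l a h"
  obtains f where "f \<in> P" "h = cls f" "\<forall>m\<in>ks f. \<forall>m'\<in>ks f. wt m = wt m'"
proof -
  obtain \<chi> where "h \<in> wspace \<chi>" using assms unfolding homogeneous_elem_def by blast
  then obtain f where "f \<in> P" "h = cls f" "\<And>m. m \<in> ks f \<Longrightarrow> has_wt \<chi> m" using weight_repr by blast
  then show ?thesis using that has_wt_unique by blast
qed

section \<open>The kernel of the derivation along \<open>S_k\<close>\<close>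

lemma pd_tri_mon_0: "lk (tm i) v = 0 \<Longrightarrow> pd v (tri_mon n l i :: (tvar, 'k) mpol) = 0"
  by (simp add: tri_mon_eq pd_single)

lemma pd_diff: "pd v (f - g) = pd v f - pd v (g :: (tvar, 'k) mpol)"
  using pd_add[of v "f - g" g] by simp

lemma pd_gens:
  assumes "f \<in> gens" shows "pd (SV k) f = 0"
proof -
  obtain i where "f = tri_mon n l i - tri_mon n l (i + 1) - mconst (a (i + 1) - a i)"
    using assms unfolding gens_def by blast
  then show ?thesis by (simp add: pd_diff pd_tri_mon_0 lookup_tm)
qed

lemma vec_field_SV: "k \<in> {1..d} \<Longrightarrow> vec_field V (\<lambda>v. if v = SV k then 1 else 0) f = pd (SV k) f"
proof -
  assume "k \<in> {1..d}"
  then have "SV k \<in> V" by (simp add: SV_in)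
  then show ?thesis unfolding vec_field_def by (simp add: if_distrib[where f = "\<lambda>x. x * _"] cong: if_cong)
qed

lemma pd_in: "f \<in> P \<Longrightarrow> pd v f \<in> P"
  by (induction f rule: pr_induct) (auto simp: pd_mvar pd_add pd_mult)

lemma dS_cls: "k \<in> {1..d} \<Longrightarrow> f \<in> P \<Longrightarrow> dS r n d l a k (cls f) = cls (pd (SV k) f)"
  unfolding dS_def by (subst induced_cls) (auto simp: vec_field_SV pd_gens I_0)

text \<open>All monomials of a homogeneous representative have the same exponent
  \<open>\<gamma> k\<close> at \<open>S_k\<close>. If it is positive, Euler's identity makes
  \<open>\<gamma> k * f\<close> a multiple of a derivative that vanishes in \<open>R\<close>, so
  \<open>h\<close> is zero and \<open>F = 0\<close> serves.\<close>

theorem ker_dS: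
  assumes k: "k \<in> {1..d}" and h: "homogeneous_elem r n d l a h" "dS r n d l a k h = \<zero>\<^bsub>R\<^esub>"
  shows "\<exists>F\<in>carrier (poly_ring {1..r}). \<exists>\<alpha> \<gamma>.
     h = cls (subst_vars (\<lambda>i. tri_mon n (\<lambda>i j. l i j div tri_gcd n l i) i) F *
        (\<Prod>i = 1..r. \<Prod>j = 1..n i. mvar (TV i j) ^ \<alpha> i j) * (\<Prod>p\<in>{1..d} - {k}. mvar (SV p) ^ \<gamma> p))"
proof -
  obtain f where f: "f \<in> P" "h = cls f" "\<forall>m\<in>ks f. \<forall>m'\<in>ks f. wt m = wt m'"
    using homogeneous_repr[OF h(1)] by blast
  obtain F m0 \<alpha> \<gamma> where F: "F \<in> carrier (poly_ring {1..r})" "f = subst_vars rmon F * sg m0 1"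
    "sg m0 1 = (\<Prod>i = 1..r. \<Prod>j = 1..n i. mvar (TV i j) ^ \<alpha> i j) * (\<Prod>k = 1..d. mvar (SV k) ^ \<gamma> k :: (tvar, 'k) mpol)"
    and F\<gamma>: "\<forall>m\<in>ks f. \<forall>k\<in>{1..d}. lk m (SV k) = \<gamma> k"
    using wt_factor[OF f(1,3)] by (elim exE conjE)
  show ?thesis
  proof (cases "\<gamma> k = 0")
    case True
    have "(\<Prod>p = 1..d. mvar (SV p) ^ \<gamma> p) = (\<Prod>p\<in>{1..d} - {k}. mvar (SV p) ^ \<gamma> p :: (tvar, 'k) mpol)"
      using k True by (simp add: prod.remove[of _ k])
    then show ?thesis using F f(2) unfolding rmon_def[abs_def]
      by (intro bexI[of _ F] exI[of _ \<alpha>] exI[of _ \<gamma>]) (simp_all add: mult.assoc)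
  next
    case False
    have "\<Phi> (pd (SV k) f) = 0" using h(2) k f(1,2) by (simp add: dS_cls cls_eq_zero_iff pd_in)
    then have "\<Phi> (of_nat (\<gamma> k) * f) = 0" using F\<gamma> k euler[of f "SV k" "\<gamma> k"] by (metis \<Phi>.mult mult_zero_right)
    then have "\<Phi> f = 0" using False by (simp add: \<Phi>.mult \<Phi>.of_nat)
    then have "h = cls 0" using f(1,2) by (simp add: cls_eq_iff)
    then show ?thesis by (intro bexI[of _ 0]) (simp_all add: mp_eval_def)
  qed
qed

subsection \<open>Derivations on the image of the model\<close>

text \<open>Transports a map on cosets to the image of \<open>P\<close> under \<open>\<Phi>\<close>;
  the value is independent of the choices there, because \<open>\<Phi> p\<close> determines the
  coset of \<open>p\<close>.\<close>

definition model_der :: "((tvar, 'k) mpol set \<Rightarrow> (tvar, 'k) mpol set) \<Rightarrow> ((tvar \<Rightarrow>\<^sub>0 int) \<Rightarrow>\<^sub>0 'k fps) \<Rightarrow> (tvar \<Rightarrow>\<^sub>0 int) \<Rightarrow>\<^sub>0 'k fps" where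
  "model_der \<delta> x = \<Phi> (SOME q. q \<in> P \<and> cls q = \<delta> (cls (SOME p. p \<in> P \<and> \<Phi> p = x)))"

lemma model_der:
  assumes "p \<in> P" "q \<in> P" "\<delta> (cls p) = cls q"
  shows "model_der \<delta> (\<Phi> p) = \<Phi> q"
proof -
  let ?p = "SOME p'. p' \<in> P \<and> \<Phi> p' = \<Phi> p"
  have "?p \<in> P \<and> \<Phi> ?p = \<Phi> p" by (rule someI[of _ p]) (simp add: assms)
  then have p: "cls ?p = cls p" using assms(1) by (simp add: cls_eq_iff)
  define q' where "q' = (SOME q'. q' \<in> P \<and> cls q' = cls q)"
  have q': "q' \<in> P \<and> cls q' = cls q"
    unfolding q'_def by (rule someI[of _ q]) (simp add: assms)
  then have "\<Phi> q' = \<Phi> q" using assms(2) cls_eq_iff by blast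
  then show ?thesis unfolding model_der_def p assms(3) q'_def .
qed

lemma derivation_repr:
  assumes "derivation R \<iota> \<delta>" "p \<in> P"
  obtains q where "q \<in> P" "\<delta> (cls p) = cls q"
proof -
  have "\<delta> (cls p) \<in> carrier R" using assms cls_in[OF assms(2)] unfolding derivation_def by blast
  then show ?thesis using that unfolding carrier_R by blast
qed

lemma domain_der_model_der:
  assumes \<delta>: "derivation R (\<lambda>c. cls (mconst c)) \<delta>"
  shows "domain_der (\<Phi> ` P) (model_der \<delta>)"
proof
  show "1 \<in> \<Phi> ` P" using pr_1 \<Phi>.one by force
  show "f + g \<in> \<Phi> ` P" if "f \<in> \<Phi> ` P" "g \<in> \<Phi> ` P" for f g
    using that by (auto simp flip: \<Phi>.add)
  show "- f \<in> \<Phi> ` P" if "f \<in> \<Phi> ` P" for f using that by (auto simp flip: \<Phi>.uminus)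
  show "f * g \<in> \<Phi> ` P" if "f \<in> \<Phi> ` P" "g \<in> \<Phi> ` P" for f g
    using that by (auto simp flip: \<Phi>.mult)
  show "model_der \<delta> f \<in> \<Phi> ` P" if "f \<in> \<Phi> ` P" for f
  proof -
    obtain p where p: "p \<in> P" "f = \<Phi> p" using \<open>f \<in> \<Phi> ` P\<close> by blast
    obtain q where "q \<in> P" "\<delta> (cls p) = cls q" using derivation_repr[OF \<delta> p(1)] .
    then show ?thesis using p model_der[of p q \<delta>] by simp
  qed
  fix f g assume "f \<in> \<Phi> ` P" "g \<in> \<Phi> ` P"
  then obtain p q where p: "p \<in> P" "f = \<Phi> p" and q: "q \<in> P" "g = \<Phi> q" by blast
  obtain p' where p': "p' \<in> P" "\<delta> (cls p) = cls p'" using derivation_repr[OF \<delta> p(1)] .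
  obtain q' where q': "q' \<in> P" "\<delta> (cls q) = cls q'" using derivation_repr[OF \<delta> q(1)] .
  have "\<delta> (cls (p + q)) = cls (p' + q')"
    using \<delta> p q p' q' unfolding derivation_def by (metis cls_add cls_in)
  then show "model_der \<delta> (f + g) = model_der \<delta> f + model_der \<delta> g"
    using p q p' q' model_der[of "p + q" "p' + q'" \<delta>] model_der[of p p' \<delta>] model_der[of q q' \<delta>] by (simp add: \<Phi>.add)
  have "\<delta> (cls p \<otimes>\<^bsub>R\<^esub> cls q) = (\<delta> (cls p) \<otimes>\<^bsub>R\<^esub> cls q) \<oplus>\<^bsub>R\<^esub> (cls p \<otimes>\<^bsub>R\<^esub> \<delta> (cls q))"
    using \<delta> p q unfolding derivation_def by (simp only: cls_in)
  then have "\<delta> (cls (p * q)) = cls (p' * q + p * q')"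
    using p q p' q' by (simp add: cls_add cls_mult)
  then show "model_der \<delta> (f * g) = model_der \<delta> f * g + f * model_der \<delta> g"
    using p q p' q' model_der[of "p * q" "p' * q + p * q'" \<delta>] model_der[of p p' \<delta>] model_der[of q q' \<delta>]
    by (simp add: \<Phi>.add \<Phi>.mult)
qed

text \<open>Linearity gives \<open>\<delta> c = c * \<delta> 1\<close>, and the Leibniz rule gives
  \<open>\<delta> 1 = 0\<close>.\<close>

lemma model_der_const:
  assumes \<delta>: "derivation R (\<lambda>c. cls (mconst c)) \<delta>"
  shows "model_der \<delta> (\<kappa> c) = 0"
proof -
  interpret domain_der "\<Phi> ` P" "model_der \<delta>" by (rule domain_der_model_der[OF \<delta>])
  obtain q where q: "q \<in> P" "\<delta> (cls 1) = cls q" using derivation_repr[OF \<delta> pr_1] .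
  have "\<delta> (cls (mconst c) \<otimes>\<^bsub>R\<^esub> cls 1) = cls (mconst c) \<otimes>\<^bsub>R\<^esub> \<delta> (cls 1)"
    using \<delta> cls_in[OF pr_1] unfolding derivation_def by blast
  then have "\<delta> (cls (mconst c)) = cls (mconst c * q)" using q by (simp add: cls_mult)
  then have "model_der \<delta> (\<Phi> (mconst c)) = \<Phi> (mconst c) * \<Phi> q"
    using q by (simp add: model_der flip: \<Phi>.mult)
  moreover have "\<Phi> q = 0" using model_der[of 1 q \<delta>] q der_1 by simp
  ultimately show ?thesis by (simp add: \<Phi>_mconst)
qed

text \<open>Both sides obey the Leibniz rule and agree on constants and variables. Hence a
  derivation of \<open>R\<close> is determined by its values on the variables.\<close>

lemma model_der_chain:
  assumes \<delta>: "derivation R (\<lambda>c. cls (mconst c)) \<delta>" and p: "p \<in> P"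
  shows "model_der \<delta> (\<Phi> p) = (\<Sum>v\<in>V. \<Phi> (pd v p) * model_der \<delta> (\<Phi> (mvar v)))"
proof -
  interpret domain_der "\<Phi> ` P" "model_der \<delta>" by (rule domain_der_model_der[OF \<delta>])
  show ?thesis using p
  proof (induction p rule: pr_induct)
    case (const c) then show ?case using model_der_const[OF \<delta>] by (simp add: \<Phi>_mconst)
  next
    case (var w)
    have "(\<Sum>v\<in>V. \<Phi> (pd v (mvar w)) * model_der \<delta> (\<Phi> (mvar v))) = (\<Sum>v\<in>V. if v = w then model_der \<delta> (\<Phi> (mvar w)) else 0)"
      by (intro sum.cong) (auto simp: pd_mvar)
    then show ?case using var by simp
  next
    case (add f g)
    then show ?case by (simp add: \<Phi>.add der_add pd_add distrib_right sum.distrib)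
  next
    case (mult f g)
    then show ?case
      by (simp add: \<Phi>.mult \<Phi>.add der_mult pd_mult algebra_simps sum.distrib sum_distrib_left sum_distrib_right)
  qed
qed

lemma iter_repr:
  assumes \<delta>: "derivation R (\<lambda>c. cls (mconst c)) \<delta>" and p: "p \<in> P"
  shows "\<exists>q\<in>P. (\<delta> ^^ N) (cls p) = cls q \<and> (model_der \<delta> ^^ N) (\<Phi> p) = \<Phi> q"
proof (induction N)
  case 0 then show ?case using p by auto
next
  case (Suc N)
  then obtain q where q: "q \<in> P" "(\<delta> ^^ N) (cls p) = cls q" "(model_der \<delta> ^^ N) (\<Phi> p) = \<Phi> q" by blast
  obtain q' where "q' \<in> P" "\<delta> (cls q) = cls q'" using derivation_repr[OF \<delta> q(1)] .
  then show ?case using q model_der[of q q' \<delta>] by (intro bexI[of _ q']) auto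
qed

lemma lnd_model_der:
  assumes \<delta>: "derivation R (\<lambda>c. cls (mconst c)) \<delta>" "locally_nilpotent R \<delta>"
  shows "lnd (\<Phi> ` P) (model_der \<delta>)"
proof -
  interpret domain_der "\<Phi> ` P" "model_der \<delta>" by (rule domain_der_model_der[OF \<delta>(1)])
  show ?thesis
  proof unfold_locales
    fix f assume "f \<in> \<Phi> ` P"
    then obtain p where p: "p \<in> P" "f = \<Phi> p" by blast
    obtain N where "(\<delta> ^^ N) (cls p) = \<zero>\<^bsub>R\<^esub>" using \<delta>(2) cls_in[OF p(1)] unfolding locally_nilpotent_def by blast
    then show "\<exists>N. (model_der \<delta> ^^ N) f = 0" using iter_repr[OF \<delta>(1) p(1), of N] p(2) by (metis cls_eq_zero_iff)
  qed
qed

lemma model_der_X_ker: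
  assumes \<delta>: "derivation R (\<lambda>c. cls (mconst c)) \<delta>" and m: "ks m \<subseteq> V"
    and ker: "\<And>v. v \<in> ks m \<Longrightarrow> model_der \<delta> (\<Phi> (mvar v)) = 0"
  shows "model_der \<delta> (X m) = 0"
proof -
  have "\<Phi> (pd v (sg m 1)) * model_der \<delta> (\<Phi> (mvar v)) = 0" for v
    using ker[of v] by (cases "v \<in> ks m") (auto simp: pd_single in_keys_iff)
  then have "(\<Sum>v\<in>V. \<Phi> (pd v (sg m 1)) * model_der \<delta> (\<Phi> (mvar v))) = 0" by (intro sum.neutral) blast
  then show ?thesis using model_der_chain[OF \<delta> pr_single[OF m, of 1]] by (simp add: \<Phi>_mon)
qed

end

section \<open>Derivatives of the monomials \<open>T_i^{l_i}\<close>\<close>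

context trinomial
begin

lemma \<Phi>_tri_mon_diff:
  assumes "i \<in> {1..r}" "k \<in> {1..r}"
  shows "\<Phi> (tri_mon n l i) = \<Phi> (tri_mon n l k) + \<kappa> (b k - b i)"
proof -
  have "fps_X - fps_const (b i) = (fps_X - fps_const (b k)) + fps_const (b k - b i)"
    by (simp flip: fps_const_sub)
  then show ?thesis unfolding \<Phi>_tri_mon[OF assms(1)] \<Phi>_tri_mon[OF assms(2)] \<kappa>_def by (simp only: single_add)
qed

text \<open>The monomial of \<open>\<partial>T\<^sub>i\<^bsup>l\<^sub>i\<^esup> / \<partial>T\<^sub>i\<^sub>c\<close>.\<close>

definition dmon :: "nat \<Rightarrow> nat \<Rightarrow> tvar \<Rightarrow>\<^sub>0 nat" where "dmon i c = tm i - sg (TV i c) 1"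

lemma lookup_dmon: "lk (dmon i c) v = (if v = TV i c then lk (tm i) v - 1 else lk (tm i) v)"
  by (simp add: dmon_def lookup_minus lookup_single when_def)

lemma keys_dmon: "i \<in> {1..r} \<Longrightarrow> ks (dmon i c) \<subseteq> V"
  using keys_tm[of i] by (auto simp: in_keys_iff lookup_dmon split: if_splits)

lemma pd_tri_mon: "c \<in> {1..n i} \<Longrightarrow> pd (TV i c) (tri_mon n l i) = sg (dmon i c) (of_nat (l i c) :: 'k)"
  by (simp add: tri_mon_eq pd_single dmon_def lookup_tm)

lemma \<Phi>_pd_tri_mon_nz:
  assumes "i \<in> {1..r}" "c \<in> {1..n i}" shows "\<Phi> (pd (TV i c) (tri_mon n l i)) \<noteq> 0"
proof -
  have "lk (\<Phi> (pd (TV i c) (tri_mon n l i))) (wt (dmon i c)) \<noteq> 0"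
    using assms l1[of i c] U_nz by (simp add: pd_tri_mon \<Phi>_single)
  then show ?thesis by (metis lookup_zero)
qed

lemma model_der_tri_mon:
  assumes \<delta>: "derivation R (\<lambda>c. cls (mconst c)) \<delta>" and i: "i \<in> {1..r}" "c \<in> {1..n i}"
    and ker: "\<And>j. j \<in> {1..n i} \<Longrightarrow> j \<noteq> c \<Longrightarrow> model_der \<delta> (\<Phi> (mvar (TV i j))) = 0"
  shows "model_der \<delta> (\<Phi> (tri_mon n l i)) = \<Phi> (pd (TV i c) (tri_mon n l i)) * model_der \<delta> (\<Phi> (mvar (TV i c)))"
proof -
  have "\<Phi> (pd v (tri_mon n l i)) * model_der \<delta> (\<Phi> (mvar v)) = 0" if "v \<in> V - {TV i c}" for v
  proof (cases "lk (tm i) v = 0")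
    case True then show ?thesis by (simp add: pd_tri_mon_0)
  next
    case False
    then obtain j where "v = TV i j" "j \<in> {1..n i}" by (auto simp: lookup_tm split: tvar.splits if_splits)
    then show ?thesis using ker[of j] that by simp
  qed
  then have "(\<Sum>v\<in>V - {TV i c}. \<Phi> (pd v (tri_mon n l i)) * model_der \<delta> (\<Phi> (mvar v))) = 0"
    by (intro sum.neutral) blast
  moreover have "TV i c \<in> V" using i by (simp add: TV_in)
  ultimately show ?thesis unfolding model_der_chain[OF \<delta> tri_mon_in[OF i(1)]] by (simp add: sum.remove)
qed

text \<open>The part of admissibility under which \<open>deltaC\<close> is a derivation. For a given
  homogeneous locally nilpotent derivation the exponent condition is deduced later, from local
  nilpotency.\<close>

definition choice :: "(nat \<Rightarrow> nat) \<Rightarrow> bool" where "choice c \<longleftrightarrow> (\<forall>i\<in>{1..r}. c i \<in> {1..n i})"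

lemma choiceD: "choice c \<Longrightarrow> i \<in> {1..r} \<Longrightarrow> c i \<in> {1..n i}"
  unfolding choice_def by blast

subsection \<open>The derivations \<open>\<delta>\<^sub>C\<close>\<close>

lemma deltaC_gen_in:
  assumes "v \<in> V" shows "deltaC_gen r n l c v \<in> P"
  by (cases v) (auto intro!: pr_prod pd_in tri_mon_in)

text \<open>The value is the same for all \<open>i\<close>, so the generators of the ideal, which
  are differences of two such monomials up to constants, are annihilated.\<close>

lemma vec_field_deltaC_tri_mon:
  assumes i: "i \<in> {1..r}" and c: "c i \<in> {1..n i}"
  shows "vec_field V (deltaC_gen r n l c) (tri_mon n l i) = (\<Prod>k\<in>{1..r}. pd (TV k (c k)) (tri_mon n l k :: (tvar, 'k) mpol))"
proof -
  have "deltaC_gen r n l c v * pd v (tri_mon n l i) = (0 :: (tvar, 'k) mpol)" if "v \<in> V - {TV i (c i)}" for v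
  proof (cases "lk (tm i) v = 0")
    case True then show ?thesis by (simp add: pd_tri_mon_0)
  next
    case False
    then obtain j where "v = TV i j" by (auto simp: lookup_tm split: tvar.splits if_splits)
    then show ?thesis using that by simp
  qed
  then have "(\<Sum>v\<in>V - {TV i (c i)}. deltaC_gen r n l c v * pd v (tri_mon n l i)) = (0 :: (tvar, 'k) mpol)"
    by (intro sum.neutral) blast
  moreover have "TV i (c i) \<in> V" using i c by (simp add: TV_in)
  ultimately have "vec_field V (deltaC_gen r n l c) (tri_mon n l i)
    = deltaC_gen r n l c (TV i (c i)) * pd (TV i (c i)) (tri_mon n l i :: (tvar, 'k) mpol)"
    unfolding vec_field_def by (simp add: sum.remove)
  also have "\<dots> = (\<Prod>k\<in>{1..r}. pd (TV k (c k)) (tri_mon n l k))"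
    by (subst prod.remove[of "{1..r}" i]) (use i in \<open>simp_all add: mult.commute\<close>)
  finally show ?thesis .
qed

lemma vec_field_deltaC_gens:
  assumes c: "choice c" and f: "f \<in> gens"
  shows "vec_field V (deltaC_gen r n l c) f = 0"
proof -
  obtain i where i: "i \<in> {1..r - 1}" and f: "f = tri_mon n l i - tri_mon n l (i + 1) - mconst (a (i + 1) - a i)"
    using f unfolding gens_def by blast
  have i': "i \<in> {1..r}" "i + 1 \<in> {1..r}" using i by auto
  have d: "vec_field V g (f - f') = vec_field V g f - vec_field V g f'" for g and f f' :: "(tvar, 'k) mpol"
    using vec_field_add[of V g "f - f'" f'] by simp
  show ?thesis unfolding f d vec_field_deltaC_tri_mon[where c = c, OF i'(1) choiceD[OF c i'(1)]]
      vec_field_deltaC_tri_mon[where c = c, OF i'(2) choiceD[OF c i'(2)]]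
    by simp
qed

lemma deltaC_cls:
  assumes c: "choice c" and f: "f \<in> P"
  shows "deltaC r n d l a c (cls f) = cls (vec_field V (deltaC_gen r n l c) f)"
  unfolding deltaC_def using deltaC_gen_in f vec_field_deltaC_gens[OF c] I_0 by (intro induced_cls) auto

lemma deltaC_P: "f \<in> P \<Longrightarrow> vec_field V (deltaC_gen r n l c) f \<in> P"
  by (rule vec_field_in[OF finite_V deltaC_gen_in])

lemma derivation_deltaC:
  assumes c: "choice c"
  shows "derivation R (\<lambda>c. cls (mconst c)) (deltaC r n d l a c)"
proof -
  have D: "deltaC r n d l a c (cls f) = cls (vec_field V (deltaC_gen r n l c) f)"
    "vec_field V (deltaC_gen r n l c) f \<in> P" if "f \<in> P" for f
    using that deltaC_cls[OF c] deltaC_P by auto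
  show ?thesis unfolding derivation_def carrier_R
    by (simp add: D cls_add cls_mult vec_field_add vec_field_mult Pi_iff)
qed

lemma model_der_deltaC:
  assumes "choice c" "f \<in> P"
  shows "model_der (deltaC r n d l a c) (\<Phi> f) = \<Phi> (vec_field V (deltaC_gen r n l c) f)"
  using assms by (intro model_der) (auto simp: deltaC_P deltaC_cls)

lemma model_der_deltaC_var:
  assumes "choice c" "v \<in> V"
  shows "model_der (deltaC r n d l a c) (\<Phi> (mvar v)) = \<Phi> (deltaC_gen r n l c v)"
  using assms by (simp add: model_der_deltaC vec_field_mvar)

lemma admissibleD:
  assumes "admissible r n l c"
  shows "choice c" "\<exists>i0\<in>{1..r}. \<forall>i\<in>{1..r} - {i0}. l i (c i) = 1"
  using assms unfolding admissible_def choice_def by blast+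

text \<open>Only \<open>\<partial>T\<^sub>k\<^bsup>l\<^sub>k\<^esup> / \<partial>T\<^sub>k\<^sub>c\<close> with \<open>k = i\<^sub>0\<close> can involve a variable outside the kernel, and
  that variable is sent into the kernel.\<close>

lemma lnd_deltaC:
  assumes c: "admissible r n l c"
  shows "lnd (\<Phi> ` P) (model_der (deltaC r n d l a c))"
proof -
  note cC = admissibleD(1)[OF c]
  note cD = choiceD[OF cC]
  note der = derivation_deltaC[OF cC]
  let ?\<Delta> = "model_der (deltaC r n d l a c)"
  interpret domain_der "\<Phi> ` P" ?\<Delta> by (rule domain_der_model_der[OF der])
  obtain i0 where i0: "i0 \<in> {1..r}" "\<And>i. i \<in> {1..r} - {i0} \<Longrightarrow> l i (c i) = 1"
    using admissibleD(2)[OF c] by blast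
  define D where "D k = \<Phi> (pd (TV k (c k)) (tri_mon n l k))" for k
  \<comment> \<open>The elements killed by a power of \<open>?\<Delta>\<close> are closed under
    sums, products and antiderivatives (\<open>nil_der\<close>), so it suffices to find constants
    and variables among them.\<close>
  define nil where "nil f \<longleftrightarrow> f \<in> \<Phi> ` P \<and> (\<exists>N. (?\<Delta> ^^ N) f = 0)" for f
  have nil_mult: "nil (f * g)" if "nil f" "nil g" for f g
    using that nilpotent_mult[of f g] mult_in unfolding nil_def by blast
  have nil_add: "nil (f + g)" if "nil f" "nil g" for f g
    using that nilpotent_add[of f g] add_in unfolding nil_def by blast
  have nil_ker: "nil f" if "f \<in> \<Phi> ` P" "?\<Delta> f = 0" for f
    unfolding nil_def using that by (intro conjI exI[of _ 1]) auto
  have nil_der: "nil f" if f: "f \<in> \<Phi> ` P" "nil (?\<Delta> f)" for f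
  proof -
    obtain N where "(?\<Delta> ^^ N) (?\<Delta> f) = 0" using f by (auto simp: nil_def)
    then have "(?\<Delta> ^^ Suc N) f = 0" by (simp add: funpow_swap1)
    then show ?thesis using f(1) unfolding nil_def by blast
  qed
  have nil_1: "nil 1" by (rule nil_ker) (auto simp: one_in der_1)
  have nil_power: "nil (f ^ k)" if "nil f" for f k
    by (induction k) (auto simp: nil_1 nil_mult that)
  have nil_prod: "nil (\<Prod>i\<in>A. f i)" if "\<And>i. i \<in> A \<Longrightarrow> nil (f i)" for A :: "'x set" and f
    using that by (induction A rule: infinite_finite_induct) (auto simp: nil_1 nil_mult)
  have const: "nil (\<kappa> x)" for x
    using model_der_const[OF der, of x] by (intro nil_ker) (auto simp flip: \<Phi>_mconst)
  have DP: "D k \<in> \<Phi> ` P" if "k \<in> {1..r}" for k using that by (auto simp: D_def intro!: imageI pd_in tri_mon_in)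
  have var: "?\<Delta> (\<Phi> (mvar (TV i j))) = (if j = c i then \<Prod>k\<in>{1..r} - {i}. D k else 0)" if "TV i j \<in> V" for i j
    using model_der_deltaC_var[OF cC that] by (simp add: D_def \<Phi>.prod)
  have Dker: "?\<Delta> (D k) = 0" if k: "k \<in> {1..r} - {i0}" for k
  proof -
    have kr: "k \<in> {1..r}" using k by simp
    have "D k = X (dmon k (c k))" using i0(2)[OF k] unfolding D_def pd_tri_mon[OF cD[OF kr]] by (simp add: \<Phi>_mon)
    moreover have "?\<Delta> (X (dmon k (c k))) = 0"
    proof (rule model_der_X_ker[OF der keys_dmon[OF kr]])
      fix v assume v: "v \<in> ks (dmon k (c k))"
      then obtain j where j: "v = TV k j" "j \<noteq> c k" using i0(2)[OF k]
        by (cases v) (auto simp: in_keys_iff lookup_dmon lookup_tm split: if_splits)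
      then show "?\<Delta> (\<Phi> (mvar v)) = 0" using v keys_dmon[OF kr, of "c k"] var[of k j] by auto
    qed
    ultimately show ?thesis by simp
  qed
  have n0: "nil (\<Phi> (mvar (TV i0 j)))" if j: "j \<in> {1..n i0}" for j
  proof (rule nil_der)
    have V: "TV i0 j \<in> V" using j i0(1) by (simp add: TV_in)
    then show "\<Phi> (mvar (TV i0 j)) \<in> \<Phi> ` P" by simp
    have "nil (\<Prod>k\<in>{1..r} - {i0}. D k)" using Dker DP by (intro nil_prod nil_ker) auto
    then show "nil (?\<Delta> (\<Phi> (mvar (TV i0 j))))"
      unfolding var[OF V] using nil_ker[OF zero_in der_0] by simp
  qed
  \<comment> \<open>\<open>D i0\<close> involves only variables of the block \<open>i0\<close>,
    which are settled in \<open>n0\<close>.\<close>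
  have "nil (D i0)"
  proof -
    have "D i0 = \<kappa> (of_nat (l i0 (c i0))) * (\<Prod>v\<in>ks (dmon i0 (c i0)). \<Phi> (mvar v) ^ lk (dmon i0 (c i0)) v)"
      unfolding D_def pd_tri_mon[OF cD[OF i0(1)]]
      by (subst single_eq_mconst_mult) (simp add: \<Phi>.mult \<Phi>_mconst mon_eval_def \<Phi>.prod \<Phi>.power flip: mon_eval_mvar)
    moreover have "nil (\<Phi> (mvar v))" if "v \<in> ks (dmon i0 (c i0))" for v
    proof -
      have "v \<in> ks (tm i0)" using that by (auto simp: in_keys_iff lookup_dmon split: if_splits)
      then show ?thesis using n0 by (auto simp: in_keys_iff lookup_tm split: tvar.splits if_splits)
    qed
    ultimately show ?thesis by (auto intro!: nil_mult const nil_prod nil_power)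
  qed
  then have nD: "nil (D k)" if "k \<in> {1..r}" for k
    using that nil_ker[OF DP Dker, of k] by (cases "k = i0") auto
  have nvar: "nil (\<Phi> (mvar v))" if v: "v \<in> V" for v
  proof (rule nil_der)
    show "\<Phi> (mvar v) \<in> \<Phi> ` P" using v by simp
    show "nil (?\<Delta> (\<Phi> (mvar v)))"
    proof (cases v)
      case (TV i j)
      then show ?thesis using var[of i j] v nil_ker[OF zero_in der_0] by (auto intro!: nil_prod nD)
    next
      case (SV k)
      then show ?thesis using model_der_deltaC_var[OF cC v] nil_ker[OF zero_in der_0] by simp
    qed
  qed
  have "nil (\<Phi> f)" if "f \<in> P" for f
    using that by (induction f rule: pr_induct)
      (auto simp: \<Phi>_mconst \<Phi>.add \<Phi>.mult intro: const nvar nil_add nil_mult)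
  then show ?thesis by unfold_locales (auto simp: nil_def)
qed

text \<open>Both factors supplied by \<open>wt_factor\<close> lie in the factorially closed kernel.
  The monomial then avoids the moved variables, and the other factor is a polynomial in a single
  element \<open>\<eta>\<close> outside the kernel, hence constant by
  \<open>ker_poly\<close>.\<close>

theorem ker_deltaC:
  assumes c: "admissible r n l c"
    and h: "homogeneous_elem r n d l a h" "deltaC r n d l a c h = \<zero>\<^bsub>R\<^esub>"
  shows "\<exists>u \<alpha> \<gamma>. h = cls (mconst u * (\<Prod>i = 1..r. \<Prod>j\<in>{1..n i} - {c i}. mvar (TV i j) ^ \<alpha> i j) * (\<Prod>p = 1..d. mvar (SV p) ^ \<gamma> p))"
proof -
  note cC = admissibleD(1)[OF c]
  note cD = choiceD[OF cC]
  note der = derivation_deltaC[OF cC]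
  let ?\<Delta> = "model_der (deltaC r n d l a c)"
  interpret lnd "\<Phi> ` P" ?\<Delta> by (rule lnd_deltaC[OF c])
  obtain i0 where i0: "i0 \<in> {1..r}" "\<And>i. i \<in> {1..r} - {i0} \<Longrightarrow> l i (c i) = 1"
    using admissibleD(2)[OF c] by blast
  obtain f where f: "f \<in> P" "h = cls f" "\<forall>m\<in>ks f. \<forall>m'\<in>ks f. wt m = wt m'"
    using homogeneous_repr[OF h(1)] by blast
  obtain F m0 \<alpha> \<gamma> where F: "F \<in> carrier (poly_ring {1..r})" "ks m0 \<subseteq> V"
      "\<forall>i j. lk m0 (TV i j) = (if TV i j \<in> V then \<alpha> i j else 0)" "f = subst_vars rmon F * sg m0 1"
    "sg m0 1 = (\<Prod>i = 1..r. \<Prod>j = 1..n i. mvar (TV i j) ^ \<alpha> i j) * (\<Prod>k = 1..d. mvar (SV k) ^ \<gamma> k :: (tvar, 'k) mpol)"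
    using wt_factor[OF f(1,3)] by (elim exE conjE)
  have "cls (vec_field V (deltaC_gen r n l c) f) = \<zero>\<^bsub>R\<^esub>" using h(2) f(1,2) cC by (simp add: deltaC_cls)
  then have ker: "?\<Delta> (\<Phi> f) = 0" using cC f(1) by (simp add: model_der_deltaC cls_eq_zero_iff deltaC_P)
  show ?thesis
  proof (cases "\<Phi> f = 0")
    case True
    then have "h = cls 0" using f by (simp add: cls_eq_iff)
    then show ?thesis by (intro exI[of _ 0]) simp
  next
    case False
    interpret sv: coeff_hom "subst_vars rmon" by (rule mconst.eval_hom)
    have SP: "subst_vars rmon F \<in> P"
      using F(1) by (induction F rule: pr_induct) (auto simp: mconst.eval_mconst mconst.eval_mvar sv.add sv.mult rmon_P)
    have XP: "X m \<in> \<Phi> ` P" if "ks m \<subseteq> V" for m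
      using that by (auto simp: pr_single simp flip: \<Phi>_mon)
    have fX: "\<Phi> f = \<Phi> (subst_vars rmon F) * X m0" by (simp add: F(4) \<Phi>.mult \<Phi>_mon)
    have kS: "?\<Delta> (\<Phi> (subst_vars rmon F)) = 0" and kX: "?\<Delta> (X m0) = 0"
      using ker_factor[of "\<Phi> (subst_vars rmon F)" "X m0"] ker False SP XP[OF F(2)] unfolding fX by auto
    have prod_nz: "(\<Prod>k\<in>A. \<Phi> (pd (TV k (c k)) (tri_mon n l k))) \<noteq> 0" if "A \<subseteq> {1..r}" for A
      using that \<Phi>_pd_tri_mon_nz cD finite_subset[OF that] by (auto simp: subset_iff)
    \<comment> \<open>A positive exponent would put the variable with index \<open>c i\<close> into
      the kernel, but its image is a nonzero product of partial derivatives.\<close>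
    have \<alpha>0: "\<alpha> i (c i) = 0" if i: "i \<in> {1..r}" for i
    proof (rule ccontr)
      assume nz: "\<alpha> i (c i) \<noteq> 0"
      have V: "TV i (c i) \<in> V" using i cD by (simp add: TV_in)
      define m1 where "m1 = m0 - sg (TV i (c i)) 1"
      have m0: "m0 = sg (TV i (c i)) 1 + m1" using nz F(3) V
        by (intro poly_mapping_eqI) (auto simp: m1_def lookup_add lookup_minus lookup_single when_def)
      have k1: "ks m1 \<subseteq> V" using F(2) unfolding m0 by (auto simp: in_keys_iff lookup_add)
      have "X m0 = \<Phi> (mvar (TV i (c i))) * X m1" by (simp add: m0 X_add \<Phi>_mvar)
      then have "?\<Delta> (\<Phi> (mvar (TV i (c i)))) = 0"
        using ker_factor(1)[of "\<Phi> (mvar (TV i (c i)))" "X m1"] kX X_nz[of m0] XP[OF k1] V by auto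
      then show False using model_der_deltaC_var[OF cC V] prod_nz[of "{1..r} - {i}"] by (simp add: \<Phi>.prod)
    qed
    define \<eta> where "\<eta> = \<Phi> (rmon i0)"
    have \<eta>P: "\<eta> \<in> \<Phi> ` P" using i0(1) rmon_P by (simp add: \<eta>_def)
    have \<eta>pow: "\<eta> ^ tri_gcd n l i0 = \<Phi> (tri_mon n l i0)"
      using i0(1) by (simp add: \<eta>_def rmon_power flip: \<Phi>.power)
    have "?\<Delta> (\<Phi> (tri_mon n l i0)) = (\<Prod>k\<in>{1..r}. \<Phi> (pd (TV k (c k)) (tri_mon n l k)))"
      unfolding model_der_deltaC[OF cC tri_mon_in[OF i0(1)]] vec_field_deltaC_tri_mon[where c = c, OF i0(1) cD[OF i0(1)]] \<Phi>.prod ..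
    \<comment> \<open>A power of \<open>\<eta>\<close> is the monomial of block \<open>i0\<close>,
      whose image is a nonzero product.\<close>
    then have \<eta>nz: "?\<Delta> \<eta> \<noteq> 0"
      using der_power_ker[OF \<eta>P, of "tri_gcd n l i0"] prod_nz[of "{1..r}"] unfolding \<eta>pow by auto
    interpret pe: coeff_hom "\<lambda>q. poly (map_poly \<kappa> q) \<eta>" by (rule \<kappa>.poly_hom)
    have rm: "\<exists>q. \<Phi> (rmon i) = poly (map_poly \<kappa> q) \<eta>" if i: "i \<in> {1..r}" for i
    proof (cases "i = i0")
      case True
      then show ?thesis by (intro exI[of _ "[:0, 1:]"]) (simp add: \<eta>_def map_poly_pCons)
    next
      case False
      \<comment> \<open>For \<open>i \<noteq> i0\<close> an exponent \<open>1\<close> in the block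
        forces \<open>d_i = 1\<close>, so \<open>rmon i\<close> is \<open>T_i^{l_i}\<close> itself,
        which differs from a power of \<open>\<eta>\<close> by a constant.\<close>
      then have "l i (c i) = 1" using i0(2) i by simp
      then have "tri_gcd n l i = 1" using gcd_dvd[OF cD[OF i]] by simp
      then have "\<Phi> (rmon i) = \<Phi> (tri_mon n l i)" using rmon_power[OF i] by simp
      also have "\<dots> = \<eta> ^ tri_gcd n l i0 + \<kappa> (b i0 - b i)"
        unfolding \<eta>pow by (rule \<Phi>_tri_mon_diff[OF i i0(1)])
      also have "\<dots> = poly (map_poly \<kappa> ([:0, 1:] ^ tri_gcd n l i0 + [:b i0 - b i:])) \<eta>"
        by (simp add: pe.add pe.power map_poly_pCons)
      finally show ?thesis by blast
    qed
    have "\<exists>q. \<Phi> (subst_vars rmon F) = poly (map_poly \<kappa> q) \<eta>"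
      using F(1)
    proof (induction F rule: pr_induct)
      case (const x)
      then show ?case by (intro exI[of _ "[:x:]"]) (simp add: mconst.eval_mconst \<Phi>_mconst map_poly_pCons)
    next
      case (var v) then show ?case using rm by (simp add: mconst.eval_mvar)
    next
      case (add f g) then show ?case by (metis sv.add \<Phi>.add pe.add)
    next
      case (mult f g) then show ?case by (metis sv.mult \<Phi>.mult pe.mult)
    qed
    then obtain q where q: "\<Phi> (subst_vars rmon F) = poly (map_poly \<kappa> q) \<eta>" by blast
    have "degree q = 0"
    proof (rule ker_poly[where \<iota> = \<kappa> and y = \<eta>])
      show "\<kappa> x \<in> \<Phi> ` P \<and> ?\<Delta> (\<kappa> x) = 0" for x using model_der_const[OF der] by (auto simp flip: \<Phi>_mconst)
      show "poly (map_poly \<kappa> q) \<eta> \<noteq> 0" using False unfolding fX q by auto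
    qed (use \<eta>P \<eta>nz kS q \<kappa>.add \<kappa>.mult in auto)
    then obtain u where "q = [:u:]" using degree_eq_zeroE by blast
    then have "\<Phi> f = \<Phi> (mconst u * sg m0 1)" using fX q by (simp add: map_poly_pCons \<Phi>.mult \<Phi>_mconst \<Phi>_mon)
    then have "h = cls (mconst u * sg m0 1)" using f(1,2) pr_single[OF F(2), of "1 :: 'k"] by (simp add: cls_eq_iff)
    also have "mconst u * sg m0 1 = mconst u * (\<Prod>i = 1..r. \<Prod>j\<in>{1..n i} - {c i}. mvar (TV i j) ^ \<alpha> i j) * (\<Prod>p = 1..d. mvar (SV p) ^ \<gamma> p)"
    proof -
      have "(\<Prod>j = 1..n i. mvar (TV i j) ^ \<alpha> i j) = (\<Prod>j\<in>{1..n i} - {c i}. mvar (TV i j) ^ \<alpha> i j :: (tvar, 'k) mpol)"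
        if "i \<in> {1..r}" for i
        by (subst prod.remove[of "{1..n i}" "c i"]) (use cD[OF that] \<alpha>0[OF that] in simp_all)
      then show ?thesis unfolding F(5) by (simp add: mult.assoc)
    qed
    finally show ?thesis by blast
  qed
qed

end

section \<open>Homogeneous locally nilpotent derivations\<close>

text \<open>\<open>\<epsilon>\<close> is the degree of \<open>\<delta>\<close>, and
  \<open>g v\<close> represents the image of the variable \<open>v\<close> by a polynomial whose
  monomials all have the weight of \<open>v\<close> shifted by \<open>\<epsilon>\<close>.\<close>

locale homogeneous_lnd = trinomial +
  fixes \<delta> and \<epsilon> and g :: "tvar \<Rightarrow> (tvar, 'a) mpol"
  assumes der: "derivation R (\<lambda>c. cls (mconst c)) \<delta>" and nilpotent: "locally_nilpotent R \<delta>"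
    and \<epsilon>: "\<epsilon> \<in> chars" and hom: "\<And>\<chi>. \<chi> \<in> chars \<Longrightarrow> \<delta> ` wspace \<chi> \<subseteq> wspace (\<lambda>t. \<chi> t * \<epsilon> t)"
    and g_in: "\<And>v. v \<in> V \<Longrightarrow> g v \<in> P" and g: "\<And>v. v \<in> V \<Longrightarrow> \<delta> (cls (mvar v)) = cls (g v)"
    and g_wt: "\<And>v m. v \<in> V \<Longrightarrow> m \<in> ks (g v) \<Longrightarrow> has_wt (\<lambda>t. mon_eval t (sg v 1) * \<epsilon> t) m"
begin

sublocale lnd "\<Phi> ` P" "model_der \<delta>" by (rule lnd_model_der[OF der nilpotent])

abbreviation \<Delta> where "\<Delta> \<equiv> model_der \<delta>"

lemma \<Delta>_var: "v \<in> V \<Longrightarrow> \<Delta> (\<Phi> (mvar v)) = \<Phi> (g v)"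
  by (rule model_der) (auto simp: g g_in)

text \<open>Carries a factorization found in the model back to cosets.\<close>

lemma \<delta>_eq:
  assumes h: "h \<in> P" and D: "\<And>f. f \<in> P \<Longrightarrow> D f \<in> P" and eq: "\<And>f. f \<in> P \<Longrightarrow> \<Delta> (\<Phi> f) = \<Phi> h * \<Phi> (D f)" and f: "f \<in> P"
  shows "\<delta> (cls f) = cls h \<otimes>\<^bsub>R\<^esub> cls (D f)"
proof -
  obtain q where q: "q \<in> P" "\<delta> (cls f) = cls q" using derivation_repr[OF der f] .
  have "\<Phi> q = \<Phi> (h * D f)" using model_der[of f q \<delta>] f q eq[OF f] by (simp add: \<Phi>.mult)
  then show ?thesis using q h D[OF f] by (simp add: cls_mult cls_eq_iff)
qed

text \<open>Both monomials have the weight of \<open>v * v'\<close> shifted by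
  \<open>\<epsilon>\<close>.\<close>

lemma compare_wt:
  assumes "v \<in> V" "v' \<in> V" "m \<in> ks (g v)" "m' \<in> ks (g v')"
  shows "wt (m + sg v' 1) = wt (m' + sg v 1)"
proof -
  have "has_wt (\<lambda>t. mon_eval t (sg v 1) * \<epsilon> t * mon_eval t (sg v' 1)) (m + sg v' 1)"
    using has_wt_mult[OF g_wt[OF assms(1,3)] has_wt_mon[of "sg v' 1"]] assms(2) by simp
  moreover have "has_wt (\<lambda>t. mon_eval t (sg v' 1) * \<epsilon> t * mon_eval t (sg v 1)) (m' + sg v 1)"
    using has_wt_mult[OF g_wt[OF assms(2,4)] has_wt_mon[of "sg v 1"]] assms(1) by simp
  ultimately show ?thesis by (intro has_wt_unique) (simp_all add: mult_ac)
qed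

text \<open>If \<open>v\<close> divided every monomial of \<open>g v\<close>, it would divide its
  own image, and \<open>dvd_der_imp_ker\<close> would make that image zero.\<close>

lemma nonzero_key:
  assumes v: "v \<in> V" and nz: "\<Delta> (\<Phi> (mvar v)) \<noteq> 0"
  obtains m where "m \<in> ks (g v)" "lk m v = 0"
proof -
  have "\<exists>m\<in>ks (g v). lk m v = 0"
  proof (rule ccontr)
    assume "\<not> ?thesis"
    then have pos: "\<forall>m\<in>ks (g v). lk m v \<noteq> 0" by simp
    define q where "q = (\<Sum>m\<in>ks (g v). sg (m - sg v 1) (lk (g v) m))"
    have "mvar v * q = (\<Sum>m\<in>ks (g v). sg m (lk (g v) m))"
      unfolding q_def sum_distrib_left
    proof (rule sum.cong[OF refl])
      fix m assume "m \<in> ks (g v)"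
      then have "sg v 1 + (m - sg v 1) = m"
        using pos by (intro poly_mapping_eqI) (auto simp: lookup_add lookup_minus lookup_single when_def)
      then show "mvar v * sg (m - sg v 1) (lk (g v) m) = sg m (lk (g v) m)" by (simp add: mvar_def mult_single)
    qed
    then have gq: "g v = mvar v * q" by (simp flip: mpol_eq_sum_single)
    have "q \<in> P" unfolding q_def
    proof (intro pr_sum pr_single)
      fix m assume "m \<in> ks (g v)"
      then have "ks m \<subseteq> V" using g_in[OF v] by (auto simp: poly_ring_carrier)
      then show "ks (m - sg v 1) \<subseteq> V" by (auto simp: in_keys_iff lookup_minus)
    qed
    then have "\<Delta> (\<Phi> (mvar v)) = 0"
      using v \<Delta>_var[OF v] by (intro dvd_der_imp_ker[of "\<Phi> (mvar v)" "\<Phi> q"]) (auto simp: gq \<Phi>.mult)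
    then show False using nz by simp
  qed
  then show ?thesis using that by blast
qed

lemma key_exists: "v \<in> V \<Longrightarrow> \<Delta> (\<Phi> (mvar v)) \<noteq> 0 \<Longrightarrow> \<exists>m. m \<in> ks (g v)"
  using nonzero_key by blast

text \<open>Take a monomial \<open>m\<close> free of \<open>T_ij\<close> in the image of
  \<open>T_ij\<close>, and \<open>m'\<close> free of \<open>T_ij'\<close> in that of
  \<open>T_ij'\<close>. The exponents of \<open>T_ij\<close> show that \<open>m * T_ij'\<close> has
  smaller block degree than \<open>m' * T_ij\<close>; those of \<open>T_ij'\<close> show that it has
  larger block degree.\<close>

lemma block_unique:
  assumes "TV i j \<in> V" "TV i j' \<in> V" "\<Delta> (\<Phi> (mvar (TV i j))) \<noteq> 0" "\<Delta> (\<Phi> (mvar (TV i j'))) \<noteq> 0"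
  shows "j = j'"
proof (rule ccontr)
  assume jj: "j \<noteq> j'"
  have i: "i \<in> {1..r}" "j \<in> {1..n i}" "j' \<in> {1..n i}" using assms(1,2) TV_in by blast+
  obtain m where m: "m \<in> ks (g (TV i j))" "lk m (TV i j) = 0" using nonzero_key[OF assms(1,3)] .
  obtain m' where m': "m' \<in> ks (g (TV i j'))" "lk m' (TV i j') = 0" using nonzero_key[OF assms(2,4)] .
  define q where "q = int (bdeg i (m + sg (TV i j') 1)) - int (bdeg i (m' + sg (TV i j) 1))"
  note w = compare_wt[OF assms(1,2) m(1) m'(1)]
  have "int (tlen i) * - (int (lk m' (TV i j)) + 1) = int (l i j) * q"
    using wtf_tm_block[OF w i(1) i(2)] m(2) jj unfolding q_def by (simp add: lookup_add lookup_single when_def algebra_simps)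
  moreover have "int (tlen i) * - (int (lk m' (TV i j)) + 1) < 0" using tlen_pos[OF i(1)] by (intro mult_pos_neg) auto
  moreover have "int (tlen i) * (int (lk m (TV i j')) + 1) = int (l i j') * q"
    using wtf_tm_block[OF w i(1) i(3)] m'(2) jj unfolding q_def by (simp add: lookup_add lookup_single when_def algebra_simps)
  moreover have "int (tlen i) * (int (lk m (TV i j')) + 1) > 0" using tlen_pos[OF i(1)] by (intro mult_pos_pos) auto
  ultimately show False by (simp add: mult_less_0_iff zero_less_mult_iff)
qed

text \<open>Once \<open>S_k\<close> moves, comparing exponents of \<open>S_k\<close> shows that no
  other variable does; the factor \<open>h\<close> is the image of \<open>S_k\<close>.\<close>

lemma vertical_case:
  assumes k: "k \<in> {1..d}" and nz: "\<Delta> (\<Phi> (mvar (SV k))) \<noteq> 0"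
  shows "\<exists>h\<in>carrier R. homogeneous_elem r n d l a h \<and> dS r n d l a k h = \<zero>\<^bsub>R\<^esub> \<and>
    (\<forall>f\<in>carrier R. \<delta> f = h \<otimes>\<^bsub>R\<^esub> dS r n d l a k f)"
proof -
  have V: "SV k \<in> V" using k by (simp add: SV_in)
  obtain m where m: "m \<in> ks (g (SV k))" "lk m (SV k) = 0" using nonzero_key[OF V nz] .
  have others: "\<Delta> (\<Phi> (mvar v)) = 0" if v: "v \<in> V" "v \<noteq> SV k" for v
  proof (rule ccontr)
    assume "\<Delta> (\<Phi> (mvar v)) \<noteq> 0"
    then obtain m' where m': "m' \<in> ks (g v)" using key_exists v(1) by blast
    \<comment> \<open>The left side is \<open>0\<close>, the right side at least
      \<open>1\<close>.\<close>
    have "lk (m + sg v 1) (SV k) = lk (m' + sg (SV k) 1) (SV k)"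
      by (rule wt_eq_SV[OF compare_wt[OF V v(1) m(1) m'] k])
    then show False using m(2) v(2) by (simp add: lookup_add lookup_single when_def)
  qed
  have chain: "\<Delta> (\<Phi> f) = \<Phi> (g (SV k)) * \<Phi> (pd (SV k) f)" if "f \<in> P" for f
  proof -
    have "(\<Sum>v\<in>V - {SV k}. \<Phi> (pd v f) * \<Delta> (\<Phi> (mvar v))) = 0" using others by (intro sum.neutral) auto
    then show ?thesis unfolding model_der_chain[OF der that] using V by (simp add: sum.remove \<Delta>_var mult.commute)
  qed
  have "lk m' (SV k) = 0" if "m' \<in> ks (g (SV k))" for m'
    using wt_eq_SV[OF has_wt_unique[OF g_wt[OF V that] g_wt[OF V m(1)]] k] m(2) by simp
  then have pd0: "pd (SV k) (g (SV k)) = 0" by (simp add: pd_def)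
  have "cls (g (SV k)) \<in> wspace (\<lambda>t. mon_eval t (sg (SV k) 1) * \<epsilon> t)"
    using hom[OF char_mon[of "sg (SV k) 1"]] mon_weight[of "sg (SV k) 1" 1] V by (auto simp: g mvar_def simp flip: g[OF V])
  moreover have "(\<lambda>t. mon_eval t (sg (SV k) 1) * \<epsilon> t) \<in> chars"
    using V by (intro char_mult char_mon \<epsilon>) simp
  ultimately have "homogeneous_elem r n d l a (cls (g (SV k)))" unfolding homogeneous_elem_def by blast
  moreover have "\<delta> f = cls (g (SV k)) \<otimes>\<^bsub>R\<^esub> dS r n d l a k f" if f: "f \<in> carrier R" for f
  proof -
    obtain p where p: "p \<in> P" "f = cls p" using f unfolding carrier_R by blast
    show ?thesis unfolding p(2) dS_cls[OF k p(1)] by (rule \<delta>_eq[OF g_in[OF V] pd_in chain p(1)])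
  qed
  moreover have "dS r n d l a k (cls (g (SV k))) = \<zero>\<^bsub>R\<^esub>"
    by (simp add: dS_cls[OF k g_in[OF V]] pd0 zero_R)
  ultimately show ?thesis using g_in[OF V] by (intro bexI[of _ "cls (g (SV k))"] conjI ballI) auto
qed

text \<open>The \<open>T_i^{l_i}\<close> agree up to constants. So if a variable of one block moves,
  all these monomials move, and with them a variable in every block, which
  \<open>block_unique\<close> makes unique.\<close>

lemma horizontal_choice:
  assumes i: "TV i j \<in> V" and nz: "\<Delta> (\<Phi> (mvar (TV i j))) \<noteq> 0"
  obtains c where "choice c" "\<And>i. i \<in> {1..r} \<Longrightarrow> \<Delta> (\<Phi> (mvar (TV i (c i)))) \<noteq> 0"
    "\<And>i j. i \<in> {1..r} \<Longrightarrow> j \<in> {1..n i} \<Longrightarrow> j \<noteq> c i \<Longrightarrow> \<Delta> (\<Phi> (mvar (TV i j))) = 0"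
proof -
  have i': "i \<in> {1..r}" "j \<in> {1..n i}" using i TV_in by blast+
  have "\<Delta> (\<Phi> (mvar (TV i j'))) = 0" if "j' \<in> {1..n i}" "j' \<noteq> j" for j'
    using block_unique[OF i _ nz, of j'] that i'(1) TV_in by blast
  then have "\<Delta> (\<Phi> (tri_mon n l i)) = \<Phi> (pd (TV i j) (tri_mon n l i)) * \<Delta> (\<Phi> (mvar (TV i j)))"
    by (rule model_der_tri_mon[OF der i'])
  then have x: "\<Delta> (\<Phi> (tri_mon n l i)) \<noteq> 0" using nz \<Phi>_pd_tri_mon_nz[OF i'] by simp
  have "\<exists>j\<in>{1..n k}. \<Delta> (\<Phi> (mvar (TV k j))) \<noteq> 0" if k: "k \<in> {1..r}" for k
  proof (rule ccontr)
    assume "\<not> ?thesis"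
    then have "\<Delta> (X (tm k)) = 0"
      by (intro model_der_X_ker[OF der keys_tm[OF k]]) (auto simp: in_keys_iff lookup_tm split: tvar.splits if_splits)
    then have "\<Delta> (\<Phi> (tri_mon n l k)) = 0" by (simp add: tri_mon_eq \<Phi>_mon)
    moreover have "\<Delta> (\<Phi> (tri_mon n l i)) = \<Delta> (\<Phi> (tri_mon n l k)) + \<Delta> (\<kappa> (b k - b i))"
      unfolding \<Phi>_tri_mon_diff[OF i'(1) k]
      by (rule der_add) (auto simp: tri_mon_in[OF k] simp flip: \<Phi>_mconst)
    ultimately show False using x model_der_const[OF der] by simp
  qed
  then obtain c where c: "\<And>k. k \<in> {1..r} \<Longrightarrow> c k \<in> {1..n k}" "\<And>k. k \<in> {1..r} \<Longrightarrow> \<Delta> (\<Phi> (mvar (TV k (c k)))) \<noteq> 0"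
    by metis
  show ?thesis
  proof (rule that)
    show "choice c" using c(1) by (auto simp: choice_def)
    show "\<Delta> (\<Phi> (mvar (TV i j))) = 0" if ij: "i \<in> {1..r}" "j \<in> {1..n i}" "j \<noteq> c i" for i j
      using block_unique[of i j "c i"] c[OF ij(1)] ij TV_in by blast
  qed (rule c(2))
qed

text \<open>\<open>T_i^{l_i}\<close> and \<open>T_k^{l_k}\<close> are powers of moved variables with
  coefficients \<open>X (rest i)\<close> and \<open>X (rest k)\<close> in the kernel, and they
  differ by a nonzero constant; \<open>power_diff_ker\<close> then lets at most one of the two
  exponents exceed \<open>1\<close>.\<close>

lemma horizontal_admissible:
  assumes c: "choice c" and nz: "\<And>i. i \<in> {1..r} \<Longrightarrow> \<Delta> (\<Phi> (mvar (TV i (c i)))) \<noteq> 0"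
    and z: "\<And>i j. i \<in> {1..r} \<Longrightarrow> j \<in> {1..n i} \<Longrightarrow> j \<noteq> c i \<Longrightarrow> \<Delta> (\<Phi> (mvar (TV i j))) = 0"
  shows "admissible r n l c"
proof -
  define rest where "rest i = tm i - sg (TV i (c i)) (l i (c i))" for i
  have lrest: "lk (rest i) v = (if v = TV i (c i) then 0 else lk (tm i) v)" if "i \<in> {1..r}" for i v
    using choiceD[OF c that] by (auto simp: rest_def lookup_minus lookup_single when_def lookup_tm)
  have krest: "ks (rest i) \<subseteq> V" if "i \<in> {1..r}" for i
    using keys_tm[OF that] by (auto simp: in_keys_iff lrest[OF that] split: if_splits)
  have tm: "\<Phi> (tri_mon n l i) = X (rest i) * \<Phi> (mvar (TV i (c i))) ^ l i (c i)" if i: "i \<in> {1..r}" for i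
  proof -
    have "tm i = rest i + sg (TV i (c i)) (l i (c i))" using choiceD[OF c i]
      by (intro poly_mapping_eqI) (auto simp: lookup_add lrest[OF i] lookup_single when_def lookup_tm)
    moreover have "sg (sg (TV i (c i)) k) 1 = (mvar (TV i (c i)) ^ k :: (tvar, 'a) mpol)" for k
      unfolding mon_eval_mvar[symmetric] by simp
    then have "X (sg (TV i (c i)) k) = \<Phi> (mvar (TV i (c i))) ^ k" for k by (metis \<Phi>_mon \<Phi>.power)
    ultimately show ?thesis by (simp add: tri_mon_eq \<Phi>_mon X_add)
  qed
  have ker: "\<Delta> (X (rest i)) = 0" if i: "i \<in> {1..r}" for i
  proof (rule model_der_X_ker[OF der krest[OF i]])
    fix v assume "v \<in> ks (rest i)"
    then obtain j where "v = TV i j" "j \<in> {1..n i}" "j \<noteq> c i"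
      by (cases v) (auto simp: in_keys_iff lrest[OF i] lookup_tm split: if_splits)
    then show "\<Delta> (\<Phi> (mvar v)) = 0" using z[OF i] by simp
  qed
  have two: "l i (c i) = 1 \<or> l k (c k) = 1" if ik: "i \<in> {1..r}" "k \<in> {1..r}" "i \<noteq> k" for i k
  proof (rule power_diff_ker)
    show "X (rest i) * \<Phi> (mvar (TV i (c i))) ^ l i (c i) - X (rest k) * \<Phi> (mvar (TV k (c k))) ^ l k (c k) = \<kappa> (b k - b i)"
      using \<Phi>_tri_mon_diff[OF ik(1,2)] unfolding tm[OF ik(1)] tm[OF ik(2)] by simp
    show "\<kappa> (b k - b i) \<noteq> 0" using inj_onD[OF inj_b, of k i] ik by (auto simp: \<kappa>_eq_0_iff)
    show "\<Delta> (\<kappa> (b k - b i)) = 0" by (rule model_der_const[OF der])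
    have V: "TV i (c i) \<in> V" "TV k (c k) \<in> V" using choiceD[OF c] ik TV_in by blast+
    show "\<Phi> (mvar (TV i (c i))) \<in> \<Phi> ` P" "\<Phi> (mvar (TV k (c k))) \<in> \<Phi> ` P" using V by auto
    show "X (rest i) \<in> \<Phi> ` P" "X (rest k) \<in> \<Phi> ` P"
      using krest[OF ik(1)] krest[OF ik(2)] by (auto simp: pr_single simp flip: \<Phi>_mon)
    show "1 \<le> l i (c i)" "1 \<le> l k (c k)" using l1 choiceD[OF c] ik by blast+
  qed (use nz ker ik in blast)+
  have "\<exists>i0\<in>{1..r}. \<forall>i\<in>{1..r} - {i0}. l i (c i) = 1"
  proof (cases "\<exists>i\<in>{1..r}. l i (c i) \<noteq> 1")
    case True then show ?thesis using two by blast
  next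
    case False then show ?thesis using r2 by (intro bexI[of _ 1]) auto
  qed
  then show ?thesis using choiceD[OF c] unfolding admissible_def by blast
qed

text \<open>The factor \<open>h\<close> is found in block \<open>i0\<close>: the image of the moved
  variable there is divisible by the partial derivatives belonging to the other blocks. As all
  \<open>T_i^{l_i}\<close> have the same image, the values on the other moved variables follow by
  cancellation.\<close>

lemma horizontal_case:
  assumes cC: "choice c" and nz: "\<And>i. i \<in> {1..r} \<Longrightarrow> \<Delta> (\<Phi> (mvar (TV i (c i)))) \<noteq> 0"
    and z: "\<And>i j. i \<in> {1..r} \<Longrightarrow> j \<in> {1..n i} \<Longrightarrow> j \<noteq> c i \<Longrightarrow> \<Delta> (\<Phi> (mvar (TV i j))) = 0"
    and S: "\<And>k. k \<in> {1..d} \<Longrightarrow> \<Delta> (\<Phi> (mvar (SV k))) = 0"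
  shows "\<exists>h\<in>carrier R. homogeneous_elem r n d l a h \<and> deltaC r n d l a c h = \<zero>\<^bsub>R\<^esub> \<and>
    (\<forall>f\<in>carrier R. \<delta> f = h \<otimes>\<^bsub>R\<^esub> deltaC r n d l a c f)"
proof -
  note cD = choiceD[OF cC]
  have V: "TV i (c i) \<in> V" if "i \<in> {1..r}" for i using cD[OF that] that by (simp add: TV_in)
  obtain i0 where i0: "i0 \<in> {1..r}" "\<And>i. i \<in> {1..r} - {i0} \<Longrightarrow> l i (c i) = 1"
    using admissibleD(2)[OF horizontal_admissible[OF cC nz z]] by blast
  define D where "D k = \<Phi> (pd (TV k (c k)) (tri_mon n l k))" for k
  \<comment> \<open>The exponents \<open>l k (c k)\<close> with \<open>k \<noteq> i0\<close> are
    \<open>1\<close>, so the product of these partial derivatives is a monomial with coefficient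
    \<open>1\<close>.\<close>
  define M where "M = (\<Sum>k\<in>{1..r} - {i0}. dmon k (c k))"
  define g0 where "g0 = g (TV i0 (c i0))"
  have g0P: "g0 \<in> P" unfolding g0_def by (rule g_in[OF V[OF i0(1)]])
  have XM: "X M = (\<Prod>k\<in>{1..r} - {i0}. D k)"
  proof -
    have "X (\<Sum>k\<in>A. dmon k (c k)) = (\<Prod>k\<in>A. D k)" if "A \<subseteq> {1..r} - {i0}" for A
      using that
    proof (induction A rule: infinite_finite_induct)
      case (insert k A)
      have kr: "k \<in> {1..r}" using insert by blast
      have "l k (c k) = 1" using insert i0(2) by blast
      then have "D k = X (dmon k (c k))" unfolding D_def pd_tri_mon[OF cD[OF kr]] by (simp add: \<Phi>_mon)
      then show ?case using insert by (simp add: X_add)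
    qed auto
    then show ?thesis unfolding M_def by blast
  qed
  have lM: "lk M (TV i j) = (if i \<in> {1..r} - {i0} then lk (dmon i (c i)) (TV i j) else 0)" for i j
  proof -
    have "lk M (TV i j) = (\<Sum>k\<in>{1..r} - {i0}. if k = i then lk (dmon i (c i)) (TV i j) else 0)"
      unfolding M_def lookup_sum by (intro sum.cong) (auto simp: lookup_dmon lookup_tm)
    then show ?thesis by simp
  qed
  have lMS: "lk M (SV k) = 0" for k unfolding M_def lookup_sum by (simp add: lookup_dmon lookup_tm)
  have kM: "ks M \<subseteq> V"
  proof
    fix v assume v: "v \<in> ks M"
    then obtain i j where ij: "v = TV i j" using lMS by (cases v) (auto simp: in_keys_iff)
    then have "i \<in> {1..r}" "v \<in> ks (dmon i (c i))" using v lM by (auto simp: in_keys_iff split: if_splits)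
    then show "v \<in> V" using keys_dmon by blast
  qed
  \<comment> \<open>Divisibility by \<open>M\<close> is checked exponent by exponent; it is
    nontrivial only at \<open>T_kj\<close> with \<open>k \<noteq> i0\<close> and
    \<open>j \<noteq> c k\<close>.\<close>
  have leM: "lk M v \<le> lk m v" if m: "m \<in> ks g0" for m v
  proof (cases v)
    case (TV k j)
    show ?thesis
    proof (cases "k \<in> {1..r} - {i0} \<and> j \<in> {1..n k} \<and> j \<noteq> c k")
      case True
      then have k: "k \<in> {1..r}" "k \<noteq> i0" "l k (c k) = 1" and j: "j \<in> {1..n k}" "j \<noteq> c k" using i0(2) by blast+
      obtain m' where m': "m' \<in> ks (g (TV k (c k)))" "lk m' (TV k (c k)) = 0" using nonzero_key[OF V[OF k(1)] nz[OF k(1)]] .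
      note w = compare_wt[OF V[OF i0(1)] V[OF k(1)] m[unfolded g0_def] m'(1)]
      define q where "q = int (bdeg k (m + sg (TV k (c k)) 1)) - int (bdeg k (m' + sg (TV i0 (c i0)) 1))"
      \<comment> \<open>At the index \<open>c k\<close> the exponent \<open>l k (c k) = 1\<close>
        determines \<open>q\<close>; inserted at \<open>j\<close>, this shows that the exponent of
        \<open>m\<close> there is at least \<open>l k j\<close>.\<close>
      have "int (tlen k) * (int (lk m (TV k (c k))) + 1) = q"
        using wtf_tm_block[OF w k(1) cD[OF k(1)]] m'(2) k(2,3) unfolding q_def by (simp add: lookup_add lookup_single when_def algebra_simps)
      moreover have "int (tlen k) * (int (lk m (TV k j)) - int (lk m' (TV k j))) = int (l k j) * q"
        using wtf_tm_block[OF w k(1) j(1)] k(2) j(2) unfolding q_def by (simp add: lookup_add lookup_single when_def algebra_simps)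
      ultimately have "int (tlen k) * (int (lk m (TV k j)) - int (lk m' (TV k j))) = int (tlen k) * (int (l k j) * (int (lk m (TV k (c k))) + 1))"
        by (simp add: mult.left_commute)
      then have "int (lk m (TV k j)) - int (lk m' (TV k j)) = int (l k j) * (int (lk m (TV k (c k))) + 1)"
        using tlen_pos[OF k(1)] by (simp only: mult_cancel_left) simp
      then have "int (lk m (TV k j)) = int (lk m' (TV k j) + l k j * (lk m (TV k (c k)) + 1))" by (simp add: algebra_simps)
      then have "lk m (TV k j) = lk m' (TV k j) + l k j * (lk m (TV k (c k)) + 1)" by (simp only: of_nat_eq_iff)
      moreover have "lk M v = l k j" using k j unfolding TV lM by (simp add: lookup_dmon lookup_tm)
      ultimately show ?thesis by (simp add: TV)
    next
      case False
      have "lk M v = 0"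
      proof (cases "k \<in> {1..r} - {i0}")
        case True
        then have 1: "l k (c k) = 1" by (rule i0(2))
        have "lk (dmon k (c k)) (TV k j) = 0"
        proof (cases "j = c k")
          case True then show ?thesis by (simp add: lookup_dmon lookup_tm 1)
        next
          case j: False
          then have "j \<notin> {1..n k}" using False True by blast
          then show ?thesis using j by (simp add: lookup_dmon lookup_tm del: atLeastAtMost_iff)
        qed
        then show ?thesis unfolding TV lM by simp
      next
        case False then show ?thesis unfolding TV lM by (simp only: if_False)
      qed
      then show ?thesis by simp
    qed
  qed (simp add: lMS)
  define h0 where "h0 = (\<Sum>m\<in>ks g0. sg (m - M) (lk g0 m))"
  have gh: "g0 = sg M 1 * h0"
  proof -
    have "sg M 1 * h0 = (\<Sum>m\<in>ks g0. sg m (lk g0 m))"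
      unfolding h0_def sum_distrib_left
    proof (rule sum.cong[OF refl])
      fix m assume "m \<in> ks g0"
      then have "M + (m - M) = m" using leM by (intro poly_mapping_eqI) (simp add: lookup_add lookup_minus)
      then show "sg M 1 * sg (m - M) (lk g0 m) = sg m (lk g0 m)" by (simp add: mult_single)
    qed
    then show ?thesis by (simp flip: mpol_eq_sum_single)
  qed
  have h0P: "h0 \<in> P" unfolding h0_def
  proof (intro pr_sum pr_single)
    fix m assume "m \<in> ks g0"
    then have "ks m \<subseteq> V" using g0P by (auto simp: poly_ring_carrier)
    then show "ks (m - M) \<subseteq> V" by (auto simp: in_keys_iff lookup_minus)
  qed
  have Dnz: "D i \<noteq> 0" if "i \<in> {1..r}" for i unfolding D_def by (rule \<Phi>_pd_tri_mon_nz[OF that cD[OF that]])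
  have \<tau>0: "\<Delta> (\<Phi> (mvar (TV i0 (c i0)))) = \<Phi> h0 * (\<Prod>k\<in>{1..r} - {i0}. D k)"
    unfolding \<Delta>_var[OF V[OF i0(1)]] g0_def[symmetric] gh \<Phi>.mult \<Phi>_mon XM by (rule mult.commute)
  have xD: "\<Delta> (\<Phi> (tri_mon n l i)) = D i * \<Delta> (\<Phi> (mvar (TV i (c i))))" if "i \<in> {1..r}" for i
    unfolding D_def by (rule model_der_tri_mon[OF der that cD[OF that] z[OF that]])
  have x: "\<Delta> (\<Phi> (tri_mon n l i)) = \<Phi> h0 * (\<Prod>k\<in>{1..r}. D k)" if i: "i \<in> {1..r}" for i
  proof -
    have "\<Delta> (\<Phi> (tri_mon n l i)) = \<Delta> (\<Phi> (tri_mon n l i0)) + \<Delta> (\<kappa> (b i0 - b i))"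
      unfolding \<Phi>_tri_mon_diff[OF i i0(1)]
      by (rule der_add) (auto simp: tri_mon_in[OF i0(1)] simp flip: \<Phi>_mconst)
    also have "\<dots> = D i0 * (\<Phi> h0 * (\<Prod>k\<in>{1..r} - {i0}. D k))"
      unfolding xD[OF i0(1)] \<tau>0 model_der_const[OF der] by simp
    also have "\<dots> = \<Phi> h0 * (\<Prod>k\<in>{1..r}. D k)"
      by (subst prod.remove[of "{1..r}" i0]) (use i0(1) in \<open>simp_all add: mult_ac\<close>)
    finally show ?thesis .
  qed
  have \<tau>: "\<Delta> (\<Phi> (mvar (TV i (c i)))) = \<Phi> h0 * (\<Prod>k\<in>{1..r} - {i}. D k)" if i: "i \<in> {1..r}" for i
  proof -
    have "D i * \<Delta> (\<Phi> (mvar (TV i (c i)))) = \<Phi> h0 * (\<Prod>k\<in>{1..r}. D k)" using xD[OF i] x[OF i] by simp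
    also have "\<dots> = D i * (\<Phi> h0 * (\<Prod>k\<in>{1..r} - {i}. D k))"
      by (subst prod.remove[of "{1..r}" i]) (use i in \<open>simp_all add: mult_ac\<close>)
    finally show ?thesis using Dnz[OF i] by simp
  qed
  have var: "\<Delta> (\<Phi> (mvar v)) = \<Phi> h0 * \<Phi> (deltaC_gen r n l c v)" if v: "v \<in> V" for v
  proof (cases v)
    case (TV i j)
    then have ij: "i \<in> {1..r}" "j \<in> {1..n i}" using v TV_in by blast+
    show ?thesis using \<tau>[OF ij(1)] z[OF ij] by (auto simp: TV D_def \<Phi>.prod)
  next
    case (SV k) then show ?thesis using S[of k] v by (simp add: SV_in)
  qed
  have chain: "\<Delta> (\<Phi> f) = \<Phi> h0 * \<Phi> (vec_field V (deltaC_gen r n l c) f)" if "f \<in> P" for f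
  proof -
    have "\<Delta> (\<Phi> f) = (\<Sum>v\<in>V. \<Phi> (pd v f) * (\<Phi> h0 * \<Phi> (deltaC_gen r n l c v)))"
      unfolding model_der_chain[OF der that] by (intro sum.cong refl) (simp only: var)
    then show ?thesis by (simp add: vec_field_def \<Phi>.sum \<Phi>.mult sum_distrib_left mult_ac)
  qed
  have h0nz: "\<Phi> h0 \<noteq> 0" using \<tau>0 nz[OF i0(1)] by auto
  \<comment> \<open>By \<open>chain\<close> the element \<open>h0\<close> divides its own image, so
    it lies in the kernel of \<open>\<Delta>\<close>; cancelling \<open>h0\<close> then shows that
    \<open>deltaC\<close> kills it too.\<close>
  have "\<Delta> (\<Phi> h0) = 0"
    using h0P by (intro dvd_der_imp_ker[OF _ _ chain[OF h0P]] imageI deltaC_P)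
  then have "\<Phi> (vec_field V (deltaC_gen r n l c) h0) = 0" using chain[OF h0P] h0nz by simp
  then have kerh: "deltaC r n d l a c (cls h0) = \<zero>\<^bsub>R\<^esub>"
    unfolding deltaC_cls[OF cC h0P] using deltaC_P[OF h0P, of c] by (simp add: cls_eq_zero_iff)
  have eq: "\<delta> f = cls h0 \<otimes>\<^bsub>R\<^esub> deltaC r n d l a c f" if f: "f \<in> carrier R" for f
  proof -
    obtain p where p: "p \<in> P" "f = cls p" using f unfolding carrier_R by blast
    show ?thesis unfolding p(2) deltaC_cls[OF cC p(1)] by (rule \<delta>_eq[OF h0P deltaC_P chain p(1)])
  qed
  define \<chi> where "\<chi> t = mon_eval t (sg (TV i0 (c i0)) 1) * \<epsilon> t" for t :: "tvar \<Rightarrow> 'a"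
  have ke: "ks (sg (TV i0 (c i0)) (1::nat)) \<subseteq> V" using V[OF i0(1)] by simp
  have "cls g0 \<in> wspace \<chi>"
    using hom[OF char_mon[OF ke]] mon_weight[OF ke, of 1] unfolding g0_def g[OF V[OF i0(1)], symmetric] \<chi>_def mvar_def by blast
  then have inI: "torus_act t g0 - mconst (\<chi> t) * g0 \<in> I" if "t \<in> T" for t
    using that weight_space_cls[OF g0P] by blast
  \<comment> \<open>The weight of \<open>h0\<close> is that of \<open>g0\<close> divided by the
    character of \<open>M\<close>; the factor \<open>M\<close> is cancelled modulo \<open>I\<close>,
    which is prime by \<open>domain_R\<close>.\<close>
  have "cls h0 \<in> wspace (\<lambda>t. \<chi> t * inverse (mon_eval t M))"
    unfolding weight_space_cls[OF h0P]
  proof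
    fix t :: "tvar \<Rightarrow> 'a" assume t: "t \<in> T"
    interpret t: coeff_hom "torus_act t" by (rule torus_act_hom)
    have "torus_act t (sg M 1 :: (tvar, 'a) mpol) = mconst (mon_eval t M) * sg M 1"
      by (simp add: torus_act_single flip: single_eq_mconst_mult)
    then have "sg M 1 * (mconst (mon_eval t M) * torus_act t h0 - mconst (\<chi> t) * h0) \<in> I"
      using inI[OF t] unfolding gh t.mult by (simp add: algebra_simps)
    moreover have "sg M 1 \<notin> I" using X_nz[of M] I_sub_ker[of "sg M 1"] by (auto simp: \<Phi>_mon)
    moreover have "mconst (mon_eval t M) * torus_act t h0 - mconst (\<chi> t) * h0 \<in> P"
      by (intro pr_diff pr_mult pr_mconst torus_act_in h0P)
    ultimately have "mconst (mon_eval t M) * torus_act t h0 - mconst (\<chi> t) * h0 \<in> I"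
      using domain_R[OF pr_single[OF kM, of 1]] by blast
    then have "mconst (inverse (mon_eval t M)) * (mconst (mon_eval t M) * torus_act t h0 - mconst (\<chi> t) * h0) \<in> I"
      by (rule I_mult) simp
    moreover have *: "mconst (inverse (mon_eval t M)) * mconst (mon_eval t M) = (1 :: (tvar, 'a) mpol)"
      using mon_eval_T_nz[OF t] by (simp flip: mconst.mult)
    then have "mconst (inverse (mon_eval t M)) * (mconst (mon_eval t M) * torus_act t h0 - mconst (\<chi> t) * h0)
      = torus_act t h0 - mconst (\<chi> t * inverse (mon_eval t M)) * h0"
      unfolding mult.commute[of "\<chi> t" "inverse (mon_eval t M)"] mconst.mult right_diff_distrib mult.assoc[symmetric] *
      by (simp only: mult_1_left)
    ultimately show "torus_act t h0 - mconst (\<chi> t * inverse (mon_eval t M)) * h0 \<in> I" by simp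
  qed
  moreover have "(\<lambda>t. \<chi> t * inverse (mon_eval t M)) \<in> chars"
    unfolding \<chi>_def by (intro char_mult char_mon char_inverse_mon \<epsilon> ke kM)
  ultimately have "homogeneous_elem r n d l a (cls h0)" unfolding homogeneous_elem_def by blast
  then show ?thesis using h0P kerh eq by (intro bexI[of _ "cls h0"] conjI ballI) auto
qed

end

section \<open>Assembling the classification\<close>

context trinomial
begin

text \<open>Representing the images of the variables by polynomials of the right weight gives the
  setting of \<open>homogeneous_lnd\<close>. By the chain rule some variable moves; the first form
  arises if some \<open>S_k\<close> does, the second if only variables \<open>T_ij\<close>
  do.\<close>

theorem homogeneous_lnd_form:
  assumes der: "derivation R (\<lambda>c. cls (mconst c)) \<delta>" and nil: "locally_nilpotent R \<delta>"
    and hom: "homogeneous_der r n d l a \<delta>" and nz: "\<exists>f\<in>carrier R. \<delta> f \<noteq> \<zero>\<^bsub>R\<^esub>"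
  shows "(\<exists>k\<in>{1..d}. \<exists>h\<in>carrier R. homogeneous_elem r n d l a h \<and> dS r n d l a k h = \<zero>\<^bsub>R\<^esub> \<and>
           (\<forall>f\<in>carrier R. \<delta> f = h \<otimes>\<^bsub>R\<^esub> dS r n d l a k f)) \<or>
        (\<exists>c. admissible r n l c \<and>
           (\<exists>h\<in>carrier R. homogeneous_elem r n d l a h \<and> deltaC r n d l a c h = \<zero>\<^bsub>R\<^esub> \<and>
              (\<forall>f\<in>carrier R. \<delta> f = h \<otimes>\<^bsub>R\<^esub> deltaC r n d l a c f)))"
proof -
  obtain \<epsilon> where \<epsilon>: "\<epsilon> \<in> chars" "\<And>\<chi>. \<chi> \<in> chars \<Longrightarrow> \<delta> ` wspace \<chi> \<subseteq> wspace (\<lambda>t. \<chi> t * \<epsilon> t)"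
    using hom unfolding homogeneous_der_def by blast
  have "\<exists>f. f \<in> P \<and> \<delta> (cls (mvar v)) = cls f \<and> (\<forall>m\<in>ks f. has_wt (\<lambda>t. mon_eval t (sg v 1) * \<epsilon> t) m)" if v: "v \<in> V" for v
  proof -
    have kv: "ks (sg v (1::nat)) \<subseteq> V" using v by simp
    have "\<delta> (cls (mvar v)) \<in> wspace (\<lambda>t. mon_eval t (sg v 1) * \<epsilon> t)"
      using \<epsilon>(2)[OF char_mon[OF kv]] mon_weight[OF kv, of 1] unfolding mvar_def by blast
    from weight_repr[OF this] show ?thesis by metis
  qed
  then have "\<forall>v. \<exists>f. v \<in> V \<longrightarrow> f \<in> P \<and> \<delta> (cls (mvar v)) = cls f \<and> (\<forall>m\<in>ks f. has_wt (\<lambda>t. mon_eval t (sg v 1) * \<epsilon> t) m)" by blast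
  from choice[OF this] obtain g where g: "\<forall>v. v \<in> V \<longrightarrow> g v \<in> P \<and> \<delta> (cls (mvar v)) = cls (g v) \<and>
      (\<forall>m\<in>ks (g v). has_wt (\<lambda>t. mon_eval t (sg v 1) * \<epsilon> t) m)" by blast
  interpret homogeneous_lnd r d n l a \<delta> \<epsilon> g
    by unfold_locales (use der nil \<epsilon> g in auto)
  have "\<exists>v\<in>V. model_der \<delta> (\<Phi> (mvar v)) \<noteq> 0"
  proof (rule ccontr)
    assume "\<not> ?thesis"
    then have "model_der \<delta> (\<Phi> p) = 0" if "p \<in> P" for p unfolding model_der_chain[OF der that] by (intro sum.neutral) auto
    then have "\<delta> (cls p) = \<zero>\<^bsub>R\<^esub>" if "p \<in> P" for p
      using derivation_repr[OF der that] model_der[of p _ \<delta>] that cls_eq_zero_iff by metis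
    then show False using nz unfolding carrier_R by blast
  qed
  then obtain v where v: "v \<in> V" "model_der \<delta> (\<Phi> (mvar v)) \<noteq> 0" by blast
  show ?thesis
  proof (cases "\<exists>k\<in>{1..d}. model_der \<delta> (\<Phi> (mvar (SV k))) \<noteq> 0")
    case True then show ?thesis using vertical_case by blast
  next
    case False
    then obtain i j where ij: "v = TV i j" using v SV_in by (cases v) auto
    obtain c where c: "choice c" "\<And>i. i \<in> {1..r} \<Longrightarrow> model_der \<delta> (\<Phi> (mvar (TV i (c i)))) \<noteq> 0"
      "\<And>i j. i \<in> {1..r} \<Longrightarrow> j \<in> {1..n i} \<Longrightarrow> j \<noteq> c i \<Longrightarrow> model_der \<delta> (\<Phi> (mvar (TV i j))) = 0"
      using horizontal_choice[of i j] v unfolding ij by blast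
    then show ?thesis using horizontal_admissible[OF c] horizontal_case[OF c] False by blast
  qed
qed

end

theorem theorem2p2:
  fixes r d :: nat and n :: "nat \<Rightarrow> nat" and l :: "nat \<Rightarrow> nat \<Rightarrow> nat"
    and a :: "nat \<Rightarrow> 'k::{alg_closed_field, field_char_0}"
  assumes "r \<ge> 2"
    and "\<forall>i\<in>{1..r}. n i \<ge> 1"
    and "\<forall>i\<in>{1..r}. \<forall>j\<in>{1..n i}. l i j \<ge> 1"
    and "inj_on a {1..r}"
  defines "R \<equiv> tri_alg r n d l a"
    and "cls \<equiv> tri_cls r n d l a"
  shows
    "(\<forall>\<delta>. derivation R (\<lambda>c. cls (mconst c)) \<delta> \<and> locally_nilpotent R \<delta> \<and>
          homogeneous_der r n d l a \<delta> \<and> (\<exists>f\<in>carrier R. \<delta> f \<noteq> \<zero>\<^bsub>R\<^esub>) \<longrightarrow>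
        (\<exists>k\<in>{1..d}. \<exists>h\<in>carrier R. homogeneous_elem r n d l a h \<and> dS r n d l a k h = \<zero>\<^bsub>R\<^esub> \<and>
           (\<forall>f\<in>carrier R. \<delta> f = h \<otimes>\<^bsub>R\<^esub> dS r n d l a k f)) \<or>
        (\<exists>c. admissible r n l c \<and>
           (\<exists>h\<in>carrier R. homogeneous_elem r n d l a h \<and> deltaC r n d l a c h = \<zero>\<^bsub>R\<^esub> \<and>
              (\<forall>f\<in>carrier R. \<delta> f = h \<otimes>\<^bsub>R\<^esub> deltaC r n d l a c f)))) \<and>
     (\<forall>k\<in>{1..d}. \<forall>h\<in>carrier R. homogeneous_elem r n d l a h \<and> dS r n d l a k h = \<zero>\<^bsub>R\<^esub> \<longrightarrow>
        (\<exists>F\<in>carrier (poly_ring {1..r}). \<exists>\<alpha> :: nat \<Rightarrow> nat \<Rightarrow> nat. \<exists>\<gamma> :: nat \<Rightarrow> nat.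
           h = cls (subst_vars (\<lambda>i. tri_mon n (\<lambda>i j. l i j div tri_gcd n l i) i) F *
                    (\<Prod>i = 1..r. \<Prod>j = 1..n i. mvar (TV i j) ^ \<alpha> i j) *
                    (\<Prod>p\<in>{1..d} - {k}. mvar (SV p) ^ \<gamma> p)))) \<and>
     (\<forall>c. admissible r n l c \<longrightarrow>
        (\<forall>h\<in>carrier R. homogeneous_elem r n d l a h \<and> deltaC r n d l a c h = \<zero>\<^bsub>R\<^esub> \<longrightarrow>
           (\<exists>u :: 'k. \<exists>\<alpha> :: nat \<Rightarrow> nat \<Rightarrow> nat. \<exists>\<gamma> :: nat \<Rightarrow> nat.
              h = cls (mconst u *
                       (\<Prod>i = 1..r. \<Prod>j\<in>{1..n i} - {c i}. mvar (TV i j) ^ \<alpha> i j) *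
                       (\<Prod>p = 1..d. mvar (SV p) ^ \<gamma> p)))))"
proof -
  interpret trinomial r d n l a
    by (rule trinomial.intro) (use assms(1-4) in blast)+
  show ?thesis
    unfolding R_def cls_def
    by (intro conjI allI ballI impI; elim conjE)
      (rule homogeneous_lnd_form ker_dS ker_deltaC; assumption)+
qed

end
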